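(* Fix $i \in \{1,\dots,n\}$, $u^i \in \mathbb{U}^i$ and $C^i \in \mathbb{C}^i$. The risk-limiting condition $$\mathrm{Var}\big[J_i^A[C^i,u^i]\big] \le S_i$$ holds if and only if there exists a unique (up to a set of measure zero) process $\gamma^i \in \Gamma^i$ such that $$C^i = \mathbb{E}\big[J_i^A[C^i,u^i]\big] - \int_0^T r_i^A(t,x_t^i,u_t^i)\,dt - \int_0^T \sigma_i^A(t)\,dW_t^i + \int_0^T \gamma_t^i\, dW_t^{(i)}$$ and $$\mathbb{E}\left[\int_0^T \|\gamma_t^i\|^2\,dt\right] \le S_i .$$
   Context: Fix $T>0$ and $n\ge 1$. On a probability space $(\Omega,\mathcal{F},\mathbb{P})$ let $W^0,W^1,\dots,W^n$ be mutually independent one-dimensional standard Brownian motions on $[0,T]$. For $i\in\{1,\dots,n\}$ put $W^{(i)}:=(W^0,W^i)$ (a two-dimensional Brownian motion) and let $\{\mathcal{F}_t^{(i)}\}_{0\le t\le T}$ be the filtration generated by $W^{(i)}$. Controls: $\mathcal{U}^i\subset\mathbb{R}$ is compact, and $\mathbb{U}^i$ is the set of $\mathcal{U}^i$-valued processes $u^i=\{u_t^i\}_{0\le t\le T}$ that are progressively measurable with respect to $\{\mathcal{F}_t^{(i)}\}$. Compensations: $\mathbb{C}^i$ is the set of real-valued $\mathcal{F}_T^{(i)}$-measurable random variables $C^i$. State: $x^i$ is the solution of $dx_t^i=f_i(x_t^i,u_t^i)\,dt$, $x_0^i=x^{0i}\in\mathbb{R}$, where $f_i:\mathbb{R}\times\mathcal{U}^i\to\mathbb{R}$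 is continuous, differentiable in its first argument, and for some constant $K$ satisfies $|\partial f_i(\boldsymbol{x},\boldsymbol{u})/\partial \boldsymbol{x}|\le K$ and $|f_i(\boldsymbol{x},\boldsymbol{u})|\le K(1+|\boldsymbol{x}|+|\boldsymbol{u}|)$ for all $(\boldsymbol{x},\boldsymbol{u})$. This has a unique solution, with $\mathbb{E}[\int_0^T (x_t^i)^2dt]<\infty$. Agent $i$'s payoff: $$J_i^A[C^i,u^i]:=\int_0^T r_i^A(t,x_t^i,u_t^i)\,dt+\int_0^T\sigma_i^A(t)\,dW_t^i+C^i,$$ where $r_i^A(t,\boldsymbol{x},\boldsymbol{u}):=-\mu_i(t)(l_i(t)+\boldsymbol{u})+r_i(\boldsymbol{x},\boldsymbol{u})$ and $\sigma_i^A(t):=-\mu_i(t)\tilde\sigma_i(t)$. Here $\mu_i,\tilde\sigma_i:[0,T]\to\mathbb{R}$ are bounded deterministic functions, $l_i:[0,T]\to\mathbb{R}$ is a deterministic function, and $r_i:\mathbb{R}\times\mathbb{R}\to\mathbb{R}$ is the agent's comfort function; all functions are measurable. It is assumed that there are constants $B_0,B_1$ with $|r_i^A(t,\boldsymbol{x},\boldsymbol{u})|\le B_0+B_1|\boldsymbol{x}|$ for all $t\in[0,T]$, $\boldsymbol{x}\in\mathbb{R}$, $\boldsymbol{u}\in\mathcal{U}^i$. $\Gamma^i$ is the set of $\mathbb{R}^{1\times 2}$-valued processes $\xi^i=\{(\xi_t^{i,1},\xi_t^{i,2})\}_{0\le t\le T}$ that are $\{\mathcal{F}_t^{(i)}\}$-progressively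 measurable and satisfy $\mathbb{E}[\int_0^T\|\xi_t^i\|^2dt]<\infty$. For $\xi^i\in\Gamma^i$, $\int_0^T\xi_t^i\,dW_t^{(i)}:=\int_0^T\xi_t^{i,1}dW_t^0+\int_0^T\xi_t^{i,2}dW_t^i$. $S_i\in\mathbb{R}$ is a given constant (the risk share of agent $i$). *)

theory Defs
  imports "HOL-Probability.Probability"
begin

section \<open>Filtrations and Brownian motion\<close>

definition natural_filtration ::
    "'a measure \<Rightarrow> (real \<Rightarrow> 'a \<Rightarrow> 'b::topological_space) \<Rightarrow> real \<Rightarrow> 'a measure" where
  "natural_filtration M X t =
     sigma (space M) {X s -` A \<inter> space M |s A. 0 \<le> s \<and> s \<le> t \<and> A \<in> sets borel}"

definition progressively_measurable ::
    "(real \<Rightarrow> 'a measure) \<Rightarrow> real \<Rightarrow> (real \<Rightarrow> 'a \<Rightarrow> 'b::topological_space) \<Rightarrow> bool" where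
  "progressively_measurable F T X \<longleftrightarrow>
     (\<forall>t\<in>{0..T}. (\<lambda>(s, \<omega>). X s \<omega>) \<in> borel_measurable (restrict_space borel {0..t} \<Otimes>\<^sub>M F t))"

definition standard_brownian_motion ::
    "'a measure \<Rightarrow> real \<Rightarrow> (real \<Rightarrow> 'a \<Rightarrow> real) \<Rightarrow> bool" where
  "standard_brownian_motion M T B \<longleftrightarrow>
     (\<forall>t\<in>{0..T}. B t \<in> borel_measurable M) \<and>
     (AE \<omega> in M. B 0 \<omega> = 0) \<and>
     (AE \<omega> in M. continuous_on {0..T} (\<lambda>t. B t \<omega>)) \<and>
     (\<forall>s t. 0 \<le> s \<and> s < t \<and> t \<le> T \<longrightarrow>
        distributed M lborel (\<lambda>\<omega>. B t \<omega> - B s \<omega>) (normal_density 0 (sqrt (t - s)))) \<and>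
     (\<forall>m (\<tau> :: nat \<Rightarrow> real).
        (\<forall>k\<le>m. \<tau> k \<in> {0..T}) \<and> (\<forall>k<m. \<tau> k \<le> \<tau> (Suc k)) \<longrightarrow>
        prob_space.indep_vars M (\<lambda>_. borel) (\<lambda>k \<omega>. B (\<tau> (Suc k)) \<omega> - B (\<tau> k) \<omega>) {..<m})"

text \<open>Processes are independent when they are independent as random elements of the path
  space with its product sigma-algebra.\<close>

definition independent_processes ::
    "'a measure \<Rightarrow> real \<Rightarrow> 'i set \<Rightarrow> ('i \<Rightarrow> real \<Rightarrow> 'a \<Rightarrow> real) \<Rightarrow> bool" where
  "independent_processes M T I W \<longleftrightarrow>
     prob_space.indep_vars M (\<lambda>_. PiM {0..T} (\<lambda>_. borel)) (\<lambda>i \<omega>. \<lambda>t\<in>{0..T}. W i t \<omega>) I"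

section \<open>The Ito integral\<close>

text \<open>A triple \<open>(m, \<tau>, \<eta>)\<close> stands for the step process that equals \<open>\<eta> k\<close> on the time
  interval from \<open>\<tau> k\<close> (excluded) to \<open>\<tau> (Suc k)\<close> (included), for \<open>k < m\<close>.\<close>

type_synonym 'a step_data = "nat \<times> (nat \<Rightarrow> real) \<times> (nat \<Rightarrow> 'a \<Rightarrow> real)"

definition step_data :: "(real \<Rightarrow> 'a measure) \<Rightarrow> real \<Rightarrow> 'a step_data \<Rightarrow> bool" where
  "step_data F T = (\<lambda>(m, \<tau>, \<eta>).
     \<tau> 0 = 0 \<and> \<tau> m = T \<and> (\<forall>k<m. \<tau> k < \<tau> (Suc k)) \<and>
     (\<forall>k<m. \<eta> k \<in> borel_measurable (F (\<tau> k))) \<and>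
     (\<exists>B. \<forall>k<m. \<forall>\<omega>\<in>space (F (\<tau> k)). \<bar>\<eta> k \<omega>\<bar> \<le> B))"

definition step_process :: "'a step_data \<Rightarrow> real \<Rightarrow> 'a \<Rightarrow> real" where
  "step_process = (\<lambda>(m, \<tau>, \<eta>) t \<omega>. \<Sum>k<m. \<eta> k \<omega> * indicator {\<tau> k<..\<tau> (Suc k)} t)"

definition step_integral :: "(real \<Rightarrow> 'a \<Rightarrow> real) \<Rightarrow> 'a step_data \<Rightarrow> 'a \<Rightarrow> real" where
  "step_integral B = (\<lambda>(m, \<tau>, \<eta>) \<omega>. \<Sum>k<m. \<eta> k \<omega> * (B (\<tau> (Suc k)) \<omega> - B (\<tau> k) \<omega>))"

definition has_ito_integral ::
    "'a measure \<Rightarrow> (real \<Rightarrow> 'a measure) \<Rightarrow> real \<Rightarrow> (real \<Rightarrow> 'a \<Rightarrow> real) \<Rightarrow>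
      (real \<Rightarrow> 'a \<Rightarrow> real) \<Rightarrow> ('a \<Rightarrow> real) \<Rightarrow> bool" where
  "has_ito_integral M F T B \<xi> I \<longleftrightarrow>
     I \<in> borel_measurable M \<and>
     (\<exists>\<phi> :: nat \<Rightarrow> 'a step_data.
        (\<forall>j. step_data F T (\<phi> j)) \<and>
        (\<lambda>j. \<integral>\<^sup>+\<omega>. (\<integral>\<^sup>+t\<in>{0..T}. ennreal ((\<xi> t \<omega> - step_process (\<phi> j) t \<omega>)\<^sup>2) \<partial>lborel) \<partial>M)
          \<longlonglongrightarrow> 0 \<and>
        (\<lambda>j. \<integral>\<^sup>+\<omega>. ennreal ((I \<omega> - step_integral B (\<phi> j) \<omega>)\<^sup>2) \<partial>M) \<longlonglongrightarrow> 0)"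

text \<open>If \<open>B\<close> is a Brownian motion relative to \<open>F\<close> and \<open>\<xi>\<close> is progressively measurable and
  square-integrable, the integral exists and is determined up to a null set; the choice
  below picks one version.\<close>

definition ito_integral ::
    "'a measure \<Rightarrow> (real \<Rightarrow> 'a measure) \<Rightarrow> real \<Rightarrow> (real \<Rightarrow> 'a \<Rightarrow> real) \<Rightarrow>
      (real \<Rightarrow> 'a \<Rightarrow> real) \<Rightarrow> 'a \<Rightarrow> real" where
  "ito_integral M F T B \<xi> = (SOME I. has_ito_integral M F T B \<xi> I)"

definition ito_integral2 ::
    "'a measure \<Rightarrow> (real \<Rightarrow> 'a measure) \<Rightarrow> real \<Rightarrow> (real \<Rightarrow> 'a \<Rightarrow> real) \<Rightarrow> (real \<Rightarrow> 'a \<Rightarrow> real) \<Rightarrow>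
      (real \<Rightarrow> 'a \<Rightarrow> real \<times> real) \<Rightarrow> 'a \<Rightarrow> real" where
  "ito_integral2 M F T B1 B2 \<xi> \<omega> =
     ito_integral M F T B1 (\<lambda>t \<omega>. fst (\<xi> t \<omega>)) \<omega> + ito_integral M F T B2 (\<lambda>t \<omega>. snd (\<xi> t \<omega>)) \<omega>"

text \<open>The norm of \<open>real \<times> real\<close> is the Euclidean one.\<close>

definition square_integrable_processes ::
    "'a measure \<Rightarrow> (real \<Rightarrow> 'a measure) \<Rightarrow> real \<Rightarrow> (real \<Rightarrow> 'a \<Rightarrow> real \<times> real) set" where
  "square_integrable_processes M F T =
     {\<xi>. progressively_measurable F T \<xi> \<and>
         (\<integral>\<^sup>+\<omega>. (\<integral>\<^sup>+t\<in>{0..T}. ennreal ((norm (\<xi> t \<omega>))\<^sup>2) \<partial>lborel) \<partial>M) < \<infinity>}"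

section \<open>The agent's problem\<close>

definition controls ::
    "'a measure \<Rightarrow> (real \<Rightarrow> 'a measure) \<Rightarrow> real \<Rightarrow> real set \<Rightarrow> (real \<Rightarrow> 'a \<Rightarrow> real) set" where
  "controls M F T U =
     {u. progressively_measurable F T u \<and> (\<forall>t\<in>{0..T}. \<forall>\<omega>\<in>space M. u t \<omega> \<in> U)}"

definition compensations :: "(real \<Rightarrow> 'a measure) \<Rightarrow> real \<Rightarrow> ('a \<Rightarrow> real) set" where
  "compensations F T = borel_measurable (F T)"

text \<open>The state equation has no noise term and is read path by path, in integral form.\<close>

definition state_solution ::
    "'a measure \<Rightarrow> real \<Rightarrow> (real \<Rightarrow> real \<Rightarrow> real) \<Rightarrow> real \<Rightarrow> (real \<Rightarrow> 'a \<Rightarrow> real) \<Rightarrow>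
      (real \<Rightarrow> 'a \<Rightarrow> real) \<Rightarrow> bool" where
  "state_solution M T f x0 u x \<longleftrightarrow>
     (\<forall>\<omega>\<in>space M.
        set_integrable lborel {0..T} (\<lambda>s. f (x s \<omega>) (u s \<omega>)) \<and>
        (\<forall>t\<in>{0..T}. x t \<omega> = x0 + (LBINT s:{0..t}. f (x s \<omega>) (u s \<omega>))))"

definition agent_reward ::
    "(real \<Rightarrow> real) \<Rightarrow> (real \<Rightarrow> real) \<Rightarrow> (real \<Rightarrow> real \<Rightarrow> real) \<Rightarrow> real \<Rightarrow> real \<Rightarrow> real \<Rightarrow> real" where
  "agent_reward \<mu> l r t x u = - \<mu> t * (l t + u) + r x u"

definition agent_volatility :: "(real \<Rightarrow> real) \<Rightarrow> (real \<Rightarrow> real) \<Rightarrow> real \<Rightarrow> real" where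
  "agent_volatility \<mu> \<sigma> t = - \<mu> t * \<sigma> t"

definition agent_payoff ::
    "'a measure \<Rightarrow> (real \<Rightarrow> 'a measure) \<Rightarrow> real \<Rightarrow> (real \<Rightarrow> 'a \<Rightarrow> real) \<Rightarrow>
      (real \<Rightarrow> real \<Rightarrow> real \<Rightarrow> real) \<Rightarrow> (real \<Rightarrow> real) \<Rightarrow>
      (real \<Rightarrow> 'a \<Rightarrow> real) \<Rightarrow> ('a \<Rightarrow> real) \<Rightarrow> (real \<Rightarrow> 'a \<Rightarrow> real) \<Rightarrow> 'a \<Rightarrow> real" where
  "agent_payoff M F T B rA \<sigma>A x C u \<omega> =
     (LBINT t:{0..T}. rA t (x t \<omega>) (u t \<omega>)) + ito_integral M F T B (\<lambda>t _. \<sigma>A t) \<omega> + C \<omega>"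

text \<open>The Bochner-integral variance of the library is 0 for a variable without second moment,
  where the variance is infinite; hence the integrability conjunct.\<close>

definition variance_at_most :: "'a measure \<Rightarrow> ('a \<Rightarrow> real) \<Rightarrow> real \<Rightarrow> bool" where
  "variance_at_most M X S \<longleftrightarrow> integrable M (\<lambda>\<omega>. (X \<omega>)\<^sup>2) \<and> prob_space.variance M X \<le> S"

end

theory Submission
  imports Defs
begin

text \<open>
  Put \<open>J = R + Z + C\<close> with the running reward \<open>R\<close> and the noise term \<open>Z\<close>. The displayed formula for
  \<open>C\<close> is a rearrangement of \<open>J = \<E>[J] + \<integral>\<gamma> dW\<close>, and the Ito isometry turns \<open>\<E>\<integral>\<parallel>\<gamma>\<parallel>\<^sup>2 dt\<close> into \<open>Var J\<close>. So the
  claim is the predictable representation theorem for the two-dimensional Brownian motion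
  \<open>(W\<^sup>0, W\<^sup>i)\<close>: every square-integrable functional \<open>X\<close> of the paths up to \<open>T\<close> equals \<open>\<E>[X] + \<integral>\<gamma> dW\<close>
  for a progressive \<open>\<gamma>\<close>, which the isometry makes unique (lemma \<open>variance_at_most_iff_represented\<close>).
  Everything up to that lemma is done for a Brownian family with a finite index type.

  The integral. Integrands are first finite lists of blocks \<open>\<eta> 1\<^bsub>(s,t]\<^esub>\<close> on a chosen coordinate. Since the
  increments after time \<open>s\<close> are independent of the past, the isometry for such lists
  (\<open>list_isometry\<close>) is a computation with second moments. Averages over the preceding cell of a
  uniform grid show that step processes are dense among progressive processes
  (\<open>average_step_tendsto\<close>, by Lebesgue's differentiation theorem), and completeness of \<open>L\<^sup>2\<close> gives the
  integral (\<open>ito_integral_exists\<close>).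

  The representation. Call \<open>X\<close> reachable if it is a mean-square limit of constants plus integrals of
  lists. For Gaussian \<open>\<Delta>\<close> of variance \<open>v\<close> the variable
  \<open>exp (i\<Delta> + v/2) - 1 - i\<Delta>\<close> is centred with second moment \<open>O(v\<^sup>2)\<close>, so telescoping an exponential
  martingale over a grid of mesh \<open>h\<close> writes it as an elementary integral up to a sum of orthogonal
  terms of total size \<open>O(h)\<close> (\<open>cos_increment_reachable\<close>). Hence every cosine of a linear combination of
  the values \<open>W\<^bsub>r\<^esub>\<close> is reachable. These cosines span an algebra of bounded functions generating the
  terminal sigma-algebra, and such an algebra is mean-square dense (\<open>dense\<close>). For a reachable \<open>X\<close> the
  approximating integrands are Cauchy by the isometry, and their limit is \<open>\<gamma>\<close>
  (\<open>martingale_representation\<close>).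

  The measurability of \<open>J\<close> rests on that of the state, which is the limit of Picard iterates
  (\<open>integral_equation_measurable\<close>).
\<close>

section \<open>Mean-square distance\<close>

text \<open>Valued in \<open>ennreal\<close>, so that distances can be compared before anything is known to be
  square-integrable.\<close>

definition sqdist :: "'a measure \<Rightarrow> ('a \<Rightarrow> real) \<Rightarrow> ('a \<Rightarrow> real) \<Rightarrow> ennreal" where
  "sqdist M f g = (\<integral>\<^sup>+x. ennreal ((f x - g x)\<^sup>2) \<partial>M)"

lemma sqdist_self [simp]: "sqdist M f f = 0"
  by (simp add: sqdist_def)

lemma sqdist_commute: "sqdist M f g = sqdist M g f"
  by (simp add: sqdist_def power2_commute)

lemma sqdist_cong_AE:
  assumes "AE x in M. f x = f' x" "AE x in M. g x = g' x"
  shows "sqdist M f g = sqdist M f' g'"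
  unfolding sqdist_def using assms by (intro nn_integral_cong_AE) auto

lemma sqdist_triangle:
  assumes [measurable]: "f \<in> borel_measurable M" "g \<in> borel_measurable M" "h \<in> borel_measurable M"
  shows "sqdist M f h \<le> 2 * sqdist M f g + 2 * sqdist M g h"
proof -
  have "(f x - h x)\<^sup>2 \<le> 2 * (f x - g x)\<^sup>2 + 2 * (g x - h x)\<^sup>2" for x
    using zero_le_power2[of "(f x - g x) - (g x - h x)"] by (simp add: power2_eq_square algebra_simps)
  then have "sqdist M f h \<le> (\<integral>\<^sup>+x. ennreal (2 * (f x - g x)\<^sup>2 + 2 * (g x - h x)\<^sup>2) \<partial>M)"
    unfolding sqdist_def by (intro nn_integral_mono ennreal_leI)
  also have "\<dots> = (\<integral>\<^sup>+x. 2 * ennreal ((f x - g x)\<^sup>2) + 2 * ennreal ((g x - h x)\<^sup>2) \<partial>M)"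
    by (intro nn_integral_cong) (simp add: ennreal_plus ennreal_mult)
  also have "\<dots> = 2 * sqdist M f g + 2 * sqdist M g h"
    unfolding sqdist_def by (simp add: nn_integral_add nn_integral_cmult)
  finally show ?thesis .
qed

lemma sqdist_eq_0D:
  assumes [measurable]: "f \<in> borel_measurable M" "g \<in> borel_measurable M"
    and "sqdist M f g = 0"
  shows "AE x in M. f x = g x"
  using assms(3) unfolding sqdist_def by (subst (asm) nn_integral_0_iff_AE) auto

lemma sqdist_eq_integral:
  assumes "integrable M (\<lambda>x. (f x - g x)\<^sup>2)"
  shows "sqdist M f g = ennreal (\<integral>x. (f x - g x)\<^sup>2 \<partial>M)"
  unfolding sqdist_def by (intro nn_integral_eq_integral assms) auto

lemma sqdist_finite_imp_integrable:
  assumes [measurable]: "f \<in> borel_measurable M" "g \<in> borel_measurable M"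
    and "sqdist M f g < \<infinity>"
  shows "integrable M (\<lambda>x. (f x - g x)\<^sup>2)"
  using assms(3) unfolding sqdist_def by (intro integrableI_bounded) (auto simp: )

lemma sqdist_add:
  assumes [measurable]: "f \<in> borel_measurable M" "g \<in> borel_measurable M"
    "f' \<in> borel_measurable M" "g' \<in> borel_measurable M"
  shows "sqdist M (\<lambda>x. f x + f' x) (\<lambda>x. g x + g' x) \<le> 2 * sqdist M f g + 2 * sqdist M f' g'"
proof -
  have "sqdist M (\<lambda>x. f x + f' x) (\<lambda>x. g x + g' x) =
      sqdist M (\<lambda>x. f x - g x) (\<lambda>x. g' x - f' x)"
    unfolding sqdist_def by (intro nn_integral_cong) (simp add: algebra_simps)
  also have "\<dots> \<le> 2 * sqdist M (\<lambda>x. f x - g x) (\<lambda>_. 0) + 2 * sqdist M (\<lambda>_. 0) (\<lambda>x. g' x - f' x)"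
    by (rule sqdist_triangle) auto
  also have "\<dots> = 2 * sqdist M f g + 2 * sqdist M f' g'"
    by (simp add: sqdist_def power2_commute)
  finally show ?thesis .
qed

lemma sqdist_diff:
  assumes [measurable]: "f \<in> borel_measurable M" "g \<in> borel_measurable M"
    "f' \<in> borel_measurable M" "g' \<in> borel_measurable M"
  shows "sqdist M (\<lambda>x. f x - f' x) (\<lambda>x. g x - g' x) \<le> 2 * sqdist M f g + 2 * sqdist M f' g'"
proof -
  have "sqdist M (\<lambda>x. f x + - f' x) (\<lambda>x. g x + - g' x)
      \<le> 2 * sqdist M f g + 2 * sqdist M (\<lambda>x. - f' x) (\<lambda>x. - g' x)"
    by (rule sqdist_add) auto
  also have "sqdist M (\<lambda>x. - f' x) (\<lambda>x. - g' x) = sqdist M f' g'"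
    unfolding sqdist_def by (intro nn_integral_cong) (simp add: power2_commute)
  finally show ?thesis by simp
qed

lemma sqdist_cmult: "sqdist M (\<lambda>x. c * f x) (\<lambda>x. c * g x) = ennreal (c\<^sup>2) * sqdist M f g"
  if [measurable]: "f \<in> borel_measurable M" "g \<in> borel_measurable M"
proof -
  have "sqdist M (\<lambda>x. c * f x) (\<lambda>x. c * g x) = (\<integral>\<^sup>+x. ennreal (c\<^sup>2) * ennreal ((f x - g x)\<^sup>2) \<partial>M)"
    unfolding sqdist_def
    by (intro nn_integral_cong) (simp add: ennreal_mult[symmetric] power_mult_distrib[symmetric] right_diff_distrib)
  then show ?thesis by (simp add: sqdist_def nn_integral_cmult)
qed

lemma ennreal_tendsto_0I:
  assumes "\<And>e :: real. 0 < e \<Longrightarrow> eventually (\<lambda>n. f n \<le> ennreal e) F"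
  shows "(f \<longlongrightarrow> 0) F"
proof (rule order_tendstoI)
  fix a :: ennreal assume "0 < a"
  then obtain b where b: "0 < b" "b < a" using dense by blast
  obtain e where "0 < e" "ennreal e < a"
  proof (cases b rule: ennreal_cases)
    case (real e)
    with b show thesis by (intro that[of e]) (auto simp: ennreal_less_zero_iff)
  next
    case top
    with b show thesis by simp
  qed
  with assms[of e] show "eventually (\<lambda>n. f n < a) F"
    by (auto elim!: eventually_mono)
qed auto

lemma ennreal_tendsto_0D:
  assumes "(f \<longlongrightarrow> 0) F" "0 < (e::real)"
  shows "eventually (\<lambda>n. f n \<le> ennreal e) F"
  using order_tendstoD(2)[OF assms(1), of "ennreal e"] assms(2)
  by (auto elim!: eventually_mono)

lemma square_integrable_prod:
  fixes f g :: "'a \<Rightarrow> real"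
  assumes [measurable]: "f \<in> borel_measurable M" "g \<in> borel_measurable M"
    and "integrable M (\<lambda>x. (f x)\<^sup>2)" "integrable M (\<lambda>x. (g x)\<^sup>2)"
  shows "integrable M (\<lambda>x. f x * g x)"
proof (rule Bochner_Integration.integrable_bound)
  show "integrable M (\<lambda>x. (f x)\<^sup>2 + (g x)\<^sup>2)" using assms by auto
  have "\<bar>f x * g x\<bar> \<le> (f x)\<^sup>2 + (g x)\<^sup>2" for x
  proof -
    have "0 \<le> (\<bar>f x\<bar> - \<bar>g x\<bar>)\<^sup>2" by simp
    then have "2 * \<bar>f x * g x\<bar> \<le> (f x)\<^sup>2 + (g x)\<^sup>2" by (simp add: power2_diff abs_mult)
    then show ?thesis using abs_ge_zero[of "f x * g x"] by linarith
  qed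
  then show "AE x in M. norm (f x * g x) \<le> norm ((f x)\<^sup>2 + (g x)\<^sup>2)" by auto
qed simp

lemma square_integrable_add:
  fixes f g :: "'a \<Rightarrow> real"
  assumes [measurable]: "f \<in> borel_measurable M" "g \<in> borel_measurable M"
    and "integrable M (\<lambda>x. (f x)\<^sup>2)" "integrable M (\<lambda>x. (g x)\<^sup>2)"
  shows "integrable M (\<lambda>x. (f x + g x)\<^sup>2)"
  using assms square_integrable_prod[OF assms] by (simp add: power2_sum mult.assoc)

lemma square_integrable_diff:
  fixes f g :: "'a \<Rightarrow> real"
  assumes [measurable]: "f \<in> borel_measurable M" "g \<in> borel_measurable M"
    and "integrable M (\<lambda>x. (f x)\<^sup>2)" "integrable M (\<lambda>x. (g x)\<^sup>2)"
  shows "integrable M (\<lambda>x. (f x - g x)\<^sup>2)"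
  using assms square_integrable_prod[OF assms] by (simp add: power2_diff mult.assoc)

text \<open>By \<open>\<bar>a\<^sup>2 - b\<^sup>2\<bar> \<le> (1 + 1/\<epsilon>) (a - b)\<^sup>2 + \<epsilon> b\<^sup>2\<close>.\<close>

lemma integral_square_tendsto:
  fixes f :: "nat \<Rightarrow> 'a \<Rightarrow> real"
  assumes f [measurable]: "\<And>n. f n \<in> borel_measurable M" and g [measurable]: "g \<in> borel_measurable M"
    and f2: "\<And>n. integrable M (\<lambda>x. (f n x)\<^sup>2)"
    and lim: "(\<lambda>n. sqdist M (f n) g) \<longlonglongrightarrow> 0"
  shows "integrable M (\<lambda>x. (g x)\<^sup>2)"
    and "(\<lambda>n. \<integral>x. (f n x)\<^sup>2 \<partial>M) \<longlonglongrightarrow> (\<integral>x. (g x)\<^sup>2 \<partial>M)"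
proof -
  obtain n where "sqdist M (f n) g \<le> ennreal 1"
    using ennreal_tendsto_0D[OF lim, of 1] by (auto simp: eventually_sequentially)
  then have "integrable M (\<lambda>x. (f n x - g x)\<^sup>2)"
    by (intro sqdist_finite_imp_integrable) (auto simp: order_le_less_trans)
  from square_integrable_diff[OF _ _ f2[of n] this]
  show g2: "integrable M (\<lambda>x. (g x)\<^sup>2)" by simp
  have d2: "integrable M (\<lambda>x. (f n x - g x)\<^sup>2)" for n
    by (intro square_integrable_diff f2 g2 f g)
  define d where "d n = (\<integral>x. (f n x - g x)\<^sup>2 \<partial>M)" for n
  have "(\<lambda>n. ennreal (d n)) \<longlonglongrightarrow> ennreal 0"
    using lim by (simp add: sqdist_eq_integral[OF d2] d_def)
  then have d0: "d \<longlonglongrightarrow> 0"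
    by (subst (asm) tendsto_ennreal_iff) (auto simp: d_def)
  define b where "b = (\<integral>x. (g x)\<^sup>2 \<partial>M)"
  have "b \<ge> 0" by (auto simp: b_def)
  have bound: "\<bar>(\<integral>x. (f n x)\<^sup>2 \<partial>M) - b\<bar> \<le> (1 + 1/e) * d n + e * b" if "e > 0" for n e
  proof -
    have pt: "\<bar>(f n x)\<^sup>2 - (g x)\<^sup>2\<bar> \<le> (1 + 1/e) * (f n x - g x)\<^sup>2 + e * (g x)\<^sup>2" for x
    proof -
      define u v where "u = f n x - g x" and "v = g x"
      have "0 \<le> (\<bar>u\<bar> / sqrt e - sqrt e * \<bar>v\<bar>)\<^sup>2" by simp
      then have "2 * \<bar>u * v\<bar> \<le> 1/e * u\<^sup>2 + e * v\<^sup>2"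
        using that by (simp add: power2_diff power_divide power_mult_distrib abs_mult)
      moreover have "(f n x)\<^sup>2 - (g x)\<^sup>2 = u\<^sup>2 + 2 * (u * v)"
        by (simp add: u_def v_def power2_eq_square algebra_simps)
      moreover have "u\<^sup>2 \<ge> 0" by simp
      ultimately have "\<bar>(f n x)\<^sup>2 - (g x)\<^sup>2\<bar> \<le> u\<^sup>2 + (1/e * u\<^sup>2 + e * v\<^sup>2)" by linarith
      then show ?thesis by (simp add: u_def v_def algebra_simps)
    qed
    have "\<bar>(\<integral>x. (f n x)\<^sup>2 \<partial>M) - b\<bar> = \<bar>\<integral>x. (f n x)\<^sup>2 - (g x)\<^sup>2 \<partial>M\<bar>"
      by (simp add: b_def f2 g2)
    also have "\<dots> \<le> (\<integral>x. \<bar>(f n x)\<^sup>2 - (g x)\<^sup>2\<bar> \<partial>M)" by (rule integral_abs_bound)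
    also have "\<dots> \<le> (\<integral>x. (1 + 1/e) * (f n x - g x)\<^sup>2 + e * (g x)\<^sup>2 \<partial>M)"
      by (intro integral_mono pt) (auto intro!: f2 g2 d2)
    also have "\<dots> = (1 + 1/e) * d n + e * b" by (simp add: d_def b_def d2 g2)
    finally show ?thesis .
  qed
  show "(\<lambda>n. \<integral>x. (f n x)\<^sup>2 \<partial>M) \<longlonglongrightarrow> (\<integral>x. (g x)\<^sup>2 \<partial>M)"
    unfolding b_def[symmetric]
  proof (rule LIMSEQ_I)
    fix r :: real assume "r > 0"
    define e where "e = r / (2 * (b + 1))"
    have e: "e > 0" "e * b < r / 2" using \<open>r > 0\<close> \<open>b \<ge> 0\<close> by (auto simp: e_def field_simps)
    have "(\<lambda>n. (1 + 1/e) * d n) \<longlonglongrightarrow> (1 + 1/e) * 0" by (intro tendsto_intros d0)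
    then have "eventually (\<lambda>n. (1 + 1/e) * d n < r / 2) sequentially"
      using \<open>r > 0\<close> by (intro order_tendstoD(2)) auto
    then obtain N where "\<And>n. n \<ge> N \<Longrightarrow> (1 + 1/e) * d n < r / 2"
      by (auto simp: eventually_sequentially)
    then have "\<And>n. n \<ge> N \<Longrightarrow> \<bar>(\<integral>x. (f n x)\<^sup>2 \<partial>M) - b\<bar> < r"
      using bound[OF e(1)] e(2) by (smt (verit) field_sum_of_halves)
    then show "\<exists>N. \<forall>n\<ge>N. norm ((\<integral>x. (f n x)\<^sup>2 \<partial>M) - b) < r" by auto
  qed
qed

text \<open>Riesz--Fischer. Along a subsequence with \<open>\<Sum>\<^sub>k 2\<^sup>k \<parallel>f\<^bsub>r k\<^esub> - f\<^bsub>r (k+1)\<^esub>\<parallel>\<^sup>2 < \<infinity>\<close> the increments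
  are absolutely summable almost everywhere. The limit is given as an explicit pointwise limit,
  because progressive measurability has to be read off it.\<close>

lemma sqdist_complete:
  fixes f :: "nat \<Rightarrow> 'a \<Rightarrow> real"
  assumes f [measurable]: "\<And>n. f n \<in> borel_measurable M"
    and Cauchy: "\<And>e::real. 0 < e \<Longrightarrow> \<exists>N. \<forall>m\<ge>N. \<forall>n\<ge>N. sqdist M (f m) (f n) \<le> ennreal e"
  obtains r where "strict_mono r" "AE x in M. convergent (\<lambda>k. f (r k) x)"
    "(\<lambda>n. sqdist M (f n) (\<lambda>x. lim (\<lambda>k. f (r k) x))) \<longlonglongrightarrow> 0"
proof -
  have "\<exists>N. \<forall>k. \<forall>m\<ge>N k. \<forall>n\<ge>N k. sqdist M (f m) (f n) \<le> ennreal ((1/4)^k)"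
    by (intro choice allI Cauchy) simp
  then obtain N where N: "\<And>k m n. m \<ge> N k \<Longrightarrow> n \<ge> N k \<Longrightarrow> sqdist M (f m) (f n) \<le> ennreal ((1/4)^k)"
    by blast
  \<comment> \<open>strictly increasing and beyond each threshold \<open>N k\<close>\<close>
  define r where "r k = k + (\<Sum>j\<le>k. N j)" for k
  have r: "strict_mono r" by (auto simp: r_def strict_mono_Suc_iff)
  have rN: "r k \<ge> N k" for k unfolding r_def by (cases k) auto
  have step: "sqdist M (f (r k)) (f (r (Suc k))) \<le> ennreal ((1/4)^k)" for k
    by (intro N rN) (use rN[of k] r in \<open>auto dest: strict_mono_leD[of r k "Suc k"]\<close>)
  define S where "S x = (\<Sum>k. ennreal (2^k) * ennreal ((f (r k) x - f (r (Suc k)) x)\<^sup>2))" for x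
  have [measurable]: "S \<in> borel_measurable M" unfolding S_def by measurable
  have "(\<integral>\<^sup>+x. S x \<partial>M) = (\<Sum>k. ennreal (2^k) * sqdist M (f (r k)) (f (r (Suc k))))"
    unfolding S_def by (subst nn_integral_suminf) (auto simp: nn_integral_cmult sqdist_def)
  also have "\<dots> \<le> (\<Sum>k. ennreal (2^k) * ennreal ((1/4)^k))"
    by (intro suminf_le mult_left_mono step) auto
  also have "\<dots> = (\<Sum>k. ennreal ((1/2)^k))"
    by (intro suminf_cong) (simp add: ennreal_mult[symmetric] power_mult_distrib[symmetric])
  also have "\<dots> = ennreal (\<Sum>k. (1/2)^k)" by (intro suminf_ennreal2) auto
  also have "\<dots> < \<infinity>" by simp
  finally have "AE x in M. S x \<noteq> \<infinity>" by (intro nn_integral_PInf_AE) auto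
  then have conv: "AE x in M. convergent (\<lambda>k. f (r k) x)"
  proof (rule AE_mp, intro AE_I2 impI)
    fix x assume fin: "S x \<noteq> \<infinity>"
    define d where "d k = f (r (Suc k)) x - f (r k) x" for k
    have "summable (\<lambda>k. 2^k * (d k)\<^sup>2)"
    proof (rule summable_suminf_not_top)
      show "(\<Sum>k. ennreal (2^k * (d k)\<^sup>2)) \<noteq> top"
        using fin by (simp add: S_def d_def ennreal_mult power2_commute)
    qed simp
    moreover have "summable (\<lambda>k. (1/2)^k :: real)" by simp
    ultimately have sm: "summable (\<lambda>k. 2^k * (d k)\<^sup>2 + (1/2)^k)" by (rule summable_add)
    have "summable d"
    proof (rule summable_comparison_test'[OF sm])
      fix k
      have "0 \<le> (2^k * \<bar>d k\<bar> - 1)\<^sup>2" by simp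
      then have "2 * (2^k * \<bar>d k\<bar>) \<le> (2^k)\<^sup>2 * (d k)\<^sup>2 + 1"
        by (simp add: power2_diff power_mult_distrib)
      then have "(2 * (2^k * \<bar>d k\<bar>)) / 2^k \<le> ((2^k)\<^sup>2 * (d k)\<^sup>2 + 1) / 2^k"
        by (intro divide_right_mono) auto
      then have "2 * \<bar>d k\<bar> \<le> 2^k * (d k)\<^sup>2 + (1/2)^k"
        by (simp add: add_divide_distrib power2_eq_square power_one_over)
      then show "norm (d k) \<le> 2^k * (d k)\<^sup>2 + (1/2)^k"
        by (smt (verit) real_norm_def)
    qed
    then have "(\<lambda>n. \<Sum>k<n. d k) \<longlonglongrightarrow> suminf d" by (rule summable_LIMSEQ)
    moreover have "(\<Sum>k<n. d k) = f (r n) x - f (r 0) x" for n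
      unfolding d_def by (rule sum_lessThan_telescope)
    ultimately have "(\<lambda>n. (f (r n) x - f (r 0) x) + f (r 0) x) \<longlonglongrightarrow> suminf d + f (r 0) x"
      by (intro tendsto_add) auto
    then show "convergent (\<lambda>k. f (r k) x)" by (auto simp: convergent_def)
  qed
  define g where "g = (\<lambda>x. lim (\<lambda>k. f (r k) x))"
  have [measurable]: "g \<in> borel_measurable M" unfolding g_def by measurable
  have "(\<lambda>n. sqdist M (f n) g) \<longlonglongrightarrow> 0"
  proof (rule ennreal_tendsto_0I)
    fix e :: real assume "0 < e"
    then obtain K where K: "\<And>m n. m \<ge> K \<Longrightarrow> n \<ge> K \<Longrightarrow> sqdist M (f m) (f n) \<le> ennreal e"
      using Cauchy by blast
    have "sqdist M (f n) g \<le> ennreal e" if "n \<ge> K" for n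
    proof -
      have "sqdist M (f n) g = (\<integral>\<^sup>+x. liminf (\<lambda>k. ennreal ((f n x - f (r k) x)\<^sup>2)) \<partial>M)"
        unfolding sqdist_def
      proof (rule nn_integral_cong_AE, use conv in eventually_elim)
        fix x assume "convergent (\<lambda>k. f (r k) x)"
        then have "(\<lambda>k. f (r k) x) \<longlonglongrightarrow> g x" by (simp add: g_def convergent_LIMSEQ_iff)
        then have "(\<lambda>k. ennreal ((f n x - f (r k) x)\<^sup>2)) \<longlonglongrightarrow> ennreal ((f n x - g x)\<^sup>2)"
          by (intro tendsto_intros)
        then show "ennreal ((f n x - g x)\<^sup>2) = liminf (\<lambda>k. ennreal ((f n x - f (r k) x)\<^sup>2))"
          by (rule lim_imp_Liminf[OF trivial_limit_sequentially, symmetric])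
      qed
      also have "\<dots> \<le> liminf (\<lambda>k. sqdist M (f n) (f (r k)))"
        unfolding sqdist_def by (rule nn_integral_liminf) auto
      also have "\<dots> \<le> ennreal e"
      proof -
        have "eventually (\<lambda>k. sqdist M (f n) (f (r k)) \<le> ennreal e) sequentially"
          unfolding eventually_sequentially
          using K[OF that] r by (metis le_trans strict_mono_imp_increasing)
        then have "limsup (\<lambda>k. sqdist M (f n) (f (r k))) \<le> ennreal e" by (rule Limsup_bounded)
        then show ?thesis
          using Liminf_le_Limsup[of sequentially] order_trans trivial_limit_sequentially by blast
      qed
      finally show ?thesis .
    qed
    then show "eventually (\<lambda>n. sqdist M (f n) g \<le> ennreal e) sequentially"
      by (auto simp: eventually_sequentially)
  qed
  with r conv show thesis unfolding g_def by (rule that)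
qed

lemma sqdist_unique:
  assumes f [measurable]: "\<And>n. f n \<in> borel_measurable M"
    and [measurable]: "g \<in> borel_measurable M" "h \<in> borel_measurable M"
    and "(\<lambda>n. sqdist M (f n) g) \<longlonglongrightarrow> 0" "(\<lambda>n. sqdist M (f n) h) \<longlonglongrightarrow> 0"
  shows "AE x in M. g x = h x"
proof (rule sqdist_eq_0D)
  have "(\<lambda>n. 2 * sqdist M (f n) g + 2 * sqdist M (f n) h) \<longlonglongrightarrow> 2 * 0 + 2 * 0"
    by (intro tendsto_intros ennreal_tendsto_cmult assms) auto
  moreover have "sqdist M g h \<le> 2 * sqdist M (f n) g + 2 * sqdist M (f n) h" for n
    using sqdist_triangle[of g M "f n" h] by (simp add: sqdist_commute[of M g])
  ultimately have "sqdist M g h \<le> 2 * 0 + 2 * 0"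
    by (intro tendsto_lowerbound[of _ _ sequentially]) auto
  then show "sqdist M g h = 0" by simp
qed auto

lemma sqdist_limit_Cauchy:
  assumes f [measurable]: "\<And>n. f n \<in> borel_measurable M"
    and [measurable]: "g \<in> borel_measurable M"
    and lim: "(\<lambda>n. sqdist M (f n) g) \<longlonglongrightarrow> 0" and "0 < (e::real)"
  shows "\<exists>N. \<forall>m\<ge>N. \<forall>n\<ge>N. sqdist M (f m) (f n) \<le> ennreal e"
proof -
  obtain N where N: "\<And>n. n \<ge> N \<Longrightarrow> sqdist M (f n) g \<le> ennreal (e/4)"
    using ennreal_tendsto_0D[OF lim, of "e/4"] \<open>0 < e\<close> by (auto simp: eventually_sequentially)
  have "sqdist M (f m) (f n) \<le> ennreal e" if "m \<ge> N" "n \<ge> N" for m n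
  proof -
    have "sqdist M (f m) (f n) \<le> 2 * sqdist M (f m) g + 2 * sqdist M g (f n)"
      by (rule sqdist_triangle) auto
    also have "\<dots> \<le> 2 * ennreal (e/4) + 2 * ennreal (e/4)"
      using N that by (intro add_mono mult_left_mono) (auto simp: sqdist_commute[of M g])
    also have "\<dots> = ennreal e"
      using \<open>0 < e\<close> ennreal_mult[of 2 "e/4"] ennreal_plus[of "e/2" "e/2"] by simp
    finally show ?thesis .
  qed
  then show ?thesis by blast
qed

lemma ennreal_tendsto_0_le:
  fixes f g :: "nat \<Rightarrow> ennreal"
  assumes "\<And>n. f n \<le> g n" "g \<longlonglongrightarrow> 0"
  shows "f \<longlonglongrightarrow> 0"
  by (rule tendsto_sandwich[OF _ _ tendsto_const assms(2)]) (simp_all add: assms(1))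

lemma ennreal_twice_plus_twice: "0 \<le> x \<Longrightarrow> 2 * ennreal x + 2 * ennreal x = ennreal (4 * x)"
  using ennreal_mult[of 2 x] ennreal_plus[of "2 * x" "2 * x"] by simp

lemma sqdist_sum_tendsto:
  assumes "finite A"
    and "\<And>a j. a \<in> A \<Longrightarrow> f a j \<in> borel_measurable N" "\<And>a. a \<in> A \<Longrightarrow> g a \<in> borel_measurable N"
    and "\<And>a. a \<in> A \<Longrightarrow> (\<lambda>j. sqdist N (f a j) (g a)) \<longlonglongrightarrow> 0"
  shows "(\<lambda>j. sqdist N (\<lambda>x. \<Sum>a\<in>A. f a j x) (\<lambda>x. \<Sum>a\<in>A. g a x)) \<longlonglongrightarrow> 0"
  using assms
proof (induction A rule: finite_induct)
  case (insert a A)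
  have IH: "(\<lambda>j. sqdist N (\<lambda>x. \<Sum>a\<in>A. f a j x) (\<lambda>x. \<Sum>a\<in>A. g a x)) \<longlonglongrightarrow> 0"
    by (rule insert.IH) (use insert.prems in blast)+
  have lim: "(\<lambda>j. 2 * sqdist N (f a j) (g a) + 2 * sqdist N (\<lambda>x. \<Sum>a\<in>A. f a j x) (\<lambda>x. \<Sum>a\<in>A. g a x)) \<longlonglongrightarrow> 2 * 0 + 2 * 0"
    by (intro tendsto_intros ennreal_tendsto_cmult IH insert.prems(3)) auto
  have le: "sqdist N (\<lambda>x. f a j x + (\<Sum>a\<in>A. f a j x)) (\<lambda>x. g a x + (\<Sum>a\<in>A. g a x)) \<le>
      2 * sqdist N (f a j) (g a) + 2 * sqdist N (\<lambda>x. \<Sum>a\<in>A. f a j x) (\<lambda>x. \<Sum>a\<in>A. g a x)" for j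
    by (intro sqdist_add borel_measurable_sum insert.prems) auto
  have "(\<lambda>j. sqdist N (\<lambda>x. f a j x + (\<Sum>a\<in>A. f a j x)) (\<lambda>x. g a x + (\<Sum>a\<in>A. g a x))) \<longlonglongrightarrow> 0"
    by (rule ennreal_tendsto_0_le[OF le]) (use lim in simp)
  then show ?case using insert.hyps by simp
qed simp

lemma sqdist_diff_tendsto:
  assumes "\<And>j. f j \<in> borel_measurable N" "g \<in> borel_measurable N"
    "\<And>j. f' j \<in> borel_measurable N" "g' \<in> borel_measurable N"
    and "(\<lambda>j. sqdist N (f j) g) \<longlonglongrightarrow> 0" "(\<lambda>j. sqdist N (f' j) g') \<longlonglongrightarrow> 0"
  shows "(\<lambda>j. sqdist N (\<lambda>x. f j x - f' j x) (\<lambda>x. g x - g' x)) \<longlonglongrightarrow> 0"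
proof -
  have lim: "(\<lambda>j. 2 * sqdist N (f j) g + 2 * sqdist N (f' j) g') \<longlonglongrightarrow> 2 * 0 + 2 * 0"
    by (intro tendsto_intros ennreal_tendsto_cmult assms) auto
  have le: "sqdist N (\<lambda>x. f j x - f' j x) (\<lambda>x. g x - g' x) \<le> 2 * sqdist N (f j) g + 2 * sqdist N (f' j) g'" for j
    by (rule sqdist_diff) (rule assms)+
  show ?thesis by (rule ennreal_tendsto_0_le[OF le]) (use lim in simp)
qed

section \<open>Independence of Brownian increments from the past\<close>

text \<open>Finitely many values of the path before \<open>s\<close> are, outside the null event \<open>B 0 \<noteq> 0\<close>, partial sums of
  increments over a partition that can be prolonged by the interval from \<open>s\<close> to \<open>t\<close>; these increments
  are independent by definition. Events of this kind form an intersection-stable generator of the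
  past.\<close>

lemma (in prob_space) brownian_past_indep:
  assumes B: "standard_brownian_motion M T B" and st: "0 \<le> s" "s < t" "t \<le> T"
  shows "indep_set (sigma_sets (space M) {B r -` A \<inter> space M |r A. 0 \<le> r \<and> r \<le> s \<and> A \<in> sets borel})
    (sigma_sets (space M) {(\<lambda>\<omega>. B t \<omega> - B s \<omega>) -` A \<inter> space M |A. A \<in> sets borel})"
proof -
  define P where "P = {(\<Inter>r\<in>R. B r -` A r \<inter> space M) |R A.
    finite R \<and> R \<noteq> {} \<and> R \<subseteq> {0..s} \<and> (\<forall>r\<in>R. A r \<in> sets borel)}"
  define \<Delta> where "\<Delta> \<omega> = B t \<omega> - B s \<omega>" for \<omega>
  define Q where "Q = {\<Delta> -` A \<inter> space M |A. A \<in> sets borel}"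
  have Bm [measurable]: "B r \<in> borel_measurable M" if "r \<in> {0..T}" for r
    using B that by (auto simp: standard_brownian_motion_def)
  have \<Delta>m [measurable]: "\<Delta> \<in> borel_measurable M"
    unfolding \<Delta>_def using st by (intro borel_measurable_diff Bm) auto
  have P_events: "P \<subseteq> events"
  proof
    fix E assume "E \<in> P"
    then obtain R A where R: "finite R" "R \<noteq> {}" "R \<subseteq> {0..s}" "\<forall>r\<in>R. A r \<in> sets borel"
      and E: "E = (\<Inter>r\<in>R. B r -` A r \<inter> space M)"
      unfolding P_def by blast
    show "E \<in> events"
      unfolding E
    proof (rule sets.finite_INT[OF R(1,2)])
      fix r assume "r \<in> R"
      then have "B r \<in> borel_measurable M" "A r \<in> sets borel" using R(3,4) st by (auto intro!: Bm)
      then show "B r -` A r \<inter> space M \<in> events" by (rule measurable_sets)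
    qed
  qed
  have Q_events: "Q \<subseteq> events"
    unfolding Q_def by auto
  have core: "prob (E \<inter> D) = prob E * prob D" if "E \<in> P" "D \<in> Q" for E D
  proof -
    from \<open>E \<in> P\<close> obtain R A where R: "finite R" "R \<noteq> {}" "R \<subseteq> {0..s}"
      and A: "\<And>r. r \<in> R \<Longrightarrow> A r \<in> sets borel" and E: "E = (\<Inter>r\<in>R. B r -` A r \<inter> space M)"
      unfolding P_def by blast
    from \<open>D \<in> Q\<close> obtain A' where A': "A' \<in> sets borel" and D: "D = \<Delta> -` A' \<inter> space M"
      unfolding Q_def by blast
    define S where "S = insert 0 (insert s R)"
    define xs where "xs = sorted_list_of_set S"
    have "finite S" using R(1) by (simp add: S_def)
    then have xs: "set xs = S" "sorted xs" by (simp_all add: xs_def)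
    have "S \<noteq> {}" by (simp add: S_def)
    then have "xs \<noteq> []" using xs(1) by (metis set_empty)
    define m where "m = length xs - 1"
    have len: "length xs = Suc m" using \<open>xs \<noteq> []\<close> by (simp add: m_def)
    have S_sub: "S \<subseteq> {0..s}" using R st by (auto simp: S_def)
    have nth_S: "xs ! k \<in> {0..s}" if "k \<le> m" for k
      using that len xs(1) S_sub nth_mem[of k xs] by auto
    have xs0: "xs ! 0 = 0"
    proof -
      obtain k where "k < length xs" "xs ! k = 0"
        using xs(1) by (metis S_def in_set_conv_nth insertI1)
      then have "xs ! 0 \<le> 0" using sorted_nth_mono[OF xs(2), of 0 k] by simp
      then show ?thesis using nth_S[of 0] by simp
    qed
    have xsm: "xs ! m = s"
    proof -
      obtain k where "k < length xs" "xs ! k = s"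
        using xs(1) by (metis S_def in_set_conv_nth insertI1 insertI2)
      then have "s \<le> xs ! m" using sorted_nth_mono[OF xs(2), of k m] len by simp
      then show ?thesis using nth_S[of m] by simp
    qed
    \<comment> \<open>the partition: the listed times up to \<open>s\<close>, then \<open>t\<close>, so that increment \<open>m\<close> is the one after \<open>s\<close>\<close>
    define \<tau> where "\<tau> k = (if k \<le> m then xs ! k else t)" for k
    have \<tau>: "\<tau> k \<in> {0..T}" for k using nth_S[of k] st by (auto simp: \<tau>_def)
    have \<tau>_mono: "\<tau> k \<le> \<tau> (Suc k)" if "k < Suc m" for k
      using that nth_S[of k] st sorted_nth_mono[OF xs(2), of k "Suc k"] len by (auto simp: \<tau>_def)
    define X where "X k \<omega> = B (\<tau> (Suc k)) \<omega> - B (\<tau> k) \<omega>" for k \<omega>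
    have X: "indep_vars (\<lambda>_. borel) X {..<Suc m}"
      using B \<tau> \<tau>_mono unfolding standard_brownian_motion_def X_def by blast
    define V where "V \<omega> = (\<lambda>k\<in>{..<m}. X k \<omega>)" for \<omega>
    have VV: "indep_var (PiM {..<m} (\<lambda>_. borel)) V (PiM {m} (\<lambda>_. borel)) (\<lambda>\<omega>. \<lambda>k\<in>{m}. X k \<omega>)"
      unfolding V_def by (intro indep_var_restrict[OF X]) auto
    have Vm [measurable]: "V \<in> measurable M (PiM {..<m} (\<lambda>_. borel))"
      using VV by (rule indep_var_rv1)
    have "\<exists>k. k \<le> m \<and> xs ! k = r" if "r \<in> R" for r
    proof -
      have "r \<in> set xs" using that xs(1) by (simp add: S_def)
      then obtain k where "k < length xs" "xs ! k = r" unfolding in_set_conv_nth by blast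
      then show ?thesis using len by (intro exI[of _ k]) simp
    qed
    then obtain kr where kr: "\<And>r. r \<in> R \<Longrightarrow> kr r \<le> m" "\<And>r. r \<in> R \<Longrightarrow> xs ! kr r = r"
      by metis
    define E' where "E' = (\<Inter>r\<in>R. (\<lambda>v. \<Sum>k<kr r. v k) -` A r \<inter> space (PiM {..<m} (\<lambda>_. borel :: real measure)))"
    have E': "E' \<in> sets (PiM {..<m} (\<lambda>_. borel))"
      unfolding E'_def
    proof (intro sets.finite_INT R measurable_sets[OF _ A] borel_measurable_sum)
      fix r k assume "r \<in> R" "k \<in> {..<kr r}"
      then show "(\<lambda>v. v k) \<in> borel_measurable (PiM {..<m} (\<lambda>_. borel :: real measure))"
        using kr(1)[of r] by (intro measurable_component_singleton) auto
    qed
    have "AE \<omega> in M. B 0 \<omega> = 0" using B by (simp add: standard_brownian_motion_def)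
    then have AE_E: "AE \<omega> in M. \<omega> \<in> E \<longleftrightarrow> \<omega> \<in> V -` E' \<inter> space M"
    proof (rule AE_mp, intro AE_I2 impI)
      fix \<omega> assume \<omega>: "\<omega> \<in> space M" "B 0 \<omega> = 0"
      have "(\<Sum>k<kr r. V \<omega> k) = B r \<omega>" if r: "r \<in> R" for r
      proof -
        have "(\<Sum>k<kr r. V \<omega> k) = (\<Sum>k<kr r. B (\<tau> (Suc k)) \<omega> - B (\<tau> k) \<omega>)"
        proof (rule sum.cong[OF refl])
          fix k assume "k \<in> {..<kr r}"
          then have "k \<in> {..<m}" using kr(1)[OF r] by simp
          then show "V \<omega> k = B (\<tau> (Suc k)) \<omega> - B (\<tau> k) \<omega>" unfolding V_def X_def by simp
        qed
        also have "\<dots> = B (\<tau> (kr r)) \<omega> - B (\<tau> 0) \<omega>" by (rule sum_lessThan_telescope[of "\<lambda>k. B (\<tau> k) \<omega>"])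
        also have "\<tau> (kr r) = r" using kr[OF r] unfolding \<tau>_def by (simp only: if_True)
        also have "\<tau> 0 = 0" using xs0 unfolding \<tau>_def by (simp only: if_True le0)
        finally show ?thesis using \<omega>(2) by simp
      qed
      then have sum: "(\<forall>r\<in>R. (\<Sum>k<kr r. V \<omega> k) \<in> A r) \<longleftrightarrow> (\<forall>r\<in>R. B r \<omega> \<in> A r)"
        by simp
      have V_space: "V \<omega> \<in> space (PiM {..<m} (\<lambda>_. borel :: real measure))"
        using measurable_space[OF Vm \<omega>(1)] .
      have "\<omega> \<in> E \<longleftrightarrow> (\<forall>r\<in>R. B r \<omega> \<in> A r)"
        using \<omega>(1) R(2) unfolding E by blast
      moreover have "V \<omega> \<in> E' \<longleftrightarrow> (\<forall>r\<in>R. (\<Sum>k<kr r. V \<omega> k) \<in> A r)"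
        using V_space R(2) unfolding E'_def by blast
      ultimately show "\<omega> \<in> E \<longleftrightarrow> \<omega> \<in> V -` E' \<inter> space M"
        using \<omega>(1) sum by simp
    qed
    have meas: "E \<in> events" "D \<in> events" "V -` E' \<inter> space M \<in> events"
      using that P_events Q_events E' by auto
    have "prob (E \<inter> D) = prob ((V -` E' \<inter> space M) \<inter> D)"
      using AE_E meas by (intro finite_measure_eq_AE) auto
    also have "\<dots> = prob (V -` E' \<inter> space M) * prob D"
    proof -
      have D': "D = (\<lambda>\<omega>. \<lambda>k\<in>{m}. X k \<omega>) -` ((\<lambda>v. v m) -` A' \<inter> space (PiM {m} (\<lambda>_. borel))) \<inter> space M"
        by (auto simp: D X_def \<Delta>_def \<tau>_def xsm space_PiM)
      have "(\<lambda>v. v m) -` A' \<inter> space (PiM {m} (\<lambda>_. borel)) \<in> sets (PiM {m} (\<lambda>_. borel :: real measure))"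
        using A' by (intro measurable_sets[OF measurable_component_singleton]) auto
      moreover have "indep_set (sigma_sets (space M) {V -` A \<inter> space M |A. A \<in> sets (PiM {..<m} (\<lambda>_. borel))})
        (sigma_sets (space M) {(\<lambda>\<omega>. \<lambda>k\<in>{m}. X k \<omega>) -` A \<inter> space M |A. A \<in> sets (PiM {m} (\<lambda>_. borel))})"
        using VV unfolding indep_var_eq by blast
      ultimately show ?thesis
        unfolding indep_sets2_eq D' using E' by blast
    qed
    also have "prob (V -` E' \<inter> space M) = prob E"
      using AE_E meas by (intro finite_measure_eq_AE) auto
    finally show ?thesis .
  qed
  have "Int_stable P"
  proof (rule Int_stableI)
    fix a b assume "a \<in> P" "b \<in> P"
    then obtain R1 A1 R2 A2 where
      R1: "finite R1" "R1 \<noteq> {}" "R1 \<subseteq> {0..s}" "\<forall>r\<in>R1. A1 r \<in> sets borel"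
      and a: "a = (\<Inter>r\<in>R1. B r -` A1 r \<inter> space M)"
      and R2: "finite R2" "R2 \<noteq> {}" "R2 \<subseteq> {0..s}" "\<forall>r\<in>R2. A2 r \<in> sets borel"
      and b: "b = (\<Inter>r\<in>R2. B r -` A2 r \<inter> space M)"
      unfolding P_def by blast
    define A where "A r = (if r \<in> R1 then A1 r else UNIV) \<inter> (if r \<in> R2 then A2 r else UNIV)" for r
    have "a \<inter> b = (\<Inter>r\<in>R1 \<union> R2. B r -` A r \<inter> space M)"
    proof (rule set_eqI)
      fix \<omega>
      have "\<omega> \<in> a \<longleftrightarrow> \<omega> \<in> space M \<and> (\<forall>r\<in>R1. B r \<omega> \<in> A1 r)" using R1(2) unfolding a by blast
      moreover have "\<omega> \<in> b \<longleftrightarrow> \<omega> \<in> space M \<and> (\<forall>r\<in>R2. B r \<omega> \<in> A2 r)" using R2(2) unfolding b by blast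
      moreover have "\<omega> \<in> (\<Inter>r\<in>R1 \<union> R2. B r -` A r \<inter> space M) \<longleftrightarrow>
          \<omega> \<in> space M \<and> (\<forall>r\<in>R1 \<union> R2. B r \<omega> \<in> A r)" using R1(2) by blast
      moreover have "(\<forall>r\<in>R1 \<union> R2. B r \<omega> \<in> A r) \<longleftrightarrow> (\<forall>r\<in>R1. B r \<omega> \<in> A1 r) \<and> (\<forall>r\<in>R2. B r \<omega> \<in> A2 r)"
        unfolding A_def by auto
      ultimately show "\<omega> \<in> a \<inter> b \<longleftrightarrow> \<omega> \<in> (\<Inter>r\<in>R1 \<union> R2. B r -` A r \<inter> space M)" by auto
    qed
    moreover have "\<forall>r\<in>R1 \<union> R2. A r \<in> sets borel" using R1(4) R2(4) by (auto simp: A_def)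
    ultimately show "a \<inter> b \<in> P" unfolding P_def using R1(1-3) R2(1-3)
      by (intro CollectI exI[of _ "R1 \<union> R2"] exI[of _ A]) simp
  qed
  moreover have "Int_stable Q"
  proof (rule Int_stableI)
    fix a b assume "a \<in> Q" "b \<in> Q"
    then obtain A1 A2 where "A1 \<in> sets borel" "A2 \<in> sets borel"
      "a = \<Delta> -` A1 \<inter> space M" "b = \<Delta> -` A2 \<inter> space M"
      unfolding Q_def by blast
    then have "a \<inter> b = \<Delta> -` (A1 \<inter> A2) \<inter> space M" "A1 \<inter> A2 \<in> sets borel" by auto
    then show "a \<inter> b \<in> Q" unfolding Q_def by blast
  qed
  moreover have "indep_set P Q"
    unfolding indep_sets2_eq using core P_events Q_events by blast
  ultimately have "indep_set (sigma_sets (space M) P) (sigma_sets (space M) Q)"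
    by (intro indep_set_sigma_sets)
  moreover have "{B r -` A \<inter> space M |r A. 0 \<le> r \<and> r \<le> s \<and> A \<in> sets borel} \<subseteq> P"
  proof safe
    fix r A assume "0 \<le> r" "r \<le> s" "A \<in> sets (borel :: real measure)"
    then show "B r -` A \<inter> space M \<in> P"
      unfolding P_def by (intro CollectI exI[of _ "{r}"] exI[of _ "\<lambda>_. A"]) auto
  qed
  then have "sigma_sets (space M) {B r -` A \<inter> space M |r A. 0 \<le> r \<and> r \<le> s \<and> A \<in> sets borel}
      \<subseteq> sigma_sets (space M) P"
    by (rule sigma_sets_mono')
  ultimately show ?thesis
    unfolding indep_sets2_eq Q_def \<Delta>_def by blast
qed

text \<open>Independent Brownian motions indexed by a finite type, with their raw (uncompleted) filtration.
  Only the carrier and the measurable sets of \<open>F t\<close> are prescribed, because \<open>F t\<close> stands for a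
  sigma-algebra.\<close>

locale brownian_family = prob_space M for M :: "'a measure" +
  fixes T :: real and F :: "real \<Rightarrow> 'a measure" and W :: "'i::finite \<Rightarrow> real \<Rightarrow> 'a \<Rightarrow> real"
  assumes T_pos: "0 < T"
    and brownian: "\<And>a. standard_brownian_motion M T (W a)"
    and indep_W: "independent_processes M T UNIV W"
    and space_F [simp]: "\<And>t. space (F t) = space M"
    and sets_F: "\<And>t. sets (F t) =
      sigma_sets (space M) {W a s -` A \<inter> space M |a s A. 0 \<le> s \<and> s \<le> t \<and> A \<in> sets borel}"
begin

lemma W_measurable: "W a t \<in> borel_measurable M" if "0 \<le> t" "t \<le> T"
  using brownian[of a] that by (auto simp: standard_brownian_motion_def)

lemma W_adapted: "W a s \<in> borel_measurable (F t)" if "0 \<le> s" "s \<le> t"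
proof (rule measurableI)
  fix A assume "A \<in> sets (borel :: real measure)"
  then show "W a s -` A \<inter> space (F t) \<in> sets (F t)"
    unfolding sets_F space_F using that by (intro sigma_sets.Basic) blast
qed auto

lemma sets_F_mono: "sets (F s) \<subseteq> sets (F t)" if "s \<le> t"
  unfolding sets_F by (rule sigma_sets_mono') (use that in force)

lemma sets_F_events: "sets (F t) \<subseteq> events" if "0 \<le> t" "t \<le> T"
  unfolding sets_F using that
  by (intro sets.sigma_sets_subset) (auto intro!: measurable_sets[OF W_measurable])

lemma measurable_F_mono:
  assumes "D \<in> measurable (F s) N" "s \<le> t"
  shows "D \<in> measurable (F t) N"
  using assms sets_F_mono[OF assms(2)] by (auto simp: measurable_def)

lemma measurable_F_M:
  assumes "D \<in> measurable (F t) N" "0 \<le> t" "t \<le> T"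
  shows "D \<in> measurable M N"
  using assms sets_F_events[OF assms(2,3)] by (auto simp: measurable_def)

definition increment :: "real \<Rightarrow> real \<Rightarrow> 'a \<Rightarrow> 'i \<Rightarrow> real" where
  "increment s t \<omega> = (\<lambda>a. W a t \<omega> - W a s \<omega>)"

text \<open>The past and the increment of each coordinate form one independent family of sigma-algebras: within
  a coordinate by \<open>brownian_past_indep\<close>, across coordinates by independence of the paths.\<close>

lemma past_increment_indep_sets:
  assumes st: "0 \<le> s" "s < t" "t \<le> T"
  defines "E \<equiv> \<lambda>(a, b). if b
      then sigma_sets (space M) {(\<lambda>\<omega>. W a t \<omega> - W a s \<omega>) -` A \<inter> space M |A. A \<in> sets borel}
      else sigma_sets (space M) {W a r -` A \<inter> space M |r A. 0 \<le> r \<and> r \<le> s \<and> A \<in> sets borel}"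
  shows "indep_sets E UNIV"
proof -
  define path where "path a \<omega> = (\<lambda>r\<in>{0..T}. W a r \<omega>)" for a \<omega>
  define N where "N a = vimage_algebra (space M) (path a) (PiM {0..T} (\<lambda>_. borel :: real measure))" for a
  have space_N [simp]: "space (N a) = space M" for a by (simp add: N_def)
  have path_space: "path a \<in> space M \<rightarrow> space (PiM {0..T} (\<lambda>_. borel :: real measure))" for a
    by (auto simp: path_def space_PiM)
  have WN: "W a r \<in> borel_measurable (N a)" if "r \<in> {0..T}" for a r
  proof -
    have "(\<lambda>p. p r) \<circ> path a \<in> borel_measurable (N a)"
      unfolding N_def
      by (intro measurable_comp[OF measurable_vimage_algebra1[OF path_space]]
          measurable_component_singleton that)
    also have "(\<lambda>p. p r) \<circ> path a = W a r" using that by (auto simp: path_def fun_eq_iff)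
    finally show ?thesis .
  qed
  have indepN: "indep_sets (\<lambda>a. sets (N a)) UNIV"
    using indep_W unfolding independent_processes_def indep_vars_def N_def path_def
    by (simp add: sets_vimage_algebra)
  have EN: "E (a, b) \<subseteq> sets (N a)" for a b
  proof -
    have inc: "{(\<lambda>\<omega>. W a t \<omega> - W a s \<omega>) -` A \<inter> space M |A. A \<in> sets borel} \<subseteq> sets (N a)"
    proof safe
      fix A assume A: "A \<in> sets (borel :: real measure)"
      have "(\<lambda>\<omega>. W a t \<omega> - W a s \<omega>) \<in> borel_measurable (N a)"
        using st by (intro borel_measurable_diff WN) auto
      from measurable_sets[OF this A]
      show "(\<lambda>\<omega>. W a t \<omega> - W a s \<omega>) -` A \<inter> space M \<in> sets (N a)" by simp
    qed
    have past: "{W a r -` A \<inter> space M |r A. 0 \<le> r \<and> r \<le> s \<and> A \<in> sets borel} \<subseteq> sets (N a)"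
    proof safe
      fix r A assume "0 \<le> r" "r \<le> s" and A: "A \<in> sets (borel :: real measure)"
      then have "W a r \<in> borel_measurable (N a)" using st by (intro WN) auto
      from measurable_sets[OF this A] show "W a r -` A \<inter> space M \<in> sets (N a)" by simp
    qed
    show ?thesis
      using sets.sigma_sets_subset[OF inc] sets.sigma_sets_subset[OF past]
      unfolding E_def prod.case space_N by (cases b) (simp_all only: if_True if_False)
  qed
  have N_events: "sets (N a) \<subseteq> events" for a using indepN by (auto simp: indep_sets_def)
  have "prob (\<Inter>j\<in>UNIV. A j) = (\<Prod>j\<in>UNIV. prob (A j))" if A: "A \<in> Pi UNIV E" for A
  proof -
    have AE: "A j \<in> E j" for j using A by auto
    have "(\<Inter>j\<in>UNIV. A j) = (\<Inter>a\<in>UNIV. A (a, False) \<inter> A (a, True))"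
      by (auto simp: set_eq_iff split_paired_All all_bool_eq)
    then have "prob (\<Inter>j\<in>UNIV. A j) = prob (\<Inter>a\<in>UNIV. A (a, False) \<inter> A (a, True))" by simp
    also have "\<dots> = (\<Prod>a\<in>UNIV. prob (A (a, False) \<inter> A (a, True)))"
    proof (rule indep_setsD[OF indepN])
      have "A (a, False) \<inter> A (a, True) \<in> sets (N a)" for a
        by (intro sets.Int subsetD[OF EN AE])
      then show "\<forall>a\<in>UNIV. A (a, False) \<inter> A (a, True) \<in> sets (N a)" by blast
    qed simp_all
    also have "\<dots> = (\<Prod>a\<in>UNIV. prob (A (a, False)) * prob (A (a, True)))"
    proof (intro prod.cong refl)
      fix a
      show "prob (A (a, False) \<inter> A (a, True)) = prob (A (a, False)) * prob (A (a, True))"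
        using brownian_past_indep[OF brownian[of a] st] AE[of "(a, False)"] AE[of "(a, True)"]
        unfolding indep_sets2_eq E_def by simp
    qed
    also have "\<dots> = (\<Prod>a\<in>UNIV. \<Prod>b\<in>UNIV. prob (A (a, b)))"
      by (simp add: UNIV_bool)
    also have "\<dots> = (\<Prod>j\<in>UNIV. prob (A j))"
      by (subst prod.cartesian_product) simp
    finally show ?thesis .
  qed
  moreover have "E j \<subseteq> events" for j using EN N_events by (cases j) blast
  moreover have "space M \<in> E j" for j unfolding E_def by (cases j) (auto intro: sigma_sets_top)
  ultimately show ?thesis by (subst indep_sets_finite) auto
qed

text \<open>Group the family above into all pasts on one side and all increments on the other.\<close>

lemma past_increment_indep_var:
  assumes st: "0 \<le> s" "s < t" "t \<le> T"
    and D: "D \<in> borel_measurable (F s)" and g: "g \<in> borel_measurable (PiM UNIV (\<lambda>_. borel))"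
  shows "indep_var borel (D :: _ \<Rightarrow> real) borel (\<lambda>\<omega>. g (increment s t \<omega>) :: real)"
proof -
  define E where "E \<equiv> \<lambda>(a::'i, b::bool). if b
      then sigma_sets (space M) {(\<lambda>\<omega>. W a t \<omega> - W a s \<omega>) -` A \<inter> space M |A. A \<in> sets borel}
      else sigma_sets (space M) {W a r -` A \<inter> space M |r A. 0 \<le> r \<and> r \<le> s \<and> A \<in> sets borel}"
  have indE: "indep_sets E UNIV" unfolding E_def by (rule past_increment_indep_sets[OF st])
  have stable: "Int_stable (E j)" for j
  proof -
    have *: "Int_stable (sigma_sets (space M) G)" if "G \<subseteq> Pow (space M)" for G
      using sets.Int_stable[of "sigma (space M) G"] sets_measure_of[OF that] by metis
    obtain a b where j: "j = (a, b)" by (cases j)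
    show ?thesis unfolding j E_def prod.case
      by (cases b) (simp only: if_True if_False, rule *, force)+
  qed
  define H where "H b = sigma (space M) (\<Union>i\<in>UNIV \<times> {b}. E i)" for b
  have Esub: "E j \<subseteq> events" for j
    by (rule indE[unfolded indep_sets_def, THEN conjunct1, THEN bspec, OF UNIV_I])
  then have Epow: "(\<Union>i\<in>UNIV \<times> {b}. E i) \<subseteq> Pow (space M)" for b
    using sets.sets_into_space by blast
  have space_H [simp]: "space (H b) = space M" for b
    unfolding H_def by (simp add: space_measure_of_conv)
  have sets_H: "sets (H b) = sigma_sets (space M) (\<Union>i\<in>UNIV \<times> {b}. E i)" for b
    unfolding H_def by (rule sets_measure_of[OF Epow])
  have "indep_sets (\<lambda>b. sigma_sets (space M) (\<Union>i\<in>UNIV \<times> {b}. E i)) (UNIV :: bool set)"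
  proof (rule indep_sets_collect_sigma)
    have "(\<Union>j\<in>(UNIV :: bool set). UNIV \<times> {j}) = (UNIV :: ('i \<times> bool) set)" by auto
    then show "indep_sets E (\<Union>j\<in>(UNIV :: bool set). UNIV \<times> {j})" using indE by simp
  qed (auto simp: stable disjoint_family_on_def)
  then have indH: "indep_sets (\<lambda>b. sets (H b)) UNIV" by (simp add: sets_H)
  have past: "{W a r -` A \<inter> space M |a r A. 0 \<le> r \<and> r \<le> s \<and> A \<in> sets borel} \<subseteq> sets (H False)"
    unfolding sets_H
  proof safe
    fix a r A assume "0 \<le> r" "r \<le> s" "A \<in> sets (borel :: real measure)"
    then have "W a r -` A \<inter> space M \<in> E (a, False)" unfolding E_def by auto
    then show "W a r -` A \<inter> space M \<in> sigma_sets (space M) (\<Union>i\<in>UNIV \<times> {False}. E i)"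
      by (intro sigma_sets.Basic) blast
  qed
  have "sets (F s) \<subseteq> sets (H False)"
    unfolding sets_F using sets.sigma_sets_subset[OF past] by (simp only: space_H)
  then have DH: "D \<in> borel_measurable (H False)" using D by (auto simp: measurable_def)
  have "(\<lambda>\<omega>. increment s t \<omega>) \<in> measurable (H True) (PiM UNIV (\<lambda>_. borel))"
  proof (rule measurable_PiM_single')
    fix a
    show "(\<lambda>\<omega>. increment s t \<omega> a) \<in> borel_measurable (H True)"
    proof (rule measurableI)
      fix A assume "A \<in> sets (borel :: real measure)"
      then have "(\<lambda>\<omega>. increment s t \<omega> a) -` A \<inter> space M \<in> E (a, True)"
        unfolding E_def increment_def by auto
      then show "(\<lambda>\<omega>. increment s t \<omega> a) -` A \<inter> space (H True) \<in> sets (H True)"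
        unfolding space_H sets_H by (intro sigma_sets.Basic) blast
    qed simp
  qed auto
  from measurable_compose[OF this g]
  have gH: "(\<lambda>\<omega>. g (increment s t \<omega>)) \<in> borel_measurable (H True)" .
  have Hev: "sets (H b) \<subseteq> events" for b using indH by (auto simp: indep_sets_def)
  have "indep_set (sets (H False)) (sets (H True))"
    unfolding indep_sets2_eq
  proof (intro conjI ballI Hev)
    fix a b assume ab: "a \<in> sets (H False)" "b \<in> sets (H True)"
    have "prob (\<Inter>j\<in>UNIV. (if j then b else a)) = (\<Prod>j\<in>UNIV. prob (if j then b else a))"
      by (rule indep_setsD[OF indH]) (use ab in auto)
    then show "prob (a \<inter> b) = prob a * prob b" by (simp add: UNIV_bool Int_commute mult.commute)
  qed
  moreover have "sigma_sets (space M) {h -` A \<inter> space M |A. A \<in> sets borel} \<subseteq> sets (H b)"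
    if "h \<in> borel_measurable (H b)" for h :: "'a \<Rightarrow> real" and b
  proof -
    have "{h -` A \<inter> space M |A. A \<in> sets borel} \<subseteq> sets (H b)"
      using measurable_sets[OF that] by (auto simp only: space_H)
    from sets.sigma_sets_subset[OF this] show ?thesis by (simp only: space_H)
  qed
  note this[OF DH] this[OF gH]
  ultimately have "indep_set (sigma_sets (space M) {D -` A \<inter> space M |A. A \<in> sets borel})
      (sigma_sets (space M) {(\<lambda>\<omega>. g (increment s t \<omega>)) -` A \<inter> space M |A. A \<in> sets borel})"
    unfolding indep_sets2_eq by blast
  moreover have "D \<in> borel_measurable M"
    using DH Hev[of False] by (auto simp: measurable_def)
  moreover have "(\<lambda>\<omega>. g (increment s t \<omega>)) \<in> borel_measurable M"
    using gH Hev[of True] by (auto simp: measurable_def)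
  ultimately show ?thesis unfolding indep_var_eq by simp
qed

lemma expectation_past_increment:
  fixes D :: "'a \<Rightarrow> real" and g :: "('i \<Rightarrow> real) \<Rightarrow> real"
  assumes "0 \<le> s" "s < t" "t \<le> T"
    and "D \<in> borel_measurable (F s)" "integrable M D"
    and "g \<in> borel_measurable (PiM UNIV (\<lambda>_. borel))" "integrable M (\<lambda>\<omega>. g (increment s t \<omega>))"
  shows "integrable M (\<lambda>\<omega>. D \<omega> * g (increment s t \<omega>))"
    and "expectation (\<lambda>\<omega>. D \<omega> * g (increment s t \<omega>)) = expectation D * expectation (\<lambda>\<omega>. g (increment s t \<omega>))"
  using indep_var_integrable[OF past_increment_indep_var[OF assms(1-4,6)] assms(5,7)]
    indep_var_lebesgue_integral[OF past_increment_indep_var[OF assms(1-4,6)] assms(5,7)]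
  by auto

section \<open>Gaussian increments\<close>

lemma increment_distributed:
  assumes "0 \<le> s" "s < t" "t \<le> T"
  shows "distributed M lborel (\<lambda>\<omega>. increment s t \<omega> a) (normal_density 0 (sqrt (t - s)))"
  using brownian[of a] assms unfolding standard_brownian_motion_def increment_def by blast

lemma increment_measurable:
  assumes "0 \<le> s" "s \<le> T" "0 \<le> t" "t \<le> T"
  shows "(\<lambda>\<omega>. increment s t \<omega> a) \<in> borel_measurable M"
  unfolding increment_def using assms by (intro borel_measurable_diff W_measurable)

lemma increment_moments:
  assumes st: "0 \<le> s" "s < t" "t \<le> T"
  shows "integrable M (\<lambda>\<omega>. (increment s t \<omega> a) ^ k)"
    and "expectation (\<lambda>\<omega>. increment s t \<omega> a) = 0"
    and "expectation (\<lambda>\<omega>. (increment s t \<omega> a)\<^sup>2) = t - s"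
    and "expectation (\<lambda>\<omega>. (increment s t \<omega> a) ^ 4) = 3 * (t - s)\<^sup>2"
proof -
  note D = increment_distributed[OF st, of a]
  have pos: "0 < sqrt (t - s)" using st by simp
  show "integrable M (\<lambda>\<omega>. (increment s t \<omega> a) ^ k)"
    using distributed_integrable[OF D, of "\<lambda>x. x ^ k"] integrable_normal_moment[OF pos, of 0 k] by simp
  show "expectation (\<lambda>\<omega>. increment s t \<omega> a) = 0"
    using distributed_integral[OF D, of "\<lambda>x. x"] integral_normal_moment_odd[OF pos, of 0 0] by simp
  show "expectation (\<lambda>\<omega>. (increment s t \<omega> a)\<^sup>2) = t - s"
    using distributed_integral[OF D, of "\<lambda>x. x\<^sup>2"] integral_normal_moment_even[OF pos, of 0 1] st
    by (simp add: fact_numeral)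
  have "fact 4 = (24::real)" by (simp add: fact_numeral)
  then show "expectation (\<lambda>\<omega>. (increment s t \<omega> a) ^ 4) = 3 * (t - s)\<^sup>2"
    using distributed_integral[OF D, of "\<lambda>x. x ^ 4"] integral_normal_moment_even[OF pos, of 0 2] st
    by (simp add: fact_numeral power_divide)
qed

lemma increment_indep_vars:
  assumes st: "0 \<le> s" "s < t" "t \<le> T"
  shows "indep_vars (\<lambda>_. borel) (\<lambda>a \<omega>. increment s t \<omega> a) UNIV"
proof -
  have "indep_vars (\<lambda>_. borel) (\<lambda>a \<omega>. (\<lambda>p. p t - p s) (\<lambda>r\<in>{0..T}. W a r \<omega>)) UNIV"
    using st
    by (intro indep_vars_compose2[OF indep_W[unfolded independent_processes_def]]
        borel_measurable_diff measurable_component_singleton) auto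
  then show ?thesis using st by (simp add: increment_def)
qed

lemma increment_cross_moment:
  assumes st: "0 \<le> s" "s < t" "t \<le> T"
  shows "integrable M (\<lambda>\<omega>. increment s t \<omega> a * increment s t \<omega> b)"
    and "expectation (\<lambda>\<omega>. increment s t \<omega> a * increment s t \<omega> b) = (if a = b then t - s else 0)"
proof -
  have int: "integrable M (\<lambda>\<omega>. increment s t \<omega> a)" for a
    using increment_moments(1)[OF st, of a 1] by simp
  have ind: "indep_var borel (\<lambda>\<omega>. increment s t \<omega> a) borel (\<lambda>\<omega>. increment s t \<omega> b)" if "a \<noteq> b"
  proof -
    have "indep_var borel ((\<lambda>v. v a) \<circ> (\<lambda>\<omega>. \<lambda>c\<in>{a}. increment s t \<omega> c))
        borel ((\<lambda>v. v b) \<circ> (\<lambda>\<omega>. \<lambda>c\<in>{b}. increment s t \<omega> c))"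
      using that
      by (intro indep_var_compose[OF indep_var_restrict[OF increment_indep_vars[OF st]]]
          measurable_component_singleton) auto
    then show ?thesis by (simp add: comp_def)
  qed
  show "integrable M (\<lambda>\<omega>. increment s t \<omega> a * increment s t \<omega> b)"
    using indep_var_integrable[OF ind int int] increment_moments(1)[OF st, of a 2]
    by (cases "a = b") (auto simp: power2_eq_square)
  show "expectation (\<lambda>\<omega>. increment s t \<omega> a * increment s t \<omega> b) = (if a = b then t - s else 0)"
    using indep_var_lebesgue_integral[OF ind int int] increment_moments(2,3)[OF st]
    by (cases "a = b") (auto simp: power2_eq_square)
qed

lemma expectation_iexp_increment:
  assumes st: "0 \<le> s" "s < t" "t \<le> T"
  shows "(CLINT \<omega>|M. iexp (\<Sum>a\<in>UNIV. lam a * increment s t \<omega> a)) =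
    complex_of_real (exp (- (\<Sum>a\<in>UNIV. (lam a)\<^sup>2) * (t - s) / 2))"
proof -
  have h: "0 < sqrt (t - s)" using st by simp
  have [measurable]: "(\<lambda>\<omega>. increment s t \<omega> a) \<in> borel_measurable M" for a
    using st by (intro increment_measurable) auto
  have one: "char (distr M borel (\<lambda>\<omega>. lam a * increment s t \<omega> a)) 1 = exp (- (lam a)\<^sup>2 * (t - s) / 2)" for a
  proof -
    define Y where "Y \<omega> = (increment s t \<omega> a - 0) / sqrt (t - s)" for \<omega>
    have "distributed M lborel Y std_normal_density"
      unfolding Y_def
      by (rule normal_standard_normal_convert[OF h, THEN iffD1]) (rule increment_distributed[OF st])
    then have "distr M lborel Y = std_normal_distribution" by (rule distributed_distr_eq_density)
    moreover have [measurable]: "Y \<in> borel_measurable M" unfolding Y_def by measurable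
    ultimately have "char std_normal_distribution (lam a * sqrt (t - s)) =
        (CLINT \<omega>|M. iexp (lam a * sqrt (t - s) * Y \<omega>))"
      unfolding char_def by (subst integral_distr[symmetric, of Y M lborel]) (auto simp: )
    moreover have "lam a * sqrt (t - s) * Y \<omega> = lam a * increment s t \<omega> a" for \<omega>
      using h by (simp add: Y_def)
    ultimately have "(CLINT \<omega>|M. iexp (lam a * increment s t \<omega> a)) = exp (- ((lam a * sqrt (t - s))\<^sup>2) / 2)"
      by (simp only: char_std_normal_distribution)
    then show ?thesis
      using st by (simp add: char_def integral_distr power_mult_distrib)
  qed
  have "indep_vars (\<lambda>_. borel) (\<lambda>a \<omega>. lam a * increment s t \<omega> a) UNIV"
    by (rule indep_vars_compose2[OF increment_indep_vars[OF st]]) auto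
  from char_distr_sum[OF this, of 1]
  have "char (distr M borel (\<lambda>\<omega>. \<Sum>a\<in>UNIV. lam a * increment s t \<omega> a)) 1
      = (\<Prod>a\<in>UNIV. complex_of_real (exp (- (lam a)\<^sup>2 * (t - s) / 2)))"
    by (simp add: one)
  also have "\<dots> = complex_of_real (exp (\<Sum>a\<in>UNIV. - (lam a)\<^sup>2 * (t - s) / 2))"
    by (simp add: exp_sum)
  also have "(\<Sum>a\<in>UNIV. - (lam a)\<^sup>2 * (t - s) / 2) = - (\<Sum>a\<in>UNIV. (lam a)\<^sup>2) * (t - s) / 2"
    by (simp add: sum_distrib_right sum_divide_distrib sum_negf)
  finally show ?thesis by (simp add: char_def integral_distr)
qed

end

lemma exp_minus_one_le: "exp y - 1 \<le> y * exp y" for y :: real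
proof -
  have "(1 - y) * exp y \<le> exp (- y) * exp y"
    using exp_ge_add_one_self[of "- y"] by (intro mult_right_mono) auto
  then show ?thesis by (simp add: exp_minus left_diff_distrib)
qed

lemma
  fixes x :: real
  shows abs_cos_minus_one_le: "\<bar>cos x - 1\<bar> \<le> x\<^sup>2 / 2"
    and abs_sin_minus_self_le: "\<bar>sin x - x\<bar> \<le> x\<^sup>2 / 2"
proof -
  have *: "cmod (iexp x - (1 + \<i> * x)) \<le> x\<^sup>2 / 2" for x :: real
    using iexp_approx1[of x 1] by (simp add: numeral_2_eq_2)
  show "\<bar>cos x - 1\<bar> \<le> x\<^sup>2 / 2"
    using order_trans[OF abs_Re_le_cmod *[of x]] by (simp add: Re_exp)
  show "\<bar>sin x - x\<bar> \<le> x\<^sup>2 / 2"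
    using order_trans[OF abs_Im_le_cmod *[of x]] by (simp add: Im_exp)
qed

context brownian_family begin

definition dot :: "('i \<Rightarrow> real) \<Rightarrow> ('i \<Rightarrow> real) \<Rightarrow> real" where
  "dot lam v = (\<Sum>a\<in>UNIV. lam a * v a)"

definition sqlen :: "('i \<Rightarrow> real) \<Rightarrow> real" where
  "sqlen lam = (\<Sum>a\<in>UNIV. (lam a)\<^sup>2)"

text \<open>With \<open>X = dot lam v\<close> and \<open>\<kappa> = sqlen lam\<close>, the real part and the imaginary part of
  \<open>exp (iX + \<kappa>h/2) - 1 - iX\<close>: what a linear term in the increment leaves of one step of the
  exponential martingale.\<close>

definition cos_rem :: "('i \<Rightarrow> real) \<Rightarrow> real \<Rightarrow> ('i \<Rightarrow> real) \<Rightarrow> real" where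
  "cos_rem lam h v = exp (sqlen lam * h / 2) * cos (dot lam v) - 1"

definition sin_rem :: "('i \<Rightarrow> real) \<Rightarrow> real \<Rightarrow> ('i \<Rightarrow> real) \<Rightarrow> real" where
  "sin_rem lam h v = exp (sqlen lam * h / 2) * sin (dot lam v) - dot lam v"

lemma sqlen_nonneg: "0 \<le> sqlen lam"
  unfolding sqlen_def by (intro sum_nonneg) auto

lemma dot_measurable [measurable]: "dot lam \<in> borel_measurable (PiM UNIV (\<lambda>_. borel))"
  unfolding dot_def by measurable

lemma cos_rem_measurable [measurable]: "cos_rem lam h \<in> borel_measurable (PiM UNIV (\<lambda>_. borel))"
  unfolding cos_rem_def by measurable

lemma sin_rem_measurable [measurable]: "sin_rem lam h \<in> borel_measurable (PiM UNIV (\<lambda>_. borel))"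
  unfolding sin_rem_def by measurable

lemma dot_power4_le:
  fixes lam v :: "'i \<Rightarrow> real"
  shows "(dot lam v) ^ 4 \<le> (sqlen lam)\<^sup>2 * (CARD('i) * (\<Sum>a\<in>UNIV. (v a) ^ 4))"
proof -
  have 1: "(dot lam v)\<^sup>2 \<le> sqlen lam * (\<Sum>a\<in>UNIV. (v a)\<^sup>2)"
    unfolding dot_def sqlen_def by (rule Cauchy_Schwarz_ineq_sum)
  have 2: "(\<Sum>a\<in>UNIV. (v a)\<^sup>2)\<^sup>2 \<le> CARD('i) * (\<Sum>a\<in>UNIV. (v a) ^ 4)"
    using Cauchy_Schwarz_ineq_sum[of "\<lambda>_. 1" "\<lambda>a. (v a)\<^sup>2" "UNIV :: 'i set"]
    by (simp add: power_mult[symmetric])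
  have "(dot lam v) ^ 4 = ((dot lam v)\<^sup>2)\<^sup>2" by simp
  also have "\<dots> \<le> (sqlen lam * (\<Sum>a\<in>UNIV. (v a)\<^sup>2))\<^sup>2"
    by (intro power_mono 1) simp
  also have "\<dots> = (sqlen lam)\<^sup>2 * (\<Sum>a\<in>UNIV. (v a)\<^sup>2)\<^sup>2" by (rule power_mult_distrib)
  also have "\<dots> \<le> (sqlen lam)\<^sup>2 * (CARD('i) * (\<Sum>a\<in>UNIV. (v a) ^ 4))"
    by (intro mult_left_mono 2) simp
  finally show ?thesis .
qed

lemma rem_pointwise:
  fixes lam v :: "'i \<Rightarrow> real"
  assumes h: "0 \<le> h" "h \<le> T"
  defines "c \<equiv> exp (sqlen lam * T / 2)"
  defines "b \<equiv> 2 * c\<^sup>2 * ((sqlen lam)\<^sup>2 * h\<^sup>2 + (sqlen lam)\<^sup>2 * (CARD('i) * (\<Sum>a\<in>UNIV. (v a) ^ 4)))"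
  shows "(cos_rem lam h v)\<^sup>2 \<le> b" "(sin_rem lam h v)\<^sup>2 \<le> b"
proof -
  define y where "y = sqlen lam * h / 2"
  define x where "x = dot lam v"
  have "0 \<le> y" unfolding y_def using sqlen_nonneg[of lam] h by simp
  have "exp y \<le> c" unfolding c_def y_def
    using h sqlen_nonneg[of lam] by (simp add: mult_left_mono)
  have "1 \<le> c" using \<open>exp y \<le> c\<close> \<open>0 \<le> y\<close> by (meson one_le_exp_iff order_trans)
  have ey: "0 \<le> exp y - 1" "exp y - 1 \<le> c * y"
    using exp_minus_one_le[of y] mult_left_mono[OF \<open>exp y \<le> c\<close> \<open>0 \<le> y\<close>] \<open>0 \<le> y\<close> by (auto simp: mult.commute)
  have "1 * (x\<^sup>2 / 2) \<le> c * x\<^sup>2" using \<open>1 \<le> c\<close> by (intro mult_mono) auto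
  then have x2: "x\<^sup>2 / 2 \<le> c * x\<^sup>2" by simp
  have y2: "c * y \<le> c * (2 * y)" using \<open>1 \<le> c\<close> \<open>0 \<le> y\<close> by simp
  have bound: "z\<^sup>2 \<le> b" if "\<bar>z\<bar> \<le> (exp y - 1) + x\<^sup>2 / 2" for z
  proof -
    have "\<bar>z\<bar> \<le> c * (2 * y + x\<^sup>2)"
      using that ey x2 y2 by (simp add: distrib_left)
    then have "z\<^sup>2 \<le> (c * (2 * y + x\<^sup>2))\<^sup>2" by (rule power2_le_iff_abs_le[THEN iffD2, rotated]) (use \<open>1 \<le> c\<close> \<open>0 \<le> y\<close> in auto)
    also have "\<dots> = c\<^sup>2 * (2 * y + x\<^sup>2)\<^sup>2" by (rule power_mult_distrib)
    also have "\<dots> \<le> c\<^sup>2 * (2 * ((sqlen lam)\<^sup>2 * h\<^sup>2 + (sqlen lam)\<^sup>2 * (CARD('i) * (\<Sum>a\<in>UNIV. (v a) ^ 4))))"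
    proof (rule mult_left_mono)
      have "(2 * y + x\<^sup>2)\<^sup>2 \<le> 2 * ((2 * y)\<^sup>2 + x ^ 4)"
        using sum_squares_bound[of "2 * y" "x\<^sup>2"] by (simp add: power2_sum)
      also have "(2 * y)\<^sup>2 = (sqlen lam)\<^sup>2 * h\<^sup>2" by (simp add: y_def power_mult_distrib)
      also have "2 * ((sqlen lam)\<^sup>2 * h\<^sup>2 + x ^ 4) \<le>
          2 * ((sqlen lam)\<^sup>2 * h\<^sup>2 + (sqlen lam)\<^sup>2 * (CARD('i) * (\<Sum>a\<in>UNIV. (v a) ^ 4)))"
        unfolding x_def by (intro mult_left_mono add_left_mono dot_power4_le) simp
      finally show "(2 * y + x\<^sup>2)\<^sup>2 \<le>
          2 * ((sqlen lam)\<^sup>2 * h\<^sup>2 + (sqlen lam)\<^sup>2 * (CARD('i) * (\<Sum>a\<in>UNIV. (v a) ^ 4)))"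
        .
    qed simp
    also have "\<dots> = b" unfolding b_def by (simp only: mult.assoc mult.left_commute)
    finally show "z\<^sup>2 \<le> b" .
  qed
  have "cos_rem lam h v = (exp y - 1) * cos x + (cos x - 1)"
    by (simp add: cos_rem_def y_def x_def algebra_simps)
  also have "\<bar>\<dots>\<bar> \<le> (exp y - 1) * 1 + x\<^sup>2 / 2"
    using ey(1) by (intro order_trans[OF abs_triangle_ineq] add_mono abs_cos_minus_one_le)
      (simp only: abs_mult, intro mult_mono, auto)
  finally show "(cos_rem lam h v)\<^sup>2 \<le> b" by (intro bound) simp
  have "sin_rem lam h v = (exp y - 1) * sin x + (sin x - x)"
    by (simp add: sin_rem_def y_def x_def algebra_simps)
  also have "\<bar>\<dots>\<bar> \<le> (exp y - 1) * 1 + x\<^sup>2 / 2"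
    using ey(1) by (intro order_trans[OF abs_triangle_ineq] add_mono abs_sin_minus_self_le)
      (simp only: abs_mult, intro mult_mono, auto)
  finally show "(sin_rem lam h v)\<^sup>2 \<le> b" by (intro bound) simp
qed

lemma increment_dot_measurable:
  assumes "0 \<le> s" "s < t" "t \<le> T"
  shows "(\<lambda>\<omega>. dot lam (increment s t \<omega>)) \<in> borel_measurable M"
  unfolding dot_def
  using assms by (intro borel_measurable_sum borel_measurable_times increment_measurable) auto

text \<open>A grid of mesh \<open>h\<close> has of the order of \<open>1/h\<close> cells, so remainders that are centred, hence
  orthogonal, and have second moment \<open>O(h\<^sup>2)\<close> vanish in the limit. The means are zero by the
  characteristic function of the Gaussian increments; the second moments are controlled by fourth
  moments of the increments.\<close>

lemma rem_moments:
  obtains C where "0 \<le> C"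
    "\<And>s t g. 0 \<le> s \<Longrightarrow> s < t \<Longrightarrow> t \<le> T \<Longrightarrow> g = cos_rem lam (t - s) \<or> g = sin_rem lam (t - s) \<Longrightarrow>
      integrable M (\<lambda>\<omega>. (g (increment s t \<omega>))\<^sup>2) \<and> expectation (\<lambda>\<omega>. g (increment s t \<omega>)) = 0 \<and>
      expectation (\<lambda>\<omega>. (g (increment s t \<omega>))\<^sup>2) \<le> C * (t - s)\<^sup>2"
proof -
  define c where "c = exp (sqlen lam * T / 2)"
  define C where "C = 2 * c\<^sup>2 * ((sqlen lam)\<^sup>2 + (sqlen lam)\<^sup>2 * (CARD('i) * (CARD('i) * 3)))"
  have "0 \<le> C" unfolding C_def by (intro mult_nonneg_nonneg add_nonneg_nonneg) auto
  moreover have "integrable M (\<lambda>\<omega>. (g (increment s t \<omega>))\<^sup>2) \<and> expectation (\<lambda>\<omega>. g (increment s t \<omega>)) = 0 \<and>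
      expectation (\<lambda>\<omega>. (g (increment s t \<omega>))\<^sup>2) \<le> C * (t - s)\<^sup>2"
    if st: "0 \<le> s" "s < t" "t \<le> T" and g: "g = cos_rem lam (t - s) \<or> g = sin_rem lam (t - s)" for s t g
  proof -
    define b where "b \<omega> = 2 * c\<^sup>2 * ((sqlen lam)\<^sup>2 * (t - s)\<^sup>2 +
      (sqlen lam)\<^sup>2 * (CARD('i) * (\<Sum>a\<in>UNIV. (increment s t \<omega> a) ^ 4)))" for \<omega>
    have gb: "(g (increment s t \<omega>))\<^sup>2 \<le> b \<omega>" for \<omega>
      using rem_pointwise[of "t - s" lam "increment s t \<omega>"] st g unfolding b_def c_def by auto
    have b_int: "integrable M b"
      unfolding b_def
      by (intro integrable_mult_right Bochner_Integration.integrable_add integrable_const Bochner_Integration.integrable_sum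
          increment_moments(1)[OF st])
    have b_exp: "expectation b = C * (t - s)\<^sup>2"
    proof -
      have "expectation b = 2 * c\<^sup>2 * ((sqlen lam)\<^sup>2 * (t - s)\<^sup>2 +
          (sqlen lam)\<^sup>2 * (CARD('i) * (\<Sum>a\<in>(UNIV :: 'i set). 3 * (t - s)\<^sup>2)))"
        unfolding b_def using increment_moments(1)[OF st] increment_moments(4)[OF st]
        by (simp add: prob_space)
      then show ?thesis by (simp add: C_def algebra_simps)
    qed
    have [measurable]: "(\<lambda>\<omega>. dot lam (increment s t \<omega>)) \<in> borel_measurable M"
      by (rule increment_dot_measurable[OF st])
    have gm [measurable]: "(\<lambda>\<omega>. g (increment s t \<omega>)) \<in> borel_measurable M"
      using g unfolding cos_rem_def sin_rem_def by auto
    have g2: "integrable M (\<lambda>\<omega>. (g (increment s t \<omega>))\<^sup>2)"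
      by (rule Bochner_Integration.integrable_bound[OF b_int])
        (auto intro!: AE_I2 order_trans[OF gb] gb)
    have g2le: "expectation (\<lambda>\<omega>. (g (increment s t \<omega>))\<^sup>2) \<le> C * (t - s)\<^sup>2"
      unfolding b_exp[symmetric] by (intro integral_mono g2 b_int gb)
    define X where "X \<omega> = dot lam (increment s t \<omega>)" for \<omega>
    have [measurable]: "X \<in> borel_measurable M" unfolding X_def by simp
    define e where "e = exp (sqlen lam * (t - s) / 2)"
    have I: "(CLINT \<omega>|M. iexp (X \<omega>)) = complex_of_real (inverse e)"
      using expectation_iexp_increment[OF st, of lam]
      by (simp add: X_def e_def dot_def sqlen_def exp_minus[symmetric])
    have iI: "integrable M (\<lambda>\<omega>. iexp (X \<omega>))" by (rule integrable_iexp) auto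
    have cosE: "integrable M (\<lambda>\<omega>. cos (X \<omega>))" "expectation (\<lambda>\<omega>. cos (X \<omega>)) = inverse e"
      using integrable_Re[OF iI] integral_Re[OF iI, unfolded I Re_complex_of_real] by (simp_all add: Re_exp)
    have sinE: "integrable M (\<lambda>\<omega>. sin (X \<omega>))" "expectation (\<lambda>\<omega>. sin (X \<omega>)) = 0"
      using integrable_Im[OF iI] integral_Im[OF iI] I by (simp_all add: Im_exp)
    have XE: "integrable M X" "expectation X = 0"
      using increment_moments(1)[OF st, of _ 1] increment_moments(2)[OF st]
      unfolding X_def dot_def by (simp_all add: )
    have "e > 0" by (simp add: e_def)
    have "expectation (\<lambda>\<omega>. g (increment s t \<omega>)) = 0"
      using g
    proof
      assume "g = cos_rem lam (t - s)"
      then have "(\<lambda>\<omega>. g (increment s t \<omega>)) = (\<lambda>\<omega>. e * cos (X \<omega>) - 1)"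
        by (simp add: cos_rem_def e_def X_def fun_eq_iff)
      then show ?thesis using cosE \<open>e > 0\<close> by (simp add: prob_space)
    next
      assume "g = sin_rem lam (t - s)"
      then have "(\<lambda>\<omega>. g (increment s t \<omega>)) = (\<lambda>\<omega>. e * sin (X \<omega>) - X \<omega>)"
        by (simp add: sin_rem_def e_def X_def fun_eq_iff)
      then show ?thesis using sinE XE by simp
    qed
    with g2 g2le show ?thesis by blast
  qed
  ultimately show thesis by (rule that)
qed

section \<open>Elementary integrands and the isometry\<close>

lemma past_increment_zero:
  assumes st: "0 \<le> s" "s < t" "t \<le> T"
    and D [measurable]: "D \<in> borel_measurable (F s)" and D2: "integrable M (\<lambda>\<omega>. (D \<omega>)\<^sup>2)"
  shows "integrable M (\<lambda>\<omega>. D \<omega> * increment s t \<omega> a)"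
    and "expectation (\<lambda>\<omega>. D \<omega> * increment s t \<omega> a) = 0"
    and "integrable M (\<lambda>\<omega>. (D \<omega> * increment s t \<omega> a)\<^sup>2)"
proof -
  have DM: "D \<in> borel_measurable M" using D st by (intro measurable_F_M[of D s]) auto
  have D1: "integrable M D" by (rule square_integrable_imp_integrable[OF DM D2])
  have g: "(\<lambda>v. v a) \<in> borel_measurable (PiM UNIV (\<lambda>_. borel :: real measure))"
    by (intro measurable_component_singleton) auto
  have i1: "integrable M (\<lambda>\<omega>. increment s t \<omega> a)" using increment_moments(1)[OF st, of a 1] by simp
  show "integrable M (\<lambda>\<omega>. D \<omega> * increment s t \<omega> a)"
    using expectation_past_increment(1)[OF st D D1 g i1] by simp
  show "expectation (\<lambda>\<omega>. D \<omega> * increment s t \<omega> a) = 0"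
    using expectation_past_increment(2)[OF st D D1 g i1] increment_moments(2)[OF st] by simp
  have D': "(\<lambda>\<omega>. (D \<omega>)\<^sup>2) \<in> borel_measurable (F s)" by measurable
  have g': "(\<lambda>v. (v a)\<^sup>2) \<in> borel_measurable (PiM UNIV (\<lambda>_. borel :: real measure))"
    using g by measurable
  show "integrable M (\<lambda>\<omega>. (D \<omega> * increment s t \<omega> a)\<^sup>2)"
    using expectation_past_increment(1)[OF st D' D2 g' increment_moments(1)[OF st, of a 2]]
    by (simp add: power_mult_distrib)
qed

definition bounded_rv :: "('a \<Rightarrow> real) \<Rightarrow> bool" where
  "bounded_rv \<eta> \<longleftrightarrow> (\<exists>B. \<forall>\<omega>\<in>space M. \<bar>\<eta> \<omega>\<bar> \<le> B)"

lemma bounded_rv_mult: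
  assumes "bounded_rv f" "bounded_rv g" shows "bounded_rv (\<lambda>\<omega>. f \<omega> * g \<omega>)"
proof -
  obtain A B where "\<forall>\<omega>\<in>space M. \<bar>f \<omega>\<bar> \<le> A" "\<forall>\<omega>\<in>space M. \<bar>g \<omega>\<bar> \<le> B"
    using assms by (auto simp: bounded_rv_def)
  then have "\<forall>\<omega>\<in>space M. \<bar>f \<omega> * g \<omega>\<bar> \<le> A * B"
    unfolding abs_mult by (intro ballI mult_mono) (auto intro: order_trans[OF abs_ge_zero])
  then show ?thesis by (auto simp: bounded_rv_def)
qed

lemma bounded_rv_square_integrable_mult:
  assumes [measurable]: "f \<in> borel_measurable M" "g \<in> borel_measurable M"
    and "bounded_rv f" "integrable M (\<lambda>\<omega>. (g \<omega>)\<^sup>2)"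
  shows "integrable M (\<lambda>\<omega>. (f \<omega> * g \<omega>)\<^sup>2)"
proof -
  obtain B where B: "\<And>\<omega>. \<omega> \<in> space M \<Longrightarrow> \<bar>f \<omega>\<bar> \<le> B" using assms(3) by (auto simp: bounded_rv_def)
  have "integrable M (\<lambda>\<omega>. B\<^sup>2 * (g \<omega>)\<^sup>2)" using assms(4) by simp
  then show ?thesis
  proof (rule Bochner_Integration.integrable_bound)
    show "AE \<omega> in M. norm ((f \<omega> * g \<omega>)\<^sup>2) \<le> norm (B\<^sup>2 * (g \<omega>)\<^sup>2)"
    proof (rule AE_I2)
      fix \<omega> assume "\<omega> \<in> space M"
      from B[OF this] have "(f \<omega>)\<^sup>2 \<le> B\<^sup>2" by (metis abs_ge_zero power2_abs power_mono)
      then show "norm ((f \<omega> * g \<omega>)\<^sup>2) \<le> norm (B\<^sup>2 * (g \<omega>)\<^sup>2)"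
        by (simp add: power_mult_distrib mult_right_mono)
    qed
  qed simp
qed

lemma bounded_rv_square_integrable:
  assumes [measurable]: "f \<in> borel_measurable M" and "bounded_rv f"
  shows "integrable M (\<lambda>\<omega>. (f \<omega>)\<^sup>2)"
  using bounded_rv_square_integrable_mult[of f "\<lambda>_. 1"] assms by simp

text \<open>Beyond the shorter interval the longer increment is centred given the past, so only the common
  interval counts.\<close>

lemma covariation_same_start:
  assumes st: "0 \<le> s" "s < t" "t \<le> t'" "t' \<le> T"
    and D [measurable]: "D \<in> borel_measurable (F s)" and Db: "bounded_rv D"
  shows "expectation (\<lambda>\<omega>. D \<omega> * (W a t \<omega> - W a s \<omega>) * (W b t' \<omega> - W b s \<omega>)) =
    (if a = b then t - s else 0) * expectation D"
proof -
  have st1: "0 \<le> s" "s < t" "t \<le> T" using st by auto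
  have DM: "D \<in> borel_measurable M" using D st by (intro measurable_F_M[of D s]) auto
  have D2: "integrable M (\<lambda>\<omega>. (D \<omega>)\<^sup>2)" by (rule bounded_rv_square_integrable[OF DM Db])
  have D1: "integrable M D" by (rule square_integrable_imp_integrable[OF DM D2])
  have g: "(\<lambda>v. v a * v b) \<in> borel_measurable (PiM UNIV (\<lambda>_. borel :: real measure))"
    by (intro borel_measurable_times measurable_component_singleton) auto
  have 1: "integrable M (\<lambda>\<omega>. D \<omega> * (increment s t \<omega> a * increment s t \<omega> b))"
    "expectation (\<lambda>\<omega>. D \<omega> * (increment s t \<omega> a * increment s t \<omega> b)) = (if a = b then t - s else 0) * expectation D"
    using expectation_past_increment[OF st1 D D1 g increment_cross_moment(1)[OF st1]]
      increment_cross_moment(2)[OF st1, of a b] by auto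
  have 2: "integrable M (\<lambda>\<omega>. (D \<omega> * increment s t \<omega> a) * increment t t' \<omega> b) \<and>
    expectation (\<lambda>\<omega>. (D \<omega> * increment s t \<omega> a) * increment t t' \<omega> b) = 0"
  proof (cases "t = t'")
    case True then show ?thesis by (simp add: increment_def)
  next
    case False
    then have "t < t'" using st by simp
    moreover have "(\<lambda>\<omega>. D \<omega> * increment s t \<omega> a) \<in> borel_measurable (F t)"
      unfolding increment_def using st
      by (intro borel_measurable_times borel_measurable_diff W_adapted measurable_F_mono[OF D]) auto
    ultimately show ?thesis
      using past_increment_zero[of t t' "\<lambda>\<omega>. D \<omega> * increment s t \<omega> a" b] st
        past_increment_zero(3)[OF st1 D D2, of a] by auto
  qed
  have "expectation (\<lambda>\<omega>. D \<omega> * (W a t \<omega> - W a s \<omega>) * (W b t' \<omega> - W b s \<omega>)) =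
    expectation (\<lambda>\<omega>. D \<omega> * (increment s t \<omega> a * increment s t \<omega> b) + (D \<omega> * increment s t \<omega> a) * increment t t' \<omega> b)"
    by (intro Bochner_Integration.integral_cong) (auto simp: increment_def algebra_simps)
  also have "\<dots> = (if a = b then t - s else 0) * expectation D"
    using 1 2 by (subst Bochner_Integration.integral_add) auto
  finally show ?thesis .
qed

lemma covariation_same_start':
  assumes st: "0 \<le> s" "s < t" "t \<le> T" "s < t'" "t' \<le> T"
    and D: "D \<in> borel_measurable (F s)" "bounded_rv D"
  shows "expectation (\<lambda>\<omega>. D \<omega> * (W a t \<omega> - W a s \<omega>) * (W b t' \<omega> - W b s \<omega>)) =
    (if a = b then min t t' - s else 0) * expectation D"
proof (cases "t \<le> t'")
  case True
  then show ?thesis using covariation_same_start[OF st(1,2) True st(5) D] by (simp add: min_def)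
next
  case False
  then have "t' \<le> t" by simp
  from covariation_same_start[OF st(1,4) this st(3) D, of b a]
  show ?thesis using False by (simp add: min_def mult_ac)
qed

text \<open>The product space \<open>[0,T] \<times> \<Omega>\<close>, on which integrands are compared.\<close>

definition time_space :: "(real \<times> 'a) measure" where
  "time_space = restrict_space lborel {0..T} \<Otimes>\<^sub>M M"

text \<open>The entry \<open>(a, s, t, \<eta>)\<close> is the integrand \<open>\<eta> 1\<^bsub>(s,t]\<^esub>\<close> in the coordinate \<open>a\<close>. A general simple integrand
  is a list of such entries with arbitrary, possibly overlapping intervals, so that sums are
  concatenations whatever the partitions.\<close>

definition elementary :: "'i \<times> real \<times> real \<times> ('a \<Rightarrow> real) \<Rightarrow> bool" where
  "elementary = (\<lambda>(a, s, t, \<eta>). 0 \<le> s \<and> s < t \<and> t \<le> T \<and> \<eta> \<in> borel_measurable (F s) \<and> bounded_rv \<eta>)"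

definition elem_integral :: "'i \<times> real \<times> real \<times> ('a \<Rightarrow> real) \<Rightarrow> 'a \<Rightarrow> real" where
  "elem_integral = (\<lambda>(a, s, t, \<eta>) \<omega>. \<eta> \<omega> * (W a t \<omega> - W a s \<omega>))"

definition elem_process :: "'i \<times> real \<times> real \<times> ('a \<Rightarrow> real) \<Rightarrow> 'i \<Rightarrow> real \<Rightarrow> 'a \<Rightarrow> real" where
  "elem_process = (\<lambda>(a, s, t, \<eta>) b r \<omega>. if a = b then \<eta> \<omega> * indicator {s<..t} r else 0)"

definition list_integral :: "('i \<times> real \<times> real \<times> ('a \<Rightarrow> real)) list \<Rightarrow> 'a \<Rightarrow> real" where
  "list_integral L \<omega> = (\<Sum>e\<leftarrow>L. elem_integral e \<omega>)"

definition list_process :: "('i \<times> real \<times> real \<times> ('a \<Rightarrow> real)) list \<Rightarrow> 'i \<Rightarrow> real \<Rightarrow> 'a \<Rightarrow> real" where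
  "list_process L b r \<omega> = (\<Sum>e\<leftarrow>L. elem_process e b r \<omega>)"

lemma elementary_square_integrable:
  assumes "elementary e"
  shows "elem_integral e \<in> borel_measurable (F T)" "elem_integral e \<in> borel_measurable M"
    "integrable M (\<lambda>\<omega>. (elem_integral e \<omega>)\<^sup>2)" "expectation (elem_integral e) = 0"
proof -
  obtain a s t \<eta> where e: "e = (a, s, t, \<eta>)" by (cases e)
  have st: "0 \<le> s" "s < t" "t \<le> T" and \<eta>: "\<eta> \<in> borel_measurable (F s)" and b: "bounded_rv \<eta>"
    using assms by (auto simp: elementary_def e)
  show FT: "elem_integral e \<in> borel_measurable (F T)"
    unfolding elem_integral_def e prod.case using st
    by (intro borel_measurable_times borel_measurable_diff W_adapted measurable_F_mono[OF \<eta>]) auto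
  show "elem_integral e \<in> borel_measurable M"
    using measurable_F_M[OF FT] T_pos by simp
  have "\<eta> \<in> borel_measurable M" using measurable_F_M[OF \<eta>] st by simp
  from past_increment_zero(2,3)[OF st \<eta> bounded_rv_square_integrable[OF this b], of a]
  show "integrable M (\<lambda>\<omega>. (elem_integral e \<omega>)\<^sup>2)" "expectation (elem_integral e) = 0"
    unfolding elem_integral_def e prod.case increment_def by auto
qed

text \<open>Split the earlier block at the starting time \<open>s'\<close> of the later one. Its part before \<open>s'\<close> belongs to the
  past of the second increment and contributes nothing; the rest starts at the same time \<open>s'\<close>.\<close>

lemma covariation_elementary_le:
  assumes e: "elementary (a, s, t, \<eta>)" and e': "elementary (b, s', t', \<eta>')" and le: "s \<le> s'"
  shows "expectation (\<lambda>\<omega>. elem_integral (a, s, t, \<eta>) \<omega> * elem_integral (b, s', t', \<eta>') \<omega>) =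
    (if a = b then max 0 (min t t' - max s s') else 0) * expectation (\<lambda>\<omega>. \<eta> \<omega> * \<eta>' \<omega>)"
proof -
  have st: "0 \<le> s" "s < t" "t \<le> T" and \<eta>: "\<eta> \<in> borel_measurable (F s)" and b: "bounded_rv \<eta>"
    using e by (auto simp: elementary_def)
  have st': "0 \<le> s'" "s' < t'" "t' \<le> T" and \<eta>': "\<eta>' \<in> borel_measurable (F s')" and b': "bounded_rv \<eta>'"
    using e' by (auto simp: elementary_def)
  have \<eta>M: "\<eta> \<in> borel_measurable M" using measurable_F_M[OF \<eta>] st by simp
  have \<eta>M': "\<eta>' \<in> borel_measurable M" using measurable_F_M[OF \<eta>'] st' by simp
  have \<eta>s': "\<eta> \<in> borel_measurable (F s')" by (rule measurable_F_mono[OF \<eta> le])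
  \<comment> \<open>up to time \<open>u \<le> s'\<close> the first factor belongs to the past of the second\<close>
  have past: "integrable M (\<lambda>\<omega>. \<eta>' \<omega> * (\<eta> \<omega> * (W a u \<omega> - W a s \<omega>)) * (W b t' \<omega> - W b s' \<omega>)) \<and>
    expectation (\<lambda>\<omega>. \<eta>' \<omega> * (\<eta> \<omega> * (W a u \<omega> - W a s \<omega>)) * (W b t' \<omega> - W b s' \<omega>)) = 0"
    if u: "s < u" "u \<le> s'" for u
  proof -
    have el: "elementary (a, s, u, \<eta>)" using st u st' \<eta> b by (auto simp: elementary_def)
    note sq = elementary_square_integrable[OF el, unfolded elem_integral_def prod.case]
    have "(\<lambda>\<omega>. \<eta>' \<omega> * (\<eta> \<omega> * (W a u \<omega> - W a s \<omega>))) \<in> borel_measurable (F s')"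
      using u st by (intro borel_measurable_times borel_measurable_diff W_adapted \<eta>s' \<eta>') auto
    from past_increment_zero(1,2)[OF st' this bounded_rv_square_integrable_mult[OF \<eta>M' sq(2) b' sq(3)], of b]
    show ?thesis unfolding increment_def by simp
  qed
  show ?thesis
  proof (cases "t \<le> s'")
    case True
    then have "max 0 (min t t' - max s s') = 0" using st' le by auto
    then show ?thesis
      using past[of t] True st by (simp add: elem_integral_def mult_ac)
  next
    case False
    then have s't: "s' < t" by simp
    have mid: "min t t' - max s s' = min t t' - s'" using le by simp
    have pos: "0 \<le> min t t' - s'" using s't st' by simp
    have D: "(\<lambda>\<omega>. \<eta>' \<omega> * \<eta> \<omega>) \<in> borel_measurable (F s')" "bounded_rv (\<lambda>\<omega>. \<eta>' \<omega> * \<eta> \<omega>)"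
      by (intro borel_measurable_times \<eta>' \<eta>s' bounded_rv_mult b b')+
    have main: "expectation (\<lambda>\<omega>. \<eta>' \<omega> * \<eta> \<omega> * (W a t \<omega> - W a s' \<omega>) * (W b t' \<omega> - W b s' \<omega>)) =
      (if a = b then min t t' - s' else 0) * expectation (\<lambda>\<omega>. \<eta>' \<omega> * \<eta> \<omega>)"
      by (rule covariation_same_start'[OF st'(1) s't st(3) st'(2,3) D])
    have main_int: "integrable M (\<lambda>\<omega>. \<eta>' \<omega> * \<eta> \<omega> * (W a t \<omega> - W a s' \<omega>) * (W b t' \<omega> - W b s' \<omega>))"
    proof -
      have "elementary (a, s', t, \<lambda>\<omega>. \<eta>' \<omega> * \<eta> \<omega>)" "elementary (b, s', t', \<lambda>_. 1)"
        using st st' s't D by (auto simp: elementary_def bounded_rv_def)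
      note sq = this[THEN elementary_square_integrable(2)] this[THEN elementary_square_integrable(3)]
      from square_integrable_prod[OF sq] show ?thesis by (simp add: elem_integral_def)
    qed
    have early: "integrable M (\<lambda>\<omega>. \<eta>' \<omega> * (\<eta> \<omega> * (W a s' \<omega> - W a s \<omega>)) * (W b t' \<omega> - W b s' \<omega>)) \<and>
      expectation (\<lambda>\<omega>. \<eta>' \<omega> * (\<eta> \<omega> * (W a s' \<omega> - W a s \<omega>)) * (W b t' \<omega> - W b s' \<omega>)) = 0"
      using past[of s'] le by (cases "s = s'") auto
    have "expectation (\<lambda>\<omega>. elem_integral (a, s, t, \<eta>) \<omega> * elem_integral (b, s', t', \<eta>') \<omega>) =
      expectation (\<lambda>\<omega>. \<eta>' \<omega> * \<eta> \<omega> * (W a t \<omega> - W a s' \<omega>) * (W b t' \<omega> - W b s' \<omega>) +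
        \<eta>' \<omega> * (\<eta> \<omega> * (W a s' \<omega> - W a s \<omega>)) * (W b t' \<omega> - W b s' \<omega>))"
      by (intro Bochner_Integration.integral_cong) (auto simp: elem_integral_def algebra_simps)
    also have "\<dots> = (if a = b then min t t' - s' else 0) * expectation (\<lambda>\<omega>. \<eta>' \<omega> * \<eta> \<omega>)"
      using main_int early main by (subst Bochner_Integration.integral_add) auto
    finally show ?thesis unfolding mid using pos by (simp add: mult.commute[of "\<eta> _"])
  qed
qed

lemma covariation_elementary:
  assumes e: "elementary (a, s, t, \<eta>)" and e': "elementary (b, s', t', \<eta>')"
  shows "expectation (\<lambda>\<omega>. elem_integral (a, s, t, \<eta>) \<omega> * elem_integral (b, s', t', \<eta>') \<omega>) =
    (if a = b then max 0 (min t t' - max s s') else 0) * expectation (\<lambda>\<omega>. \<eta> \<omega> * \<eta>' \<omega>)"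
proof (cases "s \<le> s'")
  case True
  then show ?thesis by (rule covariation_elementary_le[OF e e'])
next
  case False
  then have "s' \<le> s" by simp
  from covariation_elementary_le[OF e' e this]
  show ?thesis by (simp add: mult.commute min.commute max.commute[of s] eq_commute[of a])
qed

lemma finite_measure_Leb: "finite_measure (restrict_space lborel {0..T})"
  using T_pos by (intro finite_measureI) (simp add: emeasure_restrict_space space_restrict_space)

lemma pair_sigma_finite_time_space: "pair_sigma_finite (restrict_space lborel {0..T}) M"
proof -
  interpret L: finite_measure "restrict_space lborel {0..T}" by (rule finite_measure_Leb)
  show ?thesis ..
qed

lemma finite_measure_time_space: "finite_measure time_space"
proof -
  interpret L: finite_measure "restrict_space lborel {0..T}" by (rule finite_measure_Leb)
  show ?thesis unfolding time_space_def
    by (rule finite_measure_pair_measure) unfold_locales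
qed

lemma space_time_space: "space time_space = {0..T} \<times> space M"
  by (simp add: time_space_def space_pair_measure space_restrict_space)

lemma measurable_fst_time_space [measurable]: "fst \<in> borel_measurable time_space"
proof -
  have "(\<lambda>x. x) \<in> measurable (restrict_space lborel {0..T}) borel"
    by (rule measurable_restrict_space1) simp
  from measurable_compose[OF measurable_fst[of _ M] this] show ?thesis unfolding time_space_def .
qed

lemma measurable_snd_time_space: "f \<in> measurable M N \<Longrightarrow> (\<lambda>z. f (snd z)) \<in> measurable time_space N"
  unfolding time_space_def by (rule measurable_compose[OF measurable_snd])

lemma elem_process_measurable:
  assumes "elementary e"
  shows "(\<lambda>z. elem_process e b (fst z) (snd z)) \<in> borel_measurable time_space"
proof -
  obtain a s t \<eta> where e: "e = (a, s, t, \<eta>)" by (cases e)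
  have "\<eta> \<in> borel_measurable M"
    using assms by (auto simp: elementary_def e intro: measurable_F_M[of \<eta> s])
  note [measurable] = measurable_snd_time_space[OF this]
  show ?thesis unfolding e elem_process_def prod.case by measurable
qed

lemma elem_process_bounded:
  assumes "elementary e"
  shows "\<exists>B. \<forall>z\<in>space time_space. \<bar>elem_process e b (fst z) (snd z)\<bar> \<le> B"
proof -
  obtain a s t \<eta> where e: "e = (a, s, t, \<eta>)" by (cases e)
  obtain B where B: "\<And>\<omega>. \<omega> \<in> space M \<Longrightarrow> \<bar>\<eta> \<omega>\<bar> \<le> B"
    using assms by (auto simp: elementary_def e bounded_rv_def)
  have "\<bar>elem_process e b r \<omega>\<bar> \<le> B" if "\<omega> \<in> space M" for r \<omega>
    using B[OF that] by (auto simp: e elem_process_def indicator_def)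
  then show ?thesis by (intro exI[of _ B]) (auto simp: space_time_space)
qed

lemma elem_process_square_integrable:
  assumes e: "elementary e"
  shows "integrable time_space (\<lambda>z. (elem_process e b (fst z) (snd z))\<^sup>2)"
proof -
  interpret P: finite_measure time_space by (rule finite_measure_time_space)
  obtain B where "\<forall>z\<in>space time_space. \<bar>elem_process e b (fst z) (snd z)\<bar> \<le> B"
    using elem_process_bounded[OF e] by blast
  then have "\<forall>z\<in>space time_space. (elem_process e b (fst z) (snd z))\<^sup>2 \<le> B\<^sup>2"
    by (metis abs_ge_zero power2_abs power_mono)
  then show ?thesis
    by (intro P.integrable_const_bound[of _ "B\<^sup>2"] borel_measurable_power elem_process_measurable[OF e])
      (auto intro!: AE_I2)
qed

lemma elem_process_inner:
  assumes e: "elementary (a, s, t, \<eta>)" and e': "elementary (b, s', t', \<eta>')"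
  shows "(\<integral>z. elem_process (a, s, t, \<eta>) c (fst z) (snd z) * elem_process (b, s', t', \<eta>') c (fst z) (snd z) \<partial>time_space) =
    (if a = c \<and> b = c then max 0 (min t t' - max s s') else 0) * expectation (\<lambda>\<omega>. \<eta> \<omega> * \<eta>' \<omega>)"
proof (cases "a = c \<and> b = c")
  case False
  then show ?thesis by (auto simp: elem_process_def)
next
  case True
  interpret PS: pair_sigma_finite "restrict_space lborel {0..T}" M
    by (rule pair_sigma_finite_time_space)
  have st: "0 \<le> s" "s < t" "t \<le> T" "0 \<le> s'" "s' < t'" "t' \<le> T"
    using e e' by (auto simp: elementary_def)
  let ?f = "\<lambda>z. elem_process (a, s, t, \<eta>) c (fst z) (snd z) * elem_process (b, s', t', \<eta>') c (fst z) (snd z)"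
  have "integrable time_space ?f"
    by (intro square_integrable_prod elem_process_measurable e e' elem_process_square_integrable)
  then have "(\<integral>z. ?f z \<partial>time_space) = (\<integral>r. (\<integral>\<omega>. ?f (r, \<omega>) \<partial>M) \<partial>restrict_space lborel {0..T})"
    unfolding time_space_def by (subst PS.integral_fst') auto
  also have "\<dots> = (\<integral>r. indicator {max s s'<..min t t'} r * expectation (\<lambda>\<omega>. \<eta> \<omega> * \<eta>' \<omega>) \<partial>restrict_space lborel {0..T})"
  proof (intro Bochner_Integration.integral_cong refl)
    fix r
    have "(\<integral>\<omega>. ?f (r, \<omega>) \<partial>M) = (\<integral>\<omega>. indicator {max s s'<..min t t'} r * (\<eta> \<omega> * \<eta>' \<omega>) \<partial>M)"
      using True by (intro Bochner_Integration.integral_cong refl)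
        (auto simp: elem_process_def indicator_def)
    then show "(\<integral>\<omega>. ?f (r, \<omega>) \<partial>M) = indicator {max s s'<..min t t'} r * expectation (\<lambda>\<omega>. \<eta> \<omega> * \<eta>' \<omega>)"
      by simp
  qed
  also have "\<dots> = (\<integral>r. indicator {max s s'<..min t t'} r \<partial>restrict_space lborel {0..T}) * expectation (\<lambda>\<omega>. \<eta> \<omega> * \<eta>' \<omega>)"
    by simp
  also have "(\<integral>r. indicator {max s s'<..min t t'} r \<partial>restrict_space lborel {0..T}) = (max 0 (min t t' - max s s') :: real)"
  proof -
    have "(\<integral>r. (indicator {max s s'<..min t t'} r :: real) \<partial>restrict_space lborel {0..T})
        = (\<integral>r. indicator {0..T} r *\<^sub>R (indicator {max s s'<..min t t'} r :: real) \<partial>lborel)"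
      by (rule integral_restrict_space) simp
    also have "\<dots> = (\<integral>r. (indicator {max s s'<..min t t'} r :: real) \<partial>lborel)"
      using st by (intro Bochner_Integration.integral_cong) (auto simp: indicator_def)
    also have "\<dots> = measure lborel {max s s'<..min t t'}" by simp
    also have "\<dots> = max 0 (min t t' - max s s')"
    proof -
      have "measure lborel {u<..v} = max 0 (v - u)" for u v :: real
        by (cases "u \<le> v") auto
      then show ?thesis .
    qed
    finally show ?thesis .
  qed
  finally show ?thesis using True by simp
qed

lemma elementary_isometry:
  assumes e: "elementary e" and e': "elementary e'"
  shows "expectation (\<lambda>\<omega>. elem_integral e \<omega> * elem_integral e' \<omega>) =
    (\<Sum>c\<in>UNIV. \<integral>z. elem_process e c (fst z) (snd z) * elem_process e' c (fst z) (snd z) \<partial>time_space)"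
proof -
  obtain a s t \<eta> where a: "e = (a, s, t, \<eta>)" by (cases e)
  obtain b s' t' \<eta>' where b: "e' = (b, s', t', \<eta>')" by (cases e')
  define q where "q = max 0 (min t t' - max s s')"
  have "(\<Sum>c\<in>UNIV. if a = c \<and> b = c then q else 0) = (\<Sum>c\<in>UNIV. if c = a then (if a = b then q else 0) else 0)"
    by (intro sum.cong) auto
  then show ?thesis
    unfolding a b covariation_elementary[OF e[unfolded a] e'[unfolded b]]
      elem_process_inner[OF e[unfolded a] e'[unfolded b]] q_def[symmetric]
    by (simp add: sum_distrib_right[symmetric])
qed

lemma list_integral_Nil [simp]: "list_integral [] = (\<lambda>_. 0)"
  and list_integral_Cons [simp]: "list_integral (e # L) = (\<lambda>\<omega>. elem_integral e \<omega> + list_integral L \<omega>)"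
  and list_process_Nil [simp]: "list_process [] = (\<lambda>b r \<omega>. 0)"
  and list_process_Cons [simp]: "list_process (e # L) = (\<lambda>b r \<omega>. elem_process e b r \<omega> + list_process L b r \<omega>)"
  by (auto simp: list_integral_def list_process_def fun_eq_iff)

lemma list_integral_append: "list_integral (L @ L') \<omega> = list_integral L \<omega> + list_integral L' \<omega>"
  and list_process_append: "list_process (L @ L') b r \<omega> = list_process L b r \<omega> + list_process L' b r \<omega>"
  by (auto simp: list_integral_def list_process_def)

definition elem_scale :: "real \<Rightarrow> 'i \<times> real \<times> real \<times> ('a \<Rightarrow> real) \<Rightarrow> 'i \<times> real \<times> real \<times> ('a \<Rightarrow> real)" where
  "elem_scale c = (\<lambda>(a, s, t, \<eta>). (a, s, t, \<lambda>\<omega>. c * \<eta> \<omega>))"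

lemma elementary_scale: "elementary e \<Longrightarrow> elementary (elem_scale c e)"
  using bounded_rv_mult[of "\<lambda>_. c"] by (auto simp: elementary_def elem_scale_def bounded_rv_def)

lemma list_integral_scale: "list_integral (map (elem_scale c) L) \<omega> = c * list_integral L \<omega>"
proof (induction L)
  case (Cons e L)
  have "elem_integral (elem_scale c e) \<omega> = c * elem_integral e \<omega>"
    by (cases e) (simp add: elem_integral_def elem_scale_def)
  with Cons show ?case by (simp add: distrib_left)
qed simp

lemma list_process_scale: "list_process (map (elem_scale c) L) b r \<omega> = c * list_process L b r \<omega>"
proof (induction L)
  case (Cons e L)
  have "elem_process (elem_scale c e) b r \<omega> = c * elem_process e b r \<omega>"
    by (cases e) (simp add: elem_process_def elem_scale_def)
  with Cons show ?case by (simp add: distrib_left)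
qed simp

lemma list_integral_measurable:
  assumes "\<forall>e\<in>set L. elementary e"
  shows "list_integral L \<in> borel_measurable (F T)" "list_integral L \<in> borel_measurable M"
  using assms
  by (induction L) (auto intro!: borel_measurable_add elementary_square_integrable(1,2))

lemma list_integral_square_integrable:
  assumes "\<forall>e\<in>set L. elementary e"
  shows "integrable M (\<lambda>\<omega>. (list_integral L \<omega>)\<^sup>2)" "expectation (list_integral L) = 0"
  using assms
proof (induction L)
  case (Cons e L)
  { case 1
    with Cons show ?case
      by (auto intro!: square_integrable_add list_integral_measurable elementary_square_integrable(2,3))
  next
    case 2
    have "integrable M (elem_integral e)" "integrable M (list_integral L)"
      using Cons 2 by (auto intro!: square_integrable_imp_integrable list_integral_measurable
          elementary_square_integrable(2,3))
    then show ?case using Cons 2 elementary_square_integrable(4)[of e] by simp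
  }
qed auto

lemma list_process_measurable:
  assumes "\<forall>e\<in>set L. elementary e"
  shows "(\<lambda>z. list_process L b (fst z) (snd z)) \<in> borel_measurable time_space"
  using assms by (induction L) (auto intro!: borel_measurable_add elem_process_measurable)

lemma list_process_square_integrable:
  assumes "\<forall>e\<in>set L. elementary e"
  shows "integrable time_space (\<lambda>z. (list_process L b (fst z) (snd z))\<^sup>2)"
  using assms
  by (induction L) (auto intro!: square_integrable_add list_process_measurable
      elem_process_square_integrable elem_process_measurable)

lemma list_isometry_inner:
  assumes "\<forall>e\<in>set L. elementary e" "\<forall>e\<in>set L'. elementary e"
  shows "expectation (\<lambda>\<omega>. list_integral L \<omega> * list_integral L' \<omega>) =
    (\<Sum>c\<in>UNIV. \<integral>z. list_process L c (fst z) (snd z) * list_process L' c (fst z) (snd z) \<partial>time_space)"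
  using assms(1)
proof (induction L)
  case (Cons e L)
  then have e: "elementary e" and L: "\<forall>e\<in>set L. elementary e" by auto
  note L' = assms(2)
  have 1: "expectation (\<lambda>\<omega>. elem_integral e \<omega> * list_integral L' \<omega>) =
    (\<Sum>c\<in>UNIV. \<integral>z. elem_process e c (fst z) (snd z) * list_process L' c (fst z) (snd z) \<partial>time_space)"
    using L'
  proof (induction L')
    case (Cons e' L')
    then have e': "elementary e'" and L': "\<forall>e\<in>set L'. elementary e" by auto
    have i1: "integrable M (\<lambda>\<omega>. elem_integral e \<omega> * elem_integral e' \<omega>)"
      "integrable M (\<lambda>\<omega>. elem_integral e \<omega> * list_integral L' \<omega>)"
      by (intro square_integrable_prod elementary_square_integrable e e'
          list_integral_measurable list_integral_square_integrable L')+
    have i2: "integrable time_space (\<lambda>z. elem_process e c (fst z) (snd z) * elem_process e' c (fst z) (snd z))"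
      "integrable time_space (\<lambda>z. elem_process e c (fst z) (snd z) * list_process L' c (fst z) (snd z))" for c
      by (intro square_integrable_prod elem_process_measurable elem_process_square_integrable e e'
          list_process_measurable list_process_square_integrable L')+
    show ?case
      using Cons.IH[OF L'] i1 i2 elementary_isometry[OF e e']
      by (simp add: distrib_left sum.distrib)
  qed simp
  have i1: "integrable M (\<lambda>\<omega>. elem_integral e \<omega> * list_integral L' \<omega>)"
    "integrable M (\<lambda>\<omega>. list_integral L \<omega> * list_integral L' \<omega>)"
    by (intro square_integrable_prod elementary_square_integrable e
        list_integral_measurable list_integral_square_integrable L L')+
  have i2: "integrable time_space (\<lambda>z. elem_process e c (fst z) (snd z) * list_process L' c (fst z) (snd z))"
    "integrable time_space (\<lambda>z. list_process L c (fst z) (snd z) * list_process L' c (fst z) (snd z))" for c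
    by (intro square_integrable_prod elem_process_measurable elem_process_square_integrable e
        list_process_measurable list_process_square_integrable L L')+
  show ?case
    using Cons.IH[OF L] i1 i2 1 by (simp add: distrib_right sum.distrib)
qed simp

lemma list_isometry:
  assumes "\<forall>e\<in>set L. elementary e"
  shows "expectation (\<lambda>\<omega>. (list_integral L \<omega>)\<^sup>2) =
    (\<Sum>c\<in>UNIV. \<integral>z. (list_process L c (fst z) (snd z))\<^sup>2 \<partial>time_space)"
  using list_isometry_inner[OF assms assms] by (simp add: power2_eq_square)

lemma list_isometry_sqdist:
  assumes L: "\<forall>e\<in>set L. elementary e" and L': "\<forall>e\<in>set L'. elementary e"
  shows "sqdist M (list_integral L) (list_integral L') =
    (\<Sum>c\<in>UNIV. sqdist time_space (\<lambda>z. list_process L c (fst z) (snd z)) (\<lambda>z. list_process L' c (fst z) (snd z)))"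
proof -
  define L'' where "L'' = L @ map (elem_scale (- 1)) L'"
  have el: "\<forall>e\<in>set L''. elementary e" using L L' by (auto simp: L''_def elementary_scale)
  have I: "list_integral L'' \<omega> = list_integral L \<omega> - list_integral L' \<omega>" for \<omega>
    by (simp add: L''_def list_integral_append list_integral_scale)
  have P: "list_process L'' b r \<omega> = list_process L b r \<omega> - list_process L' b r \<omega>" for b r \<omega>
    by (simp add: L''_def list_process_append list_process_scale)
  have "sqdist M (list_integral L) (list_integral L') = ennreal (expectation (\<lambda>\<omega>. (list_integral L'' \<omega>)\<^sup>2))"
    unfolding I by (rule sqdist_eq_integral) (use list_integral_square_integrable(1)[OF el] in \<open>simp add: I\<close>)
  also have "\<dots> = (\<Sum>c\<in>UNIV. ennreal (\<integral>z. (list_process L'' c (fst z) (snd z))\<^sup>2 \<partial>time_space))"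
    unfolding list_isometry[OF el] by (rule sum_ennreal[symmetric]) auto
  also have "\<dots> = (\<Sum>c\<in>UNIV. sqdist time_space (\<lambda>z. list_process L c (fst z) (snd z)) (\<lambda>z. list_process L' c (fst z) (snd z)))"
    unfolding P
    by (intro sum.cong refl sqdist_eq_integral[symmetric])
      (use list_process_square_integrable[OF el] in \<open>simp add: P\<close>)
  finally show ?thesis .
qed

end

section \<open>Simple approximation of progressive processes\<close>

lemma set_integrable_bounded_Icc:
  fixes g :: "real \<Rightarrow> real"
  assumes [measurable]: "g \<in> borel_measurable borel" and B: "\<And>x. \<bar>g x\<bar> \<le> B"
  shows "set_integrable lborel {a..b} g"
  unfolding set_integrable_def
proof (rule Bochner_Integration.integrable_bound)
  have "integrable lborel (indicator {a..b} :: real \<Rightarrow> real)"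
    by (intro integrable_real_indicator) (auto simp: emeasure_lborel_Icc_eq)
  then show "integrable lborel (\<lambda>x. B * indicator {a..b} x)" by simp
  show "AE x in lborel. norm (indicator {a..b} x *\<^sub>R g x) \<le> norm (B * indicator {a..b} x)"
  proof (rule AE_I2)
    fix x
    show "norm (indicator {a..b} x *\<^sub>R g x) \<le> norm (B * indicator {a..b} x)"
      using B[of x] by (cases "x \<in> {a..b}") auto
  qed
qed simp

text \<open>Lebesgue's differentiation theorem for averages to the right, applied to the reflected function.\<close>

lemma left_average_tendsto:
  fixes g :: "real \<Rightarrow> real"
  assumes g [measurable]: "g \<in> borel_measurable borel" and B: "\<And>x. \<bar>g x\<bar> \<le> B"
  shows "AE t in lborel. \<forall>e>0. \<exists>d>0. \<forall>h. 0 < h \<and> h < d \<longrightarrow> \<bar>(LBINT x:{t - h..t}. g x) / h - g t\<bar> < e"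
proof -
  define f where "f x = g (- x)" for x
  have f [measurable]: "f \<in> borel_measurable borel" unfolding f_def by measurable
  have fint: "set_integrable lborel {a..b} f" for a b
    by (rule set_integrable_bounded_Icc[OF f, of B]) (simp add: f_def B)
  have gint: "set_integrable lborel {a..b} g" for a b
    by (rule set_integrable_bounded_Icc[OF g B])
  have "f integrable_on cbox a b" for a b
    using set_borel_integral_eq_integral(1)[OF fint] by simp
  then obtain N where N: "negligible N"
    and lim: "\<And>x e. \<lbrakk>x \<notin> N; 0 < e\<rbrakk> \<Longrightarrow> \<exists>d>0. \<forall>h. 0 < h \<and> h < d \<longrightarrow>
      norm (integral (cbox x (x + h *\<^sub>R One)) f /\<^sub>R h ^ DIM(real) - f x) < e"
    using integrable_ccontinuous_explicit[of f] by metis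
  have "negligible (uminus ` N)"
  proof (rule negligible_differentiable_image_negligible[OF _ N])
    show "uminus differentiable_on N"
      unfolding differentiable_on_def by (intro ballI differentiable_minus) simp
  qed simp
  then have "AE t in lebesgue. t \<notin> uminus ` N"
    unfolding negligible_iff_null_sets by (rule AE_not_in)
  then have "AE t in lborel. t \<notin> uminus ` N" unfolding AE_completion_iff .
  then show ?thesis
  proof (rule AE_mp, intro AE_I2 impI allI)
    fix t e :: real assume t: "t \<notin> uminus ` N" and e: "0 < e"
    have "- t \<notin> N" using t by (metis image_eqI minus_minus)
    from lim[OF this e] obtain d where d: "d > 0"
      "\<And>h. 0 < h \<Longrightarrow> h < d \<Longrightarrow> norm (integral (cbox (- t) (- t + h *\<^sub>R One)) f /\<^sub>R h ^ DIM(real) - f (- t)) < e"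
      by metis
    have "\<bar>(LBINT x:{t - h..t}. g x) / h - g t\<bar> < e" if h: "0 < h" "h < d" for h
    proof -
      have "integral (cbox (- t) (- t + h *\<^sub>R One)) f = integral {- t..- (t - h)} (\<lambda>x. g (- x))"
        by (simp add: f_def[abs_def])
      also have "\<dots> = integral {t - h..t} g" by (rule Henstock_Kurzweil_Integration.integral_reflect_real)
      also have "\<dots> = (LBINT x:{t - h..t}. g x)"
        by (rule set_borel_integral_eq_integral(2)[OF gint, symmetric])
      finally show ?thesis using d(2)[OF h] by (simp add: f_def divide_inverse mult.commute)
    qed
    then show "\<exists>d>0. \<forall>h. 0 < h \<and> h < d \<longrightarrow> \<bar>(LBINT x:{t - h..t}. g x) / h - g t\<bar> < e"
      using d(1) by blast
  qed
qed

text \<open>The cell \<open>[b - h, b]\<close> lies to the left of \<open>t\<close> without touching it. Its integral is the difference of two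
  integrals ending in \<open>t\<close>, of lengths at most \<open>2h\<close> and \<open>h\<close>, so the error is at most three times that of
  the averages ending in \<open>t\<close>.\<close>

lemma lagged_average_tendsto:
  fixes g :: "real \<Rightarrow> real"
  assumes g [measurable]: "g \<in> borel_measurable borel" and B: "\<And>x. \<bar>g x\<bar> \<le> B"
  shows "AE t in lborel. \<forall>e>0. \<exists>d>0. \<forall>b h. 0 < h \<and> h < d \<and> b < t \<and> t \<le> b + h \<longrightarrow>
    \<bar>(LBINT x:{b - h..b}. g x) / h - g t\<bar> \<le> e"
  using left_average_tendsto[OF assms]
proof (rule AE_mp, intro AE_I2 impI allI)
  fix t e :: real
  assume lim: "\<forall>e>0. \<exists>d>0. \<forall>h. 0 < h \<and> h < d \<longrightarrow> \<bar>(LBINT x:{t - h..t}. g x) / h - g t\<bar> < e"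
    and e: "0 < e"
  define L where "L h = (LBINT x:{t - h..t}. g x)" for h
  from e have "0 < e/3" by simp
  from lim[rule_format, OF this] obtain d where d: "d > 0" "\<And>h. 0 < h \<Longrightarrow> h < d \<Longrightarrow> \<bar>L h / h - g t\<bar> < e/3"
    unfolding L_def by blast
  have "\<bar>(LBINT x:{b - h..b}. g x) / h - g t\<bar> \<le> e"
    if h: "0 < h" "h < d/2" "b < t" "t \<le> b + h" for b h
  proof -
    define p q where "p = t - b" and "q = t - (b - h)"
    have pq: "0 < p" "p \<le> h" "q = p + h" "p < d" "0 < q" "q < d" using h by (auto simp: p_def q_def)
    have gi: "set_integrable lborel {a..c} g" for a c by (rule set_integrable_bounded_Icc[OF g B])
    have int_eq: "(LBINT x:{a..c}. g x) = integral {a..c} g" for a c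
      by (rule set_borel_integral_eq_integral(2)[OF gi])
    have "integral {b - h..b} g + integral {b..t} g = integral {b - h..t} g"
      by (rule Henstock_Kurzweil_Integration.integral_combine[OF _ _ set_borel_integral_eq_integral(1)[OF gi]])
        (use h in linarith)+
    moreover have "L p = integral {b..t} g" "L q = integral {b - h..t} g"
      by (simp_all only: L_def int_eq p_def q_def, simp_all)
    ultimately have "(LBINT x:{b - h..b}. g x) + L p = L q" by (simp only: int_eq)
    then have eq: "(LBINT x:{b - h..b}. g x) - h * g t = (L q - q * g t) - (L p - p * g t)"
      using pq(3) by (simp add: algebra_simps)
    have bnd: "\<bar>L r - r * g t\<bar> \<le> r * (e/3)" if "0 < r" "r < d" for r
    proof -
      have "\<bar>L r - r * g t\<bar> = r * \<bar>L r / r - g t\<bar>"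
        using that by (simp add: abs_mult_pos' right_diff_distrib)
      also have "\<dots> \<le> r * (e/3)" using d(2)[OF that] that by (intro mult_left_mono) auto
      finally show ?thesis .
    qed
    have "\<bar>(LBINT x:{b - h..b}. g x) - h * g t\<bar> \<le> q * (e/3) + p * (e/3)"
      unfolding eq using bnd[OF pq(5,6)] bnd[OF pq(1,4)] by linarith
    also have "\<dots> = (q + p) * (e/3)" by (simp add: distrib_right)
    also have "\<dots> \<le> (3 * h) * (e/3)" using pq e by (intro mult_right_mono) auto
    finally have "\<bar>(LBINT x:{b - h..b}. g x) - h * g t\<bar> \<le> h * e" by simp
    moreover have "(LBINT x:{b - h..b}. g x) / h - g t = ((LBINT x:{b - h..b}. g x) - h * g t) / h"
      using h by (simp add: diff_divide_distrib)
    ultimately show ?thesis using h by (simp add: abs_divide pos_divide_le_eq mult.commute)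
  qed
  note bound = this
  show "\<exists>d>0. \<forall>b h. 0 < h \<and> h < d \<and> b < t \<and> t \<le> b + h \<longrightarrow> \<bar>(LBINT x:{b - h..b}. g x) / h - g t\<bar> \<le> e"
  proof (intro exI[of _ "d/2"] conjI allI impI)
    fix b h assume "0 < h \<and> h < d/2 \<and> b < t \<and> t \<le> b + h"
    then show "\<bar>(LBINT x:{b - h..b}. g x) / h - g t\<bar> \<le> e" by (intro bound) blast+
  qed (use d(1) in simp)
qed

context brownian_family begin

lemma measurable_ident_time_space:
  "(\<lambda>z. z) \<in> measurable time_space (restrict_space borel {0..T} \<Otimes>\<^sub>M F T)"
proof (rule measurable_pair)
  have "(\<lambda>x. x) \<in> measurable (restrict_space lborel {0..T}) (restrict_space borel {0..T})"
    by (intro measurable_ident_sets sets_restrict_space_cong) simp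
  from measurable_compose[OF measurable_fst[of _ M] this]
  show "fst \<circ> (\<lambda>z. z) \<in> measurable time_space (restrict_space borel {0..T})"
    unfolding time_space_def by (simp add: comp_def)
  have "(\<lambda>x. x) \<in> measurable M (F T)"
    using sets_F_events[of T] T_pos by (auto simp: measurable_def)
  from measurable_compose[OF measurable_snd[of "restrict_space lborel {0..T}"] this]
  show "snd \<circ> (\<lambda>z. z) \<in> measurable time_space (F T)"
    unfolding time_space_def by (simp add: comp_def)
qed

lemma progressive_time_space:
  assumes "progressively_measurable F T \<xi>"
  shows "(\<lambda>z. \<xi> (fst z) (snd z)) \<in> borel_measurable time_space"
proof -
  have "(\<lambda>(s, \<omega>). \<xi> s \<omega>) \<in> borel_measurable (restrict_space borel {0..T} \<Otimes>\<^sub>M F T)"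
    using assms T_pos by (simp add: progressively_measurable_def)
  from measurable_compose[OF measurable_ident_time_space this]
  show ?thesis by (simp add: case_prod_beta')
qed

lemma iterated_eq_sqdist:
  assumes [measurable]: "(\<lambda>z. f (fst z) (snd z)) \<in> borel_measurable time_space"
    "(\<lambda>z. g (fst z) (snd z)) \<in> borel_measurable time_space"
  shows "(\<integral>\<^sup>+\<omega>. (\<integral>\<^sup>+t\<in>{0..T}. ennreal ((f t \<omega> - g t \<omega>)\<^sup>2) \<partial>lborel) \<partial>M) =
    sqdist time_space (\<lambda>z. f (fst z) (snd z)) (\<lambda>z. g (fst z) (snd z))"
proof -
  interpret PS: pair_sigma_finite "restrict_space lborel {0..T}" M
    by (rule pair_sigma_finite_time_space)
  have m: "(\<lambda>z. ennreal ((f (fst z) (snd z) - g (fst z) (snd z))\<^sup>2)) \<in>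
      borel_measurable (restrict_space lborel {0..T} \<Otimes>\<^sub>M M)"
    unfolding time_space_def[symmetric] by measurable
  have "(\<integral>\<^sup>+\<omega>. (\<integral>\<^sup>+t\<in>{0..T}. ennreal ((f t \<omega> - g t \<omega>)\<^sup>2) \<partial>lborel) \<partial>M)
      = (\<integral>\<^sup>+\<omega>. (\<integral>\<^sup>+t. ennreal ((f t \<omega> - g t \<omega>)\<^sup>2) \<partial>restrict_space lborel {0..T}) \<partial>M)"
    by (intro nn_integral_cong nn_integral_restrict_space[symmetric]) simp
  also have "\<dots> = sqdist time_space (\<lambda>z. f (fst z) (snd z)) (\<lambda>z. g (fst z) (snd z))"
    unfolding sqdist_def time_space_def using PS.nn_integral_snd[OF m] by simp
  finally show ?thesis .
qed

text \<open>The average of \<open>\<xi>\<close> over the \<open>h\<close> time units before \<open>b\<close>, with \<open>\<xi>\<close> read as \<open>0\<close> outside \<open>[0,T]\<close>. Looking back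
  keeps it measurable at time \<open>b\<close>.\<close>

definition lagged_average :: "real \<Rightarrow> (real \<Rightarrow> 'a \<Rightarrow> real) \<Rightarrow> real \<Rightarrow> 'a \<Rightarrow> real" where
  "lagged_average h \<xi> b \<omega> = (LBINT x:{b - h..b}. indicator {0..T} x * \<xi> x \<omega>) / h"

lemma progressive_path_measurable:
  fixes \<xi> :: "real \<Rightarrow> 'a \<Rightarrow> real"
  assumes \<xi>: "progressively_measurable F T \<xi>" and \<omega>: "\<omega> \<in> space M"
  shows "(\<lambda>x. indicator {0..T} x * \<xi> x \<omega>) \<in> borel_measurable borel"
proof -
  have \<xi>': "(\<lambda>(s, \<omega>). \<xi> s \<omega>) \<in> borel_measurable (restrict_space borel {0..T} \<Otimes>\<^sub>M F T)"
    using \<xi> T_pos by (simp add: progressively_measurable_def)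
  have "(\<lambda>x. (x, \<omega>)) \<in> measurable (restrict_space borel {0..T}) (restrict_space borel {0..T} \<Otimes>\<^sub>M F T)"
    using \<omega> by (intro measurable_Pair2') simp
  from measurable_compose[OF this \<xi>']
  have "(\<lambda>x. \<xi> x \<omega>) \<in> borel_measurable (restrict_space borel {0..T})" by simp
  then have "(\<lambda>x. indicator {0..T} x *\<^sub>R \<xi> x \<omega>) \<in> borel_measurable borel"
    using borel_measurable_restrict_space_iff[of "{0..T}" borel "\<lambda>x. \<xi> x \<omega>"] by simp
  then show ?thesis by simp
qed

lemma lagged_average_adapted:
  assumes \<xi>: "progressively_measurable F T \<xi>" and b: "0 \<le> b" "b \<le> T"
  shows "lagged_average h \<xi> b \<in> borel_measurable (F b)"
proof -
  interpret R: finite_measure "restrict_space lborel {0..b}"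
    by (intro finite_measureI) (simp add: emeasure_restrict_space space_restrict_space emeasure_lborel_Icc_eq)
  have eq: "(LBINT x:{b - h..b}. indicator {0..T} x * \<xi> x \<omega>) =
      (\<integral>x. indicator {b - h..b} x * \<xi> x \<omega> \<partial>restrict_space lborel {0..b})" for \<omega>
  proof -
    have "(\<integral>x. indicator {b - h..b} x * \<xi> x \<omega> \<partial>restrict_space lborel {0..b}) =
        (\<integral>x. indicator {0..b} x *\<^sub>R (indicator {b - h..b} x * \<xi> x \<omega>) \<partial>lborel)"
      by (rule integral_restrict_space) simp
    also have "\<dots> = (LBINT x:{b - h..b}. indicator {0..T} x * \<xi> x \<omega>)"
      unfolding set_lebesgue_integral_def using b
      by (intro Bochner_Integration.integral_cong) (auto simp: indicator_def)
    finally show ?thesis by simp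
  qed
  have \<xi>': "(\<lambda>(s, \<omega>). \<xi> s \<omega>) \<in> borel_measurable (restrict_space borel {0..b} \<Otimes>\<^sub>M F b)"
    using \<xi> b by (simp add: progressively_measurable_def)
  have "sets (restrict_space borel {0..b} \<Otimes>\<^sub>M F b) = sets (restrict_space lborel {0..b} \<Otimes>\<^sub>M F b)"
    by (intro sets_pair_measure_cong sets_restrict_space_cong) simp_all
  from \<xi>'[unfolded measurable_cong_sets[OF this refl]]
  have "(\<lambda>(s, \<omega>). \<xi> s \<omega>) \<in> borel_measurable (restrict_space lborel {0..b} \<Otimes>\<^sub>M F b)" .
  from measurable_pair_swap[OF this]
  have "(\<lambda>z. \<xi> (snd z) (fst z)) \<in> borel_measurable (F b \<Otimes>\<^sub>M restrict_space lborel {0..b})"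
    by (simp add: case_prod_beta')
  moreover have "(\<lambda>x. indicator {b - h..b} x :: real) \<in> borel_measurable (restrict_space lborel {0..b})"
    by (intro measurable_restrict_space1) simp
  from measurable_compose[OF measurable_snd this]
  have "(\<lambda>z. indicator {b - h..b} (snd z) :: real) \<in> borel_measurable (F b \<Otimes>\<^sub>M restrict_space lborel {0..b})" .
  ultimately have "(\<lambda>(\<omega>, x). indicator {b - h..b} x * \<xi> x \<omega>) \<in> borel_measurable (F b \<Otimes>\<^sub>M restrict_space lborel {0..b})"
    unfolding case_prod_beta' by (intro borel_measurable_times)
  from R.borel_measurable_lebesgue_integral[OF this]
  show ?thesis unfolding lagged_average_def[abs_def] eq by (intro borel_measurable_divide) auto
qed

lemma lagged_average_bounded:
  assumes \<xi>: "progressively_measurable F T \<xi>" and \<omega>: "\<omega> \<in> space M"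
    and B: "\<And>t. t \<in> {0..T} \<Longrightarrow> \<bar>\<xi> t \<omega>\<bar> \<le> B" and "0 < h" and "0 \<le> B"
  shows "\<bar>lagged_average h \<xi> b \<omega>\<bar> \<le> B"
proof -
  let ?g = "\<lambda>x. indicator {0..T} x * \<xi> x \<omega>"
  have gB: "\<bar>?g x\<bar> \<le> B" for x using B[of x] \<open>0 \<le> B\<close> by (auto simp: indicator_def)
  note gi = set_integrable_bounded_Icc[OF progressive_path_measurable[OF \<xi> \<omega>] gB, of "b - h" b]
  have "norm (integral {b - h..b} ?g) \<le> integral {b - h..b} (\<lambda>_. B)"
    by (rule integral_norm_bound_integral) (use set_borel_integral_eq_integral(1)[OF gi] gB in auto)
  also have "\<dots> = h * B" using \<open>0 < h\<close> by simp
  finally show ?thesis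
    unfolding lagged_average_def set_borel_integral_eq_integral(2)[OF gi] using \<open>0 < h\<close>
    by (simp add: abs_divide pos_divide_le_eq mult.commute)
qed

definition average_step :: "(real \<Rightarrow> 'a \<Rightarrow> real) \<Rightarrow> nat \<Rightarrow> 'a step_data" where
  "average_step \<xi> n = (Suc n, \<lambda>k. T * k / Suc n, \<lambda>k. lagged_average (T / Suc n) \<xi> (T * k / Suc n))"

lemma average_step_data:
  assumes \<xi>: "progressively_measurable F T \<xi>"
    and B: "\<And>t \<omega>. t \<in> {0..T} \<Longrightarrow> \<omega> \<in> space M \<Longrightarrow> \<bar>\<xi> t \<omega>\<bar> \<le> B" and "0 \<le> B"
  shows "step_data F T (average_step \<xi> n)"
proof -
  have "lagged_average (T / Suc n) \<xi> (T * k / Suc n) \<in> borel_measurable (F (T * k / Suc n))" if "k < Suc n" for k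
  proof (rule lagged_average_adapted[OF \<xi>])
    show "0 \<le> T * k / Suc n" using T_pos by simp
    have "T * real k \<le> T * real (Suc n)" using that T_pos by (intro mult_left_mono) auto
    then show "T * k / Suc n \<le> T" by (subst pos_divide_le_eq) auto
  qed
  moreover have "\<bar>lagged_average (T / Suc n) \<xi> (T * k / Suc n) \<omega>\<bar> \<le> B" if "\<omega> \<in> space M" for k \<omega>
    using T_pos B that by (intro lagged_average_bounded[OF \<xi> that _ _ \<open>0 \<le> B\<close>]) auto
  moreover have "T * real k / real (Suc n) < T * real (Suc k) / real (Suc n)" for k
    using T_pos by (intro divide_strict_right_mono mult_strict_left_mono) auto
  ultimately show ?thesis
    unfolding step_data_def average_step_def prod.case space_F by (auto simp del: of_nat_Suc)
qed

lemma step_process_measurable: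
  assumes "step_data F T \<phi>"
  shows "(\<lambda>z. step_process \<phi> (fst z) (snd z)) \<in> borel_measurable time_space"
proof -
  obtain m \<tau> \<eta> where \<phi>: "\<phi> = (m, \<tau>, \<eta>)" by (cases \<phi>)
  have \<tau>: "\<tau> 0 = 0" "\<tau> m = T" "\<And>k. k < m \<Longrightarrow> \<tau> k < \<tau> (Suc k)"
    and \<eta>: "\<And>k. k < m \<Longrightarrow> \<eta> k \<in> borel_measurable (F (\<tau> k))"
    using assms by (auto simp: step_data_def \<phi>)
  have mono: "\<tau> j \<le> \<tau> k" if "j \<le> k" "k \<le> m" for j k
    using that
  proof (induction k rule: dec_induct)
    case (step k) then show ?case using \<tau>(3)[of k] by force
  qed simp
  have "\<eta> k \<in> borel_measurable M" if "k < m" for k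
    using measurable_F_M[OF \<eta>[OF that]] mono[of 0 k] mono[of k m] \<tau> that by auto
  from measurable_snd_time_space[OF this] show ?thesis
    unfolding step_process_def \<phi> prod.case
    by (intro borel_measurable_sum borel_measurable_times
        measurable_compose[OF measurable_fst_time_space borel_measurable_indicator]) auto
qed

lemma average_step_process:
  assumes "0 < t" "t \<le> T"
  obtains k where "T * real k / Suc n < t" "t \<le> T * real k / Suc n + T / Suc n"
    "step_process (average_step \<xi> n) t \<omega> = lagged_average (T / Suc n) \<xi> (T * k / Suc n) \<omega>"
proof -
  define y where "y = t * Suc n / T"
  have "t * real (Suc n) \<le> T * real (Suc n)" using assms by (intro mult_right_mono) auto
  then have y: "0 < y" "y \<le> Suc n"
    using assms T_pos unfolding y_def by (simp, subst pos_divide_le_eq, auto simp: mult.commute)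
  \<comment> \<open>cells are open on the left, hence the ceiling\<close>
  define k where "k = nat (\<lceil>y\<rceil> - 1)"
  have "1 \<le> \<lceil>y\<rceil>" using y by linarith
  then have rk: "real k = of_int \<lceil>y\<rceil> - 1" by (simp add: k_def)
  then have ky: "real k < y" "y \<le> real k + 1" by linarith+
  have kn: "k < Suc n" using ky(1) y(2) by linarith
  have iff: "t \<in> {T * real j / Suc n<..T * real (Suc j) / Suc n} \<longleftrightarrow> real j < y \<and> y \<le> real j + 1" for j
    using T_pos by (auto simp: y_def field_simps)
  have uniq: "j = k" if "real j < y" "y \<le> real j + 1" for j
    using that ky by linarith
  have "step_process (average_step \<xi> n) t \<omega> =
      (\<Sum>j<Suc n. if j = k then lagged_average (T / Suc n) \<xi> (T * k / Suc n) \<omega> else 0)"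
    unfolding step_process_def average_step_def prod.case
    using iff ky uniq by (intro sum.cong refl) (auto simp del: of_nat_Suc greaterThanAtMost_iff simp: indicator_def)
  also have "\<dots> = lagged_average (T / Suc n) \<xi> (T * k / Suc n) \<omega>"
    using kn by simp
  finally have "step_process (average_step \<xi> n) t \<omega> = lagged_average (T / Suc n) \<xi> (T * k / Suc n) \<omega>" .
  moreover have "t \<in> {T * real k / Suc n<..T * real (Suc k) / Suc n}" using iff ky by blast
  ultimately show thesis
    by (intro that[of k]) (auto simp: add_divide_distrib distrib_left)
qed

text \<open>Path by path the step processes converge at almost every time; boundedness allows dominated
  convergence, first in time and then over \<open>\<Omega>\<close>.\<close>

lemma average_step_tendsto:
  assumes \<xi>: "progressively_measurable F T \<xi>"
    and B: "\<And>t \<omega>. t \<in> {0..T} \<Longrightarrow> \<omega> \<in> space M \<Longrightarrow> \<bar>\<xi> t \<omega>\<bar> \<le> B" and "0 \<le> B"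
  shows "(\<lambda>n. sqdist time_space (\<lambda>z. \<xi> (fst z) (snd z)) (\<lambda>z. step_process (average_step \<xi> n) (fst z) (snd z))) \<longlonglongrightarrow> 0"
proof -
  note sd = average_step_data[OF \<xi> B \<open>0 \<le> B\<close>]
  have [measurable]: "(\<lambda>z. \<xi> (fst z) (snd z)) \<in> borel_measurable time_space"
    by (rule progressive_time_space[OF \<xi>])
  have [measurable]: "(\<lambda>z. step_process (average_step \<xi> n) (fst z) (snd z)) \<in> borel_measurable time_space" for n
    by (rule step_process_measurable[OF sd])
  let ?R = "restrict_space lborel {0..T}"
  interpret R: finite_measure ?R by (rule finite_measure_Leb)
  interpret PS: pair_sigma_finite ?R M by (rule pair_sigma_finite_time_space)
  define d where "d n t \<omega> = ennreal ((\<xi> t \<omega> - step_process (average_step \<xi> n) t \<omega>)\<^sup>2)" for n t \<omega>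
  have dm: "(\<lambda>z. d n (fst z) (snd z)) \<in> borel_measurable (?R \<Otimes>\<^sub>M M)" for n
    unfolding d_def time_space_def[symmetric] by measurable
  have eq: "sqdist time_space (\<lambda>z. \<xi> (fst z) (snd z)) (\<lambda>z. step_process (average_step \<xi> n) (fst z) (snd z)) =
      (\<integral>\<^sup>+\<omega>. (\<integral>\<^sup>+t. d n t \<omega> \<partial>?R) \<partial>M)" for n
    unfolding sqdist_def time_space_def d_def[symmetric] using PS.nn_integral_snd[OF dm[of n]] by simp
  have d_le: "d n t \<omega> \<le> ennreal ((2 * B)\<^sup>2)" if t: "0 < t" "t \<le> T" and \<omega>: "\<omega> \<in> space M" for n t \<omega>
  proof -
    obtain k where "step_process (average_step \<xi> n) t \<omega> = lagged_average (T / Suc n) \<xi> (T * k / Suc n) \<omega>"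
      using average_step_process[OF t] by blast
    moreover have "\<bar>lagged_average (T / Suc n) \<xi> (T * k / Suc n) \<omega>\<bar> \<le> B"
      using T_pos B \<omega> by (intro lagged_average_bounded[OF \<xi> \<omega> _ _ \<open>0 \<le> B\<close>]) auto
    moreover have "\<bar>\<xi> t \<omega>\<bar> \<le> B" using B[of t \<omega>] t \<omega> by simp
    ultimately have "\<bar>\<xi> t \<omega> - step_process (average_step \<xi> n) t \<omega>\<bar> \<le> 2 * B" by linarith
    then have "(\<xi> t \<omega> - step_process (average_step \<xi> n) t \<omega>)\<^sup>2 \<le> (2 * B)\<^sup>2"
      by (metis abs_ge_zero power2_abs power_mono)
    then show ?thesis unfolding d_def by (rule ennreal_leI)
  qed
  have pos: "AE t in ?R. 0 < t \<and> t \<le> T"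
  proof -
    have "AE t in lborel. t \<noteq> (0::real)" by (rule AE_lborel_singleton)
    then show ?thesis by (subst AE_restrict_space_iff) (auto elim!: eventually_mono)
  qed
  have fin: "ennreal ((2 * B)\<^sup>2) * emeasure ?R (space ?R) < \<infinity>"
    unfolding infinity_ennreal_def ennreal_mult_less_top
    using R.emeasure_finite[of "space ?R"] by (simp only: less_top[symmetric]) simp
  have inner: "(\<lambda>n. \<integral>\<^sup>+t. d n t \<omega> \<partial>?R) \<longlonglongrightarrow> 0" if \<omega>: "\<omega> \<in> space M" for \<omega>
  proof -
    let ?g = "\<lambda>x. indicator {0..T} x * \<xi> x \<omega>"
    have gB: "\<bar>?g x\<bar> \<le> B" for x using B[of x \<omega>] \<omega> \<open>0 \<le> B\<close> by (auto simp: indicator_def)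
    have "AE t in lborel. \<forall>e>0. \<exists>d>0. \<forall>b h. 0 < h \<and> h < d \<and> b < t \<and> t \<le> b + h \<longrightarrow>
        \<bar>(LBINT x:{b - h..b}. ?g x) / h - ?g t\<bar> \<le> e"
      by (rule lagged_average_tendsto[OF progressive_path_measurable[OF \<xi> \<omega>] gB])
    then have "AE t in ?R. \<forall>e>0. \<exists>d>0. \<forall>b h. 0 < h \<and> h < d \<and> b < t \<and> t \<le> b + h \<longrightarrow>
        \<bar>lagged_average h \<xi> b \<omega> - ?g t\<bar> \<le> e"
      unfolding lagged_average_def by (subst AE_restrict_space_iff) (auto elim!: eventually_mono)
    with pos have "AE t in ?R. (\<lambda>n. d n t \<omega>) \<longlonglongrightarrow> 0"
    proof eventually_elim
      case (elim t)
      then have t: "0 < t" "t \<le> T" by auto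
      have "(\<lambda>n. \<xi> t \<omega> - step_process (average_step \<xi> n) t \<omega>) \<longlonglongrightarrow> 0"
      proof (rule LIMSEQ_I)
        fix e :: real assume "0 < e"
        then obtain \<delta> where \<delta>: "\<delta> > 0" "\<And>b h. 0 < h \<Longrightarrow> h < \<delta> \<Longrightarrow> b < t \<Longrightarrow> t \<le> b + h \<Longrightarrow>
            \<bar>lagged_average h \<xi> b \<omega> - ?g t\<bar> \<le> e/2"
          using elim(2) by (metis half_gt_zero)
        obtain N where N: "T / \<delta> < real N" using reals_Archimedean2 by blast
        have "norm (\<xi> t \<omega> - step_process (average_step \<xi> n) t \<omega> - 0) < e" if "N \<le> n" for n
        proof -
          have "T / \<delta> < real (Suc n)" using N that by simp
          then have h: "0 < T / Suc n" "T / Suc n < \<delta>"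
            using T_pos \<open>\<delta> > 0\<close> by (auto simp: field_simps)
          obtain k where k: "T * real k / Suc n < t" "t \<le> T * real k / Suc n + T / Suc n"
            "step_process (average_step \<xi> n) t \<omega> = lagged_average (T / Suc n) \<xi> (T * k / Suc n) \<omega>"
            using average_step_process[OF t] by blast
          from \<delta>(2)[OF h k(1,2)] show ?thesis
            unfolding k(3) using t \<open>0 < e\<close> by (simp add: abs_minus_commute)
        qed
        then show "\<exists>N. \<forall>n\<ge>N. norm (\<xi> t \<omega> - step_process (average_step \<xi> n) t \<omega> - 0) < e" by blast
      qed
      from tendsto_power[OF this, of 2] show "(\<lambda>n. d n t \<omega>) \<longlonglongrightarrow> 0"
        unfolding d_def by (subst ennreal_0[symmetric], intro tendsto_ennrealI) simp
    qed
    moreover have "(\<lambda>t. d n t \<omega>) \<in> borel_measurable ?R" for n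
      using measurable_compose[OF measurable_Pair2'[OF \<omega>] dm[of n]] by simp
    moreover have "AE t in ?R. d n t \<omega> \<le> ennreal ((2 * B)\<^sup>2)" for n
      using pos
    proof eventually_elim
      case (elim t)
      then show ?case by (intro d_le \<omega>) blast+
    qed
    moreover have "(\<integral>\<^sup>+t. ennreal ((2 * B)\<^sup>2) \<partial>?R) < \<infinity>"
      using fin unfolding nn_integral_const .
    ultimately have "(\<lambda>n. \<integral>\<^sup>+t. d n t \<omega> \<partial>?R) \<longlonglongrightarrow> (\<integral>\<^sup>+t. 0 \<partial>?R)"
      by (intro nn_integral_dominated_convergence[where w="\<lambda>_. ennreal ((2 * B)\<^sup>2)"]) auto
    then show ?thesis by simp
  qed
  have "(\<lambda>n. \<integral>\<^sup>+\<omega>. (\<integral>\<^sup>+t. d n t \<omega> \<partial>?R) \<partial>M) \<longlonglongrightarrow> (\<integral>\<^sup>+\<omega>. 0 \<partial>M)"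
  proof (rule nn_integral_dominated_convergence[where w="\<lambda>_. ennreal ((2 * B)\<^sup>2) * emeasure ?R (space ?R)"])
    show "(\<lambda>\<omega>. \<integral>\<^sup>+t. d n t \<omega> \<partial>?R) \<in> borel_measurable M" for n
      using R.borel_measurable_nn_integral[of "\<lambda>\<omega> t. d n t \<omega>" M] measurable_pair_swap[OF dm[of n]]
      by (simp add: case_prod_beta')
    show "AE \<omega> in M. (\<integral>\<^sup>+t. d n t \<omega> \<partial>?R) \<le> ennreal ((2 * B)\<^sup>2) * emeasure ?R (space ?R)" for n
    proof (rule AE_I2)
      fix \<omega> assume \<omega>: "\<omega> \<in> space M"
      have "(\<integral>\<^sup>+t. d n t \<omega> \<partial>?R) \<le> (\<integral>\<^sup>+t. ennreal ((2 * B)\<^sup>2) \<partial>?R)"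
      proof (rule nn_integral_mono_AE)
        show "AE t in ?R. d n t \<omega> \<le> ennreal ((2 * B)\<^sup>2)"
          using pos
        proof eventually_elim
          case (elim t)
          then show ?case by (intro d_le \<omega>) blast+
        qed
      qed
      then show "(\<integral>\<^sup>+t. d n t \<omega> \<partial>?R) \<le> ennreal ((2 * B)\<^sup>2) * emeasure ?R (space ?R)" by simp
    qed
    show "(\<integral>\<^sup>+\<omega>. ennreal ((2 * B)\<^sup>2) * emeasure ?R (space ?R) \<partial>M) < \<infinity>"
      using fin unfolding nn_integral_const emeasure_space_1 by simp
    show "AE \<omega> in M. (\<lambda>n. \<integral>\<^sup>+t. d n t \<omega> \<partial>?R) \<longlonglongrightarrow> 0" by (intro AE_I2 inner)
  qed auto
  then show ?thesis by (simp add: eq)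
qed

definition L2_progressive :: "(real \<Rightarrow> 'a \<Rightarrow> real) \<Rightarrow> bool" where
  "L2_progressive \<xi> \<longleftrightarrow> progressively_measurable F T \<xi> \<and>
    integrable time_space (\<lambda>z. (\<xi> (fst z) (snd z))\<^sup>2)"

lemma truncation_tendsto:
  assumes \<xi>: "L2_progressive \<xi>"
  defines "\<theta> \<equiv> \<lambda>N t \<omega>. max (- real N) (min (real N) (\<xi> t \<omega>))"
  shows "(\<lambda>N. sqdist time_space (\<lambda>z. \<xi> (fst z) (snd z)) (\<lambda>z. \<theta> N (fst z) (snd z))) \<longlonglongrightarrow> 0"
proof -
  have [measurable]: "(\<lambda>z. \<xi> (fst z) (snd z)) \<in> borel_measurable time_space"
    using \<xi> by (intro progressive_time_space) (simp add: L2_progressive_def)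
  have "(\<lambda>N. \<integral>\<^sup>+z. ennreal ((\<xi> (fst z) (snd z) - \<theta> N (fst z) (snd z))\<^sup>2) \<partial>time_space)
      \<longlonglongrightarrow> (\<integral>\<^sup>+z. 0 \<partial>time_space)"
  proof (rule nn_integral_dominated_convergence[where w="\<lambda>z. ennreal ((\<xi> (fst z) (snd z))\<^sup>2)"])
    show "AE z in time_space. ennreal ((\<xi> (fst z) (snd z) - \<theta> N (fst z) (snd z))\<^sup>2) \<le> ennreal ((\<xi> (fst z) (snd z))\<^sup>2)" for N
    proof (intro AE_I2 ennreal_leI)
      fix z
      have "\<bar>\<xi> (fst z) (snd z) - \<theta> N (fst z) (snd z)\<bar> \<le> \<bar>\<xi> (fst z) (snd z)\<bar>"
        unfolding \<theta>_def by linarith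
      then show "(\<xi> (fst z) (snd z) - \<theta> N (fst z) (snd z))\<^sup>2 \<le> (\<xi> (fst z) (snd z))\<^sup>2"
        by (simp only: abs_le_square_iff)
    qed
    show "(\<integral>\<^sup>+z. ennreal ((\<xi> (fst z) (snd z))\<^sup>2) \<partial>time_space) < \<infinity>"
      using \<xi> unfolding L2_progressive_def integrable_iff_bounded by simp
    show "AE z in time_space. (\<lambda>N. ennreal ((\<xi> (fst z) (snd z) - \<theta> N (fst z) (snd z))\<^sup>2)) \<longlonglongrightarrow> 0"
    proof (rule AE_I2)
      fix z
      obtain N0 where N0: "\<bar>\<xi> (fst z) (snd z)\<bar> \<le> real N0" using real_arch_simple by blast
      have "\<xi> (fst z) (snd z) - \<theta> N (fst z) (snd z) = 0" if "N \<ge> N0" for N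
      proof -
        have "real N0 \<le> real N" using that by simp
        then show ?thesis using N0 unfolding \<theta>_def by linarith
      qed
      then have "\<forall>\<^sub>F N in sequentially. ennreal ((\<xi> (fst z) (snd z) - \<theta> N (fst z) (snd z))\<^sup>2) = 0"
        unfolding eventually_sequentially by (intro exI[of _ N0]) simp
      then show "(\<lambda>N. ennreal ((\<xi> (fst z) (snd z) - \<theta> N (fst z) (snd z))\<^sup>2)) \<longlonglongrightarrow> 0"
        by (rule tendsto_eventually)
    qed
  qed (auto simp: \<theta>_def)
  then show ?thesis by (simp add: sqdist_def)
qed

lemma step_approximation:
  assumes \<xi>: "L2_progressive \<xi>"
  obtains \<phi> where "\<And>j. step_data F T (\<phi> j)"
    "(\<lambda>j. sqdist time_space (\<lambda>z. \<xi> (fst z) (snd z)) (\<lambda>z. step_process (\<phi> j) (fst z) (snd z))) \<longlonglongrightarrow> 0"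
proof -
  define \<theta> where "\<theta> N t \<omega> = max (- real N) (min (real N) (\<xi> t \<omega>))" for N t \<omega>
  have prog: "progressively_measurable F T \<xi>" using \<xi> by (simp add: L2_progressive_def)
  have \<theta>_prog: "progressively_measurable F T (\<theta> N)" for N
    unfolding progressively_measurable_def
  proof
    fix t assume "t \<in> {0..T}"
    then have [measurable]: "(\<lambda>z. \<xi> (fst z) (snd z)) \<in> borel_measurable (restrict_space borel {0..t} \<Otimes>\<^sub>M F t)"
      using prog by (simp add: progressively_measurable_def case_prod_beta')
    show "(\<lambda>(s, \<omega>). \<theta> N s \<omega>) \<in> borel_measurable (restrict_space borel {0..t} \<Otimes>\<^sub>M F t)"
      unfolding \<theta>_def case_prod_beta' by measurable
  qed
  have \<theta>_bound: "\<bar>\<theta> N t \<omega>\<bar> \<le> real N" for N t \<omega> unfolding \<theta>_def by linarith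
  have trunc: "(\<lambda>N. sqdist time_space (\<lambda>z. \<xi> (fst z) (snd z)) (\<lambda>z. \<theta> N (fst z) (snd z))) \<longlonglongrightarrow> 0"
    unfolding \<theta>_def by (rule truncation_tendsto[OF \<xi>])
  have "\<exists>\<phi>. step_data F T \<phi> \<and>
      sqdist time_space (\<lambda>z. \<xi> (fst z) (snd z)) (\<lambda>z. step_process \<phi> (fst z) (snd z)) \<le> ennreal (1 / Suc j)" for j
  proof -
    define e where "e = 1 / real (Suc j) / 4"
    have "0 < e" by (simp add: e_def)
    from ennreal_tendsto_0D[OF trunc this]
    obtain N where N: "sqdist time_space (\<lambda>z. \<xi> (fst z) (snd z)) (\<lambda>z. \<theta> N (fst z) (snd z)) \<le> ennreal e"
      unfolding eventually_sequentially by blast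
    from ennreal_tendsto_0D[OF average_step_tendsto[OF \<theta>_prog \<theta>_bound of_nat_0_le_iff] \<open>0 < e\<close>]
    obtain n where n: "sqdist time_space (\<lambda>z. \<theta> N (fst z) (snd z)) (\<lambda>z. step_process (average_step (\<theta> N) n) (fst z) (snd z)) \<le> ennreal e"
      unfolding eventually_sequentially by blast
    have sd: "step_data F T (average_step (\<theta> N) n)"
      by (rule average_step_data[OF \<theta>_prog \<theta>_bound]) simp
    have "sqdist time_space (\<lambda>z. \<xi> (fst z) (snd z)) (\<lambda>z. step_process (average_step (\<theta> N) n) (fst z) (snd z))
        \<le> 2 * sqdist time_space (\<lambda>z. \<xi> (fst z) (snd z)) (\<lambda>z. \<theta> N (fst z) (snd z)) +
          2 * sqdist time_space (\<lambda>z. \<theta> N (fst z) (snd z)) (\<lambda>z. step_process (average_step (\<theta> N) n) (fst z) (snd z))"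
      by (intro sqdist_triangle progressive_time_space prog \<theta>_prog step_process_measurable sd)
    also have "\<dots> \<le> 2 * ennreal e + 2 * ennreal e" by (intro add_mono mult_left_mono N n) auto
    also have "\<dots> = ennreal (4 * e)" using \<open>0 < e\<close> by (intro ennreal_twice_plus_twice) simp
    also have "4 * e = 1 / Suc j" by (simp add: e_def divide_simps)
    finally show ?thesis using sd by blast
  qed
  then have "\<forall>j. \<exists>\<phi>. step_data F T \<phi> \<and>
      sqdist time_space (\<lambda>z. \<xi> (fst z) (snd z)) (\<lambda>z. step_process \<phi> (fst z) (snd z)) \<le> ennreal (1 / Suc j)"
    by (rule allI)
  from choice[OF this] obtain \<phi> where \<phi>: "\<And>j. step_data F T (\<phi> j)"
    "\<And>j. sqdist time_space (\<lambda>z. \<xi> (fst z) (snd z)) (\<lambda>z. step_process (\<phi> j) (fst z) (snd z)) \<le> ennreal (1 / Suc j)"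
    by blast
  have "(\<lambda>j. ennreal (1 / Suc j)) \<longlonglongrightarrow> ennreal 0"
    by (intro tendsto_ennrealI) (rule LIMSEQ_Suc[OF lim_1_over_n])
  from ennreal_tendsto_0_le[OF \<phi>(2) this[unfolded ennreal_0]]
  have "(\<lambda>j. sqdist time_space (\<lambda>z. \<xi> (fst z) (snd z)) (\<lambda>z. step_process (\<phi> j) (fst z) (snd z))) \<longlonglongrightarrow> 0" .
  with \<phi>(1) show thesis by (rule that)
qed

section \<open>The Ito integral of square-integrable progressive processes\<close>

definition step_list :: "'i \<Rightarrow> 'a step_data \<Rightarrow> ('i \<times> real \<times> real \<times> ('a \<Rightarrow> real)) list" where
  "step_list a = (\<lambda>(m, \<tau>, \<eta>). map (\<lambda>k. (a, \<tau> k, \<tau> (Suc k), \<eta> k)) [0..<m])"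

lemma step_list_elementary:
  assumes "step_data F T \<phi>"
  shows "\<forall>e\<in>set (step_list a \<phi>). elementary e"
proof -
  obtain m \<tau> \<eta> where \<phi>: "\<phi> = (m, \<tau>, \<eta>)" by (cases \<phi>)
  have \<tau>: "\<tau> 0 = 0" "\<tau> m = T" "\<And>k. k < m \<Longrightarrow> \<tau> k < \<tau> (Suc k)"
    and \<eta>: "\<And>k. k < m \<Longrightarrow> \<eta> k \<in> borel_measurable (F (\<tau> k))"
    and "\<exists>B. \<forall>k<m. \<forall>\<omega>\<in>space M. \<bar>\<eta> k \<omega>\<bar> \<le> B"
    using assms unfolding step_data_def \<phi> prod.case space_F by blast+
  then obtain B where B: "\<And>k \<omega>. k < m \<Longrightarrow> \<omega> \<in> space M \<Longrightarrow> \<bar>\<eta> k \<omega>\<bar> \<le> B" by blast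
  have mono: "\<tau> j \<le> \<tau> k" if "j \<le> k" "k \<le> m" for j k
    using that
  proof (induction k rule: dec_induct)
    case (step k) then show ?case using \<tau>(3)[of k] by force
  qed simp
  have "elementary (a, \<tau> k, \<tau> (Suc k), \<eta> k)" if "k < m" for k
  proof -
    have "0 \<le> \<tau> k" using mono[of 0 k] \<tau>(1) that by simp
    moreover have "\<tau> (Suc k) \<le> T" using mono[of "Suc k" m] \<tau>(2) that by simp
    moreover have "bounded_rv (\<eta> k)"
      unfolding bounded_rv_def by (intro exI[of _ B] ballI B that)
    ultimately show ?thesis
      unfolding elementary_def prod.case using \<tau>(3)[OF that] \<eta>[OF that] by blast
  qed
  then show ?thesis by (auto simp: step_list_def \<phi>)
qed

lemma step_list_integral: "list_integral (step_list a \<phi>) = step_integral (W a) \<phi>"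
  by (cases \<phi>) (simp add: fun_eq_iff step_list_def list_integral_def step_integral_def elem_integral_def
      comp_def interv_sum_list_conv_sum_set_nat atLeast0LessThan)

lemma step_list_process:
  "list_process (step_list a \<phi>) b r \<omega> = (if a = b then step_process \<phi> r \<omega> else 0)"
  by (cases \<phi>) (simp add: step_list_def list_process_def step_process_def elem_process_def
      comp_def interv_sum_list_conv_sum_set_nat atLeast0LessThan)

end

context brownian_family begin

text \<open>Approximating step processes are Cauchy on \<open>[0,T] \<times> \<Omega>\<close>, hence by the isometry so are their
  integrals.\<close>

lemma ito_integral_exists:
  assumes \<xi>: "L2_progressive \<xi>"
  shows "\<exists>I. has_ito_integral M F T (W a) \<xi> I"
proof -
  obtain \<phi> where \<phi>: "\<And>j. step_data F T (\<phi> j)"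
    "(\<lambda>j. sqdist time_space (\<lambda>z. \<xi> (fst z) (snd z)) (\<lambda>z. step_process (\<phi> j) (fst z) (snd z))) \<longlonglongrightarrow> 0"
    using step_approximation[OF \<xi>] by blast
  have \<xi>m: "(\<lambda>z. \<xi> (fst z) (snd z)) \<in> borel_measurable time_space"
    using \<xi> by (intro progressive_time_space) (simp add: L2_progressive_def)
  note el = step_list_elementary[OF \<phi>(1), where a=a]
  have SIm: "step_integral (W a) (\<phi> j) \<in> borel_measurable M" for j
    using list_integral_measurable(2)[OF el[of j]] by (simp add: step_list_integral)
  have iso: "sqdist M (step_integral (W a) (\<phi> m)) (step_integral (W a) (\<phi> n)) =
      sqdist time_space (\<lambda>z. step_process (\<phi> m) (fst z) (snd z)) (\<lambda>z. step_process (\<phi> n) (fst z) (snd z))" for m n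
  proof -
    have "sqdist M (step_integral (W a) (\<phi> m)) (step_integral (W a) (\<phi> n)) =
      (\<Sum>c\<in>UNIV. if c = a then sqdist time_space (\<lambda>z. step_process (\<phi> m) (fst z) (snd z)) (\<lambda>z. step_process (\<phi> n) (fst z) (snd z)) else 0)"
      unfolding list_isometry_sqdist[OF el[of m] el[of n], unfolded step_list_integral step_list_process]
    proof (intro sum.cong refl)
      fix c
      show "sqdist time_space (\<lambda>z. if a = c then step_process (\<phi> m) (fst z) (snd z) else 0)
          (\<lambda>z. if a = c then step_process (\<phi> n) (fst z) (snd z) else 0) =
        (if c = a then sqdist time_space (\<lambda>z. step_process (\<phi> m) (fst z) (snd z)) (\<lambda>z. step_process (\<phi> n) (fst z) (snd z)) else 0)"
        by (cases "a = c") simp_all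
    qed
    then show ?thesis by simp
  qed
  have "\<exists>N. \<forall>m\<ge>N. \<forall>n\<ge>N. sqdist M (step_integral (W a) (\<phi> m)) (step_integral (W a) (\<phi> n)) \<le> ennreal e"
    if "0 < e" for e :: real
    unfolding iso
    by (rule sqdist_limit_Cauchy[OF step_process_measurable[OF \<phi>(1)] \<xi>m _ that])
      (use \<phi>(2) in \<open>simp add: sqdist_commute\<close>)
  then obtain r where r: "strict_mono r" "AE x in M. convergent (\<lambda>k. step_integral (W a) (\<phi> (r k)) x)"
    "(\<lambda>n. sqdist M (step_integral (W a) (\<phi> n)) (\<lambda>x. lim (\<lambda>k. step_integral (W a) (\<phi> (r k)) x))) \<longlonglongrightarrow> 0"
    using sqdist_complete[of "\<lambda>j. step_integral (W a) (\<phi> j)", OF SIm] by blast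
  define I where "I = (\<lambda>x. lim (\<lambda>k. step_integral (W a) (\<phi> (r k)) x))"
  have Im: "I \<in> borel_measurable M" unfolding I_def by (intro borel_measurable_lim_metric SIm)
  have "has_ito_integral M F T (W a) \<xi> I"
    unfolding has_ito_integral_def
  proof (intro conjI exI[of _ \<phi>] allI Im \<phi>(1))
    show "(\<lambda>j. \<integral>\<^sup>+\<omega>. (\<integral>\<^sup>+t\<in>{0..T}. ennreal ((\<xi> t \<omega> - step_process (\<phi> j) t \<omega>)\<^sup>2) \<partial>lborel) \<partial>M) \<longlonglongrightarrow> 0"
      using \<phi>(2) by (simp only: iterated_eq_sqdist[OF \<xi>m step_process_measurable[OF \<phi>(1)]])
    show "(\<lambda>j. \<integral>\<^sup>+\<omega>. ennreal ((I \<omega> - step_integral (W a) (\<phi> j) \<omega>)\<^sup>2) \<partial>M) \<longlonglongrightarrow> 0"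
      using r(3) unfolding I_def[symmetric] sqdist_def by (subst power2_commute)
  qed
  then show ?thesis by blast
qed

lemma ito_integral_approx:
  assumes \<xi>: "L2_progressive \<xi>"
  obtains \<phi> where "ito_integral M F T (W a) \<xi> \<in> borel_measurable M" "\<And>j. step_data F T (\<phi> j)"
    "(\<lambda>j. sqdist time_space (\<lambda>z. step_process (\<phi> j) (fst z) (snd z)) (\<lambda>z. \<xi> (fst z) (snd z))) \<longlonglongrightarrow> 0"
    "(\<lambda>j. sqdist M (step_integral (W a) (\<phi> j)) (ito_integral M F T (W a) \<xi>)) \<longlonglongrightarrow> 0"
proof -
  have \<xi>m: "(\<lambda>z. \<xi> (fst z) (snd z)) \<in> borel_measurable time_space"
    using \<xi> by (intro progressive_time_space) (simp add: L2_progressive_def)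
  have "has_ito_integral M F T (W a) \<xi> (ito_integral M F T (W a) \<xi>)"
    unfolding ito_integral_def by (rule someI_ex[OF ito_integral_exists[OF \<xi>]])
  then obtain \<phi> where m: "ito_integral M F T (W a) \<xi> \<in> borel_measurable M" and \<phi>: "\<And>j. step_data F T (\<phi> j)"
    and 1: "(\<lambda>j. \<integral>\<^sup>+\<omega>. (\<integral>\<^sup>+t\<in>{0..T}. ennreal ((\<xi> t \<omega> - step_process (\<phi> j) t \<omega>)\<^sup>2) \<partial>lborel) \<partial>M) \<longlonglongrightarrow> 0"
    and 2: "(\<lambda>j. \<integral>\<^sup>+\<omega>. ennreal ((ito_integral M F T (W a) \<xi> \<omega> - step_integral (W a) (\<phi> j) \<omega>)\<^sup>2) \<partial>M) \<longlonglongrightarrow> 0"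
    unfolding has_ito_integral_def by blast
  show thesis
  proof (rule that[OF m \<phi>])
    show "(\<lambda>j. sqdist time_space (\<lambda>z. step_process (\<phi> j) (fst z) (snd z)) (\<lambda>z. \<xi> (fst z) (snd z))) \<longlonglongrightarrow> 0"
      using 1 unfolding iterated_eq_sqdist[OF \<xi>m step_process_measurable[OF \<phi>]]
      by (subst sqdist_commute)
    show "(\<lambda>j. sqdist M (step_integral (W a) (\<phi> j)) (ito_integral M F T (W a) \<xi>)) \<longlonglongrightarrow> 0"
      using 2 unfolding sqdist_def by (subst power2_commute)
  qed
qed

text \<open>The chosen version of the integral is only measurable in the full space, but a subsequence of the
  step integrals converges almost everywhere and its pointwise limit is a version that depends on
  the paths alone.\<close>

lemma ito_integral_terminal_measurable:
  assumes \<xi>: "L2_progressive \<xi>"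
  obtains I where "I \<in> borel_measurable (F T)" "AE \<omega> in M. ito_integral M F T (W a) \<xi> \<omega> = I \<omega>"
proof -
  obtain \<phi> where m: "ito_integral M F T (W a) \<xi> \<in> borel_measurable M" and \<phi>: "\<And>j. step_data F T (\<phi> j)"
    and lim: "(\<lambda>j. sqdist M (step_integral (W a) (\<phi> j)) (ito_integral M F T (W a) \<xi>)) \<longlonglongrightarrow> 0"
    using ito_integral_approx[OF \<xi>, where a=a] by blast
  note lm = list_integral_measurable[OF step_list_elementary[OF \<phi>, where a=a], unfolded step_list_integral]
  obtain r where r: "strict_mono r" "AE x in M. convergent (\<lambda>k. step_integral (W a) (\<phi> (r k)) x)"
    "(\<lambda>n. sqdist M (step_integral (W a) (\<phi> n)) (\<lambda>x. lim (\<lambda>k. step_integral (W a) (\<phi> (r k)) x))) \<longlonglongrightarrow> 0"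
    using sqdist_complete[of "\<lambda>j. step_integral (W a) (\<phi> j)", OF lm(2) sqdist_limit_Cauchy[OF lm(2) m lim]] by blast
  define I where "I = (\<lambda>x. lim (\<lambda>k. step_integral (W a) (\<phi> (r k)) x))"
  have "I \<in> borel_measurable M" unfolding I_def by (intro borel_measurable_lim_metric lm(2))
  from sqdist_unique[OF lm(2) m this lim r(3)[folded I_def]]
  have "AE \<omega> in M. ito_integral M F T (W a) \<xi> \<omega> = I \<omega>" .
  moreover have "I \<in> borel_measurable (F T)" unfolding I_def by (intro borel_measurable_lim_metric lm(1))
  ultimately show thesis by (intro that)
qed

definition ito_sum :: "('i \<Rightarrow> real \<Rightarrow> 'a \<Rightarrow> real) \<Rightarrow> 'a \<Rightarrow> real" where
  "ito_sum \<gamma> \<omega> = (\<Sum>a\<in>UNIV. ito_integral M F T (W a) (\<gamma> a) \<omega>)"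

text \<open>Passing to the limit along such a sequence transfers the isometry from lists to progressive
  integrands, for all coordinates at once.\<close>

definition approximates :: "(nat \<Rightarrow> ('i \<times> real \<times> real \<times> ('a \<Rightarrow> real)) list) \<Rightarrow> ('i \<Rightarrow> real \<Rightarrow> 'a \<Rightarrow> real) \<Rightarrow> bool" where
  "approximates L \<gamma> \<longleftrightarrow> (\<forall>j. \<forall>e\<in>set (L j). elementary e) \<and>
    (\<forall>b. (\<lambda>j. sqdist time_space (\<lambda>z. list_process (L j) b (fst z) (snd z)) (\<lambda>z. \<gamma> b (fst z) (snd z))) \<longlonglongrightarrow> 0) \<and>
    (\<lambda>j. sqdist M (list_integral (L j)) (ito_sum \<gamma>)) \<longlonglongrightarrow> 0"

lemma ito_sum_measurable:
  assumes \<gamma>: "\<And>a. L2_progressive (\<gamma> a)"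
  shows "ito_sum \<gamma> \<in> borel_measurable M"
  unfolding ito_sum_def[abs_def]
proof (intro borel_measurable_sum)
  fix a
  show "ito_integral M F T (W a) (\<gamma> a) \<in> borel_measurable M"
    using ito_integral_approx[OF \<gamma>[of a], where a=a] by blast
qed

lemma ito_sum_approx:
  assumes \<gamma>: "\<And>a. L2_progressive (\<gamma> a)"
  shows "\<exists>L. approximates L \<gamma>"
proof -
  have "\<forall>a. \<exists>\<phi>. ito_integral M F T (W a) (\<gamma> a) \<in> borel_measurable M \<and> (\<forall>j. step_data F T (\<phi> j)) \<and>
    (\<lambda>j. sqdist time_space (\<lambda>z. step_process (\<phi> j) (fst z) (snd z)) (\<lambda>z. \<gamma> a (fst z) (snd z))) \<longlonglongrightarrow> 0 \<and>
    (\<lambda>j. sqdist M (step_integral (W a) (\<phi> j)) (ito_integral M F T (W a) (\<gamma> a))) \<longlonglongrightarrow> 0"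
  proof
    fix a
    obtain \<phi> where "ito_integral M F T (W a) (\<gamma> a) \<in> borel_measurable M" "\<And>j. step_data F T (\<phi> j)"
      "(\<lambda>j. sqdist time_space (\<lambda>z. step_process (\<phi> j) (fst z) (snd z)) (\<lambda>z. \<gamma> a (fst z) (snd z))) \<longlonglongrightarrow> 0"
      "(\<lambda>j. sqdist M (step_integral (W a) (\<phi> j)) (ito_integral M F T (W a) (\<gamma> a))) \<longlonglongrightarrow> 0"
      using ito_integral_approx[OF \<gamma>[of a], where a=a] by blast
    then show "\<exists>\<phi>. ito_integral M F T (W a) (\<gamma> a) \<in> borel_measurable M \<and> (\<forall>j. step_data F T (\<phi> j)) \<and>
      (\<lambda>j. sqdist time_space (\<lambda>z. step_process (\<phi> j) (fst z) (snd z)) (\<lambda>z. \<gamma> a (fst z) (snd z))) \<longlonglongrightarrow> 0 \<and>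
      (\<lambda>j. sqdist M (step_integral (W a) (\<phi> j)) (ito_integral M F T (W a) (\<gamma> a))) \<longlonglongrightarrow> 0"
      by (intro exI[of _ \<phi>] conjI allI)
  qed
  from choice[OF this] obtain \<phi> where m: "\<And>a. ito_integral M F T (W a) (\<gamma> a) \<in> borel_measurable M"
    and \<phi>: "\<And>a j. step_data F T (\<phi> a j)"
    and P: "\<And>a. (\<lambda>j. sqdist time_space (\<lambda>z. step_process (\<phi> a j) (fst z) (snd z)) (\<lambda>z. \<gamma> a (fst z) (snd z))) \<longlonglongrightarrow> 0"
    and I: "\<And>a. (\<lambda>j. sqdist M (step_integral (W a) (\<phi> a j)) (ito_integral M F T (W a) (\<gamma> a))) \<longlonglongrightarrow> 0"
    by blast
  obtain as :: "'i list" where as: "set as = UNIV" "distinct as"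
    using finite_distinct_list[OF finite_class.finite_UNIV] by blast
  define L where "L j = concat (map (\<lambda>a. step_list a (\<phi> a j)) as)" for j
  have LI: "list_integral (L j) \<omega> = (\<Sum>a\<in>UNIV. step_integral (W a) (\<phi> a j) \<omega>)" for j \<omega>
  proof -
    have "list_integral (concat (map (\<lambda>a. step_list a (\<phi> a j)) bs)) \<omega> = (\<Sum>a\<leftarrow>bs. step_integral (W a) (\<phi> a j) \<omega>)" for bs
      by (induction bs) (simp_all add: list_integral_append step_list_integral)
    then show ?thesis unfolding L_def using as by (simp add: sum_list_distinct_conv_sum_set)
  qed
  have LP: "list_process (L j) b r \<omega> = step_process (\<phi> b j) r \<omega>" for j b r \<omega>
  proof -
    have "list_process (concat (map (\<lambda>a. step_list a (\<phi> a j)) bs)) b r \<omega> =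
        (\<Sum>a\<leftarrow>bs. if a = b then step_process (\<phi> a j) r \<omega> else 0)" for bs
      by (induction bs) (simp_all add: list_process_append step_list_process)
    then show ?thesis unfolding L_def using as by (simp add: sum_list_distinct_conv_sum_set)
  qed
  show ?thesis
    unfolding approximates_def
  proof (intro exI[of _ L] conjI allI)
    show "\<forall>e\<in>set (L j). elementary e" for j
      using step_list_elementary[OF \<phi>] by (auto simp: L_def)
    show "(\<lambda>j. sqdist time_space (\<lambda>z. list_process (L j) b (fst z) (snd z)) (\<lambda>z. \<gamma> b (fst z) (snd z))) \<longlonglongrightarrow> 0" for b
      unfolding LP by (rule P)
    have "step_integral (W a) (\<phi> a j) \<in> borel_measurable M" for a j
      using list_integral_measurable(2)[OF step_list_elementary[OF \<phi>, of a]] by (simp add: step_list_integral)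
    from sqdist_sum_tendsto[OF finite_class.finite_UNIV this m I]
    show "(\<lambda>j. sqdist M (list_integral (L j)) (ito_sum \<gamma>)) \<longlonglongrightarrow> 0"
      unfolding LI[abs_def] ito_sum_def[abs_def] .
  qed
qed

lemma ito_sum_isometry:
  assumes \<gamma>: "\<And>a. L2_progressive (\<gamma> a)"
  shows "integrable M (\<lambda>\<omega>. (ito_sum \<gamma> \<omega>)\<^sup>2)"
    and "expectation (\<lambda>\<omega>. (ito_sum \<gamma> \<omega>)\<^sup>2) = (\<Sum>a\<in>UNIV. \<integral>z. (\<gamma> a (fst z) (snd z))\<^sup>2 \<partial>time_space)"
proof -
  obtain L where "approximates L \<gamma>" using ito_sum_approx[of \<gamma>, OF \<gamma>] by blast
  then have el: "\<And>j. \<forall>e\<in>set (L j). elementary e"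
    and P: "\<And>b. (\<lambda>j. sqdist time_space (\<lambda>z. list_process (L j) b (fst z) (snd z)) (\<lambda>z. \<gamma> b (fst z) (snd z))) \<longlonglongrightarrow> 0"
    and I: "(\<lambda>j. sqdist M (list_integral (L j)) (ito_sum \<gamma>)) \<longlonglongrightarrow> 0"
    unfolding approximates_def by blast+
  have m: "ito_sum \<gamma> \<in> borel_measurable M" by (rule ito_sum_measurable[of \<gamma>, OF \<gamma>])
  have \<gamma>m: "(\<lambda>z. \<gamma> b (fst z) (snd z)) \<in> borel_measurable time_space" for b
    using \<gamma>[of b] by (intro progressive_time_space) (simp add: L2_progressive_def)
  note II = integral_square_tendsto[OF list_integral_measurable(2)[OF el] m list_integral_square_integrable(1)[OF el] I]
  show "integrable M (\<lambda>\<omega>. (ito_sum \<gamma> \<omega>)\<^sup>2)" by (rule II(1))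
  have "(\<lambda>j. \<Sum>b\<in>UNIV. \<integral>z. (list_process (L j) b (fst z) (snd z))\<^sup>2 \<partial>time_space) \<longlonglongrightarrow>
      (\<Sum>b\<in>UNIV. \<integral>z. (\<gamma> b (fst z) (snd z))\<^sup>2 \<partial>time_space)"
    by (intro tendsto_sum integral_square_tendsto(2) list_process_measurable el \<gamma>m list_process_square_integrable P)
  moreover have "(\<lambda>j. \<Sum>b\<in>UNIV. \<integral>z. (list_process (L j) b (fst z) (snd z))\<^sup>2 \<partial>time_space) \<longlonglongrightarrow>
      expectation (\<lambda>\<omega>. (ito_sum \<gamma> \<omega>)\<^sup>2)"
    using II(2) by (simp add: list_isometry[OF el])
  ultimately show "expectation (\<lambda>\<omega>. (ito_sum \<gamma> \<omega>)\<^sup>2) = (\<Sum>a\<in>UNIV. \<integral>z. (\<gamma> a (fst z) (snd z))\<^sup>2 \<partial>time_space)"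
    using LIMSEQ_unique by blast
qed

lemma ito_sum_diff_isometry:
  assumes \<gamma>: "\<And>a. L2_progressive (\<gamma> a)" and \<gamma>': "\<And>a. L2_progressive (\<gamma>' a)"
  shows "expectation (\<lambda>\<omega>. (ito_sum \<gamma> \<omega> - ito_sum \<gamma>' \<omega>)\<^sup>2) =
    (\<Sum>a\<in>UNIV. \<integral>z. (\<gamma> a (fst z) (snd z) - \<gamma>' a (fst z) (snd z))\<^sup>2 \<partial>time_space)"
proof -
  obtain L where "approximates L \<gamma>" using ito_sum_approx[of \<gamma>, OF \<gamma>] by blast
  then have el: "\<And>j. \<forall>e\<in>set (L j). elementary e"
    and P: "\<And>b. (\<lambda>j. sqdist time_space (\<lambda>z. list_process (L j) b (fst z) (snd z)) (\<lambda>z. \<gamma> b (fst z) (snd z))) \<longlonglongrightarrow> 0"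
    and I: "(\<lambda>j. sqdist M (list_integral (L j)) (ito_sum \<gamma>)) \<longlonglongrightarrow> 0"
    unfolding approximates_def by blast+
  have m: "ito_sum \<gamma> \<in> borel_measurable M" by (rule ito_sum_measurable[of \<gamma>, OF \<gamma>])
  obtain L' where "approximates L' \<gamma>'" using ito_sum_approx[of \<gamma>', OF \<gamma>'] by blast
  then have el': "\<And>j. \<forall>e\<in>set (L' j). elementary e"
    and P': "\<And>b. (\<lambda>j. sqdist time_space (\<lambda>z. list_process (L' j) b (fst z) (snd z)) (\<lambda>z. \<gamma>' b (fst z) (snd z))) \<longlonglongrightarrow> 0"
    and I': "(\<lambda>j. sqdist M (list_integral (L' j)) (ito_sum \<gamma>')) \<longlonglongrightarrow> 0"
    unfolding approximates_def by blast+
  have m': "ito_sum \<gamma>' \<in> borel_measurable M" by (rule ito_sum_measurable[of \<gamma>', OF \<gamma>'])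
  have \<gamma>m: "(\<lambda>z. \<gamma> b (fst z) (snd z)) \<in> borel_measurable time_space"
    and \<gamma>m': "(\<lambda>z. \<gamma>' b (fst z) (snd z)) \<in> borel_measurable time_space" for b
    using \<gamma>[of b] \<gamma>'[of b] by (auto intro!: progressive_time_space simp: L2_progressive_def)
  define D where "D j = L j @ map (elem_scale (- 1)) (L' j)" for j
  have elD: "\<forall>e\<in>set (D j). elementary e" for j using el el' by (auto simp: D_def elementary_scale)
  have DI: "list_integral (D j) = (\<lambda>\<omega>. list_integral (L j) \<omega> - list_integral (L' j) \<omega>)" for j
    by (simp add: fun_eq_iff D_def list_integral_append list_integral_scale)
  have DP: "list_process (D j) b r \<omega> = list_process (L j) b r \<omega> - list_process (L' j) b r \<omega>" for j b r \<omega>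
    by (simp add: D_def list_process_append list_process_scale)
  have "(\<lambda>j. sqdist M (list_integral (D j)) (\<lambda>\<omega>. ito_sum \<gamma> \<omega> - ito_sum \<gamma>' \<omega>)) \<longlonglongrightarrow> 0"
    unfolding DI by (intro sqdist_diff_tendsto list_integral_measurable(2) el el' m m' I I')
  from integral_square_tendsto(2)[OF list_integral_measurable(2)[OF elD] _ list_integral_square_integrable(1)[OF elD] this] m m'
  have 1: "(\<lambda>j. \<Sum>b\<in>UNIV. \<integral>z. (list_process (D j) b (fst z) (snd z))\<^sup>2 \<partial>time_space) \<longlonglongrightarrow>
      expectation (\<lambda>\<omega>. (ito_sum \<gamma> \<omega> - ito_sum \<gamma>' \<omega>)\<^sup>2)"
    unfolding list_isometry[OF elD] by simp
  have "(\<lambda>j. sqdist time_space (\<lambda>z. list_process (D j) b (fst z) (snd z))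
      (\<lambda>z. \<gamma> b (fst z) (snd z) - \<gamma>' b (fst z) (snd z))) \<longlonglongrightarrow> 0" for b
    unfolding DP by (intro sqdist_diff_tendsto list_process_measurable el el' \<gamma>m \<gamma>m' P P')
  then have "(\<lambda>j. \<Sum>b\<in>UNIV. \<integral>z. (list_process (D j) b (fst z) (snd z))\<^sup>2 \<partial>time_space) \<longlonglongrightarrow>
      (\<Sum>b\<in>UNIV. \<integral>z. (\<gamma> b (fst z) (snd z) - \<gamma>' b (fst z) (snd z))\<^sup>2 \<partial>time_space)"
    by (intro tendsto_sum integral_square_tendsto(2) list_process_measurable elD \<gamma>m \<gamma>m'
        list_process_square_integrable borel_measurable_diff)
  with 1 show ?thesis using LIMSEQ_unique by blast
qed

end

section \<open>Algebras of bounded functions are mean-square dense\<close>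

lemma tendsto_if_dist_le_inverse:
  assumes "\<And>n. \<bar>x n - y\<bar> \<le> 1 / Suc n"
  shows "x \<longlonglongrightarrow> (y :: real)"
proof -
  have "(\<lambda>n. x n - y) \<longlonglongrightarrow> 0"
    by (rule Lim_null_comparison[OF _ LIMSEQ_Suc[OF lim_1_over_n]])
      (intro always_eventually allI, use assms in simp)
  then show ?thesis by (simp add: LIM_zero_iff)
qed

text \<open>A closed subspace of \<open>L\<^sup>2\<close> containing the constants, given as a set of functions.\<close>

locale L2_closed_subspace = prob_space M for M :: "'a measure" +
  fixes H :: "('a \<Rightarrow> real) set"
  assumes H_measurable: "X \<in> H \<Longrightarrow> X \<in> borel_measurable M"
    and H_const: "(\<lambda>_. c) \<in> H"
    and H_add: "X \<in> H \<Longrightarrow> Y \<in> H \<Longrightarrow> (\<lambda>\<omega>. X \<omega> + Y \<omega>) \<in> H"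
    and H_scale: "X \<in> H \<Longrightarrow> (\<lambda>\<omega>. c * X \<omega>) \<in> H"
    and H_limit: "(\<And>n. Z n \<in> H) \<Longrightarrow> X \<in> borel_measurable M \<Longrightarrow> (\<lambda>n. sqdist M (Z n) X) \<longlonglongrightarrow> 0 \<Longrightarrow> X \<in> H"
begin

lemma H_sum: "finite I \<Longrightarrow> (\<And>i. i \<in> I \<Longrightarrow> X i \<in> H) \<Longrightarrow> (\<lambda>\<omega>. \<Sum>i\<in>I. X i \<omega>) \<in> H"
proof (induction I rule: finite_induct)
  case empty
  show ?case using H_const[of 0] by simp
next
  case (insert i I)
  have "(\<lambda>\<omega>. X i \<omega> + (\<Sum>i\<in>I. X i \<omega>)) \<in> H"
    by (intro H_add insert.IH insert.prems) simp_all
  then show ?case using insert.hyps by simp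
qed

lemma H_dominated_limit:
  assumes Y: "\<And>n. Y n \<in> H" and X [measurable]: "X \<in> borel_measurable M"
    and w: "integrable M w" and bound: "\<And>n \<omega>. \<omega> \<in> space M \<Longrightarrow> (Y n \<omega> - X \<omega>)\<^sup>2 \<le> w \<omega>"
    and lim: "\<And>\<omega>. \<omega> \<in> space M \<Longrightarrow> (\<lambda>n. Y n \<omega>) \<longlonglongrightarrow> X \<omega>"
  shows "X \<in> H"
proof (rule H_limit[OF Y X])
  have [measurable]: "Y n \<in> borel_measurable M" for n by (rule H_measurable[OF Y])
  have [measurable]: "w \<in> borel_measurable M" using w by simp
  have "(\<lambda>n. \<integral>\<^sup>+\<omega>. ennreal ((Y n \<omega> - X \<omega>)\<^sup>2) \<partial>M) \<longlonglongrightarrow> (\<integral>\<^sup>+\<omega>. 0 \<partial>M)"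
  proof (rule nn_integral_dominated_convergence[where w="\<lambda>\<omega>. ennreal (w \<omega>)"])
    show "AE \<omega> in M. ennreal ((Y n \<omega> - X \<omega>)\<^sup>2) \<le> ennreal (w \<omega>)" for n
      by (intro AE_I2 ennreal_leI bound)
    have "0 \<le> w \<omega>" if "\<omega> \<in> space M" for \<omega> using bound[OF that, of 0] by (meson order_trans zero_le_power2)
    then have "(\<integral>\<^sup>+\<omega>. ennreal (w \<omega>) \<partial>M) = ennreal (\<integral>\<omega>. w \<omega> \<partial>M)"
      by (intro nn_integral_eq_integral w AE_I2)
    then show "(\<integral>\<^sup>+\<omega>. ennreal (w \<omega>) \<partial>M) < \<infinity>" by simp
    show "AE \<omega> in M. (\<lambda>n. ennreal ((Y n \<omega> - X \<omega>)\<^sup>2)) \<longlonglongrightarrow> 0"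
    proof (rule AE_I2)
      fix \<omega> assume "\<omega> \<in> space M"
      from lim[OF this] have "(\<lambda>n. (Y n \<omega> - X \<omega>)\<^sup>2) \<longlonglongrightarrow> (X \<omega> - X \<omega>)\<^sup>2" by (intro tendsto_intros)
      then show "(\<lambda>n. ennreal ((Y n \<omega> - X \<omega>)\<^sup>2)) \<longlonglongrightarrow> 0"
        using tendsto_ennrealI by fastforce
    qed
  qed simp_all
  then show "(\<lambda>n. sqdist M (Y n) X) \<longlonglongrightarrow> 0" by (simp add: sqdist_def)
qed

lemma H_bounded_limit:
  assumes Y: "\<And>n. Y n \<in> H" and X: "X \<in> borel_measurable M"
    and bound: "\<And>n \<omega>. \<omega> \<in> space M \<Longrightarrow> \<bar>Y n \<omega>\<bar> \<le> B"
    and lim: "\<And>\<omega>. \<omega> \<in> space M \<Longrightarrow> (\<lambda>n. Y n \<omega>) \<longlonglongrightarrow> X \<omega>"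
  shows "X \<in> H"
proof (rule H_dominated_limit[OF Y X _ _ lim, where w="\<lambda>_. (2 * B)\<^sup>2"])
  show "(Y n \<omega> - X \<omega>)\<^sup>2 \<le> (2 * B)\<^sup>2" if "\<omega> \<in> space M" for n \<omega>
  proof -
    have "(\<lambda>n. \<bar>Y n \<omega>\<bar>) \<longlonglongrightarrow> \<bar>X \<omega>\<bar>" by (intro tendsto_rabs lim that)
    then have "\<bar>X \<omega>\<bar> \<le> B" by (rule LIMSEQ_le_const2) (use bound[OF that] in blast)
    then have "\<bar>Y n \<omega> - X \<omega>\<bar> \<le> 2 * B" using bound[OF that, of n] by linarith
    then show ?thesis by (metis abs_ge_zero power2_abs power_mono)
  qed
qed simp

end

text \<open>An algebra of bounded functions inside \<open>H\<close>. Its uniform closure is stable under continuous functions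
  by the Weierstrass theorem, hence a lattice, so the sets on which one of its members is positive
  are stable under intersection. Their indicators are bounded limits of members of the closure, and
  Dynkin's argument carries \<open>H\<close> to all indicators of the generated sigma-algebra.\<close>

locale bounded_function_algebra = L2_closed_subspace M H for M :: "'a measure" and H +
  fixes A :: "('a \<Rightarrow> real) set"
  assumes A_H: "\<phi> \<in> A \<Longrightarrow> \<phi> \<in> H"
    and A_bounded: "\<phi> \<in> A \<Longrightarrow> \<exists>B. \<forall>\<omega>\<in>space M. \<bar>\<phi> \<omega>\<bar> \<le> B"
    and A_const: "(\<lambda>_. c) \<in> A"
    and A_add: "\<phi> \<in> A \<Longrightarrow> \<psi> \<in> A \<Longrightarrow> (\<lambda>\<omega>. \<phi> \<omega> + \<psi> \<omega>) \<in> A"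
    and A_mult: "\<phi> \<in> A \<Longrightarrow> \<psi> \<in> A \<Longrightarrow> (\<lambda>\<omega>. \<phi> \<omega> * \<psi> \<omega>) \<in> A"
begin

definition uniform_closure :: "('a \<Rightarrow> real) set" where
  "uniform_closure = {\<phi>. \<forall>e>0. \<exists>\<psi>\<in>A. \<forall>\<omega>\<in>space M. \<bar>\<psi> \<omega> - \<phi> \<omega>\<bar> \<le> e}"

lemma uniform_closureD:
  "\<phi> \<in> uniform_closure \<Longrightarrow> 0 < e \<Longrightarrow> \<exists>\<psi>\<in>A. \<forall>\<omega>\<in>space M. \<bar>\<psi> \<omega> - \<phi> \<omega>\<bar> \<le> e"
  unfolding uniform_closure_def by blast

lemma A_uniform_closure: "\<phi> \<in> A \<Longrightarrow> \<phi> \<in> uniform_closure"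
  unfolding uniform_closure_def by (intro CollectI allI impI bexI[of _ \<phi>]) simp_all

lemma uniform_closure_bounded:
  assumes "\<phi> \<in> uniform_closure"
  shows "\<exists>B. \<forall>\<omega>\<in>space M. \<bar>\<phi> \<omega>\<bar> \<le> B"
proof -
  obtain \<psi> where \<psi>: "\<psi> \<in> A" "\<forall>\<omega>\<in>space M. \<bar>\<psi> \<omega> - \<phi> \<omega>\<bar> \<le> 1"
    using uniform_closureD[OF assms, of 1] by auto
  obtain B where "\<forall>\<omega>\<in>space M. \<bar>\<psi> \<omega>\<bar> \<le> B" using A_bounded[OF \<psi>(1)] by blast
  then have "\<bar>\<phi> \<omega>\<bar> \<le> B + 1" if "\<omega> \<in> space M" for \<omega>
    using \<psi>(2)[rule_format, OF that] that by (smt (verit))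
  then show ?thesis by blast
qed

lemma uniform_closure_add:
  assumes "\<phi> \<in> uniform_closure" "\<psi> \<in> uniform_closure"
  shows "(\<lambda>\<omega>. \<phi> \<omega> + \<psi> \<omega>) \<in> uniform_closure"
  unfolding uniform_closure_def
proof (intro CollectI allI impI)
  fix e :: real assume "0 < e"
  then have "0 < e/2" by simp
  obtain p where p: "p \<in> A" "\<forall>\<omega>\<in>space M. \<bar>p \<omega> - \<phi> \<omega>\<bar> \<le> e/2"
    using uniform_closureD[OF assms(1) \<open>0 < e/2\<close>] by blast
  obtain q where q: "q \<in> A" "\<forall>\<omega>\<in>space M. \<bar>q \<omega> - \<psi> \<omega>\<bar> \<le> e/2"
    using uniform_closureD[OF assms(2) \<open>0 < e/2\<close>] by blast
  have "\<bar>(p \<omega> + q \<omega>) - (\<phi> \<omega> + \<psi> \<omega>)\<bar> \<le> e" if "\<omega> \<in> space M" for \<omega>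
    using p(2)[rule_format, OF that] q(2)[rule_format, OF that] by linarith
  then show "\<exists>\<psi>'\<in>A. \<forall>\<omega>\<in>space M. \<bar>\<psi>' \<omega> - (\<phi> \<omega> + \<psi> \<omega>)\<bar> \<le> e"
    by (intro bexI[OF _ A_add[OF p(1) q(1)]] ballI)
qed

lemma A_polynomial:
  assumes "real_polynomial_function p" "\<psi> \<in> A"
  shows "(\<lambda>\<omega>. p (\<psi> \<omega>)) \<in> A"
  using assms(1)
proof (induction rule: real_polynomial_function.induct)
  case (linear f)
  then have "f x = f 1 * x" for x :: real
    using linear_simps(5)[of f x 1] by (simp add: mult.commute)
  then have "(\<lambda>\<omega>. f (\<psi> \<omega>)) = (\<lambda>\<omega>. f 1 * \<psi> \<omega>)" by (rule ext)
  then show ?case using A_mult[OF A_const[of "f 1"] assms(2)] by simp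
next
  case (const c) show ?case by (rule A_const)
next
  case (add f g) then show ?case by (intro A_add)
next
  case (mult f g) then show ?case by (intro A_mult)
qed

text \<open>Weierstrass approximation on a compact interval around the range of \<open>\<phi>\<close>. Applied to truncations it
  makes the uniform closure a lattice.\<close>

lemma uniform_closure_continuous:
  fixes f :: "real \<Rightarrow> real"
  assumes \<phi>: "\<phi> \<in> uniform_closure" and f: "continuous_on UNIV f"
  shows "(\<lambda>\<omega>. f (\<phi> \<omega>)) \<in> uniform_closure"
  unfolding uniform_closure_def
proof (intro CollectI allI impI)
  fix e :: real assume "0 < e"
  then have "0 < e/2" by simp
  obtain B where B: "\<And>\<omega>. \<omega> \<in> space M \<Longrightarrow> \<bar>\<phi> \<omega>\<bar> \<le> B" using uniform_closure_bounded[OF \<phi>] by blast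
  \<comment> \<open>one unit of room, since the approximants \<open>\<psi>\<close> may leave the range of \<open>\<phi>\<close>\<close>
  let ?K = "{- (B + 1)..B + 1}"
  have fK: "continuous_on ?K f" using f continuous_on_subset by blast
  then have "uniformly_continuous_on ?K f" by (rule compact_uniformly_continuous) simp
  then obtain d where d: "d > 0" "\<And>x y. x \<in> ?K \<Longrightarrow> y \<in> ?K \<Longrightarrow> dist y x < d \<Longrightarrow> dist (f y) (f x) < e/2"
    unfolding uniformly_continuous_on_def using \<open>0 < e/2\<close> by meson
  obtain p where p: "real_polynomial_function p" "\<And>x. x \<in> ?K \<Longrightarrow> \<bar>f x - p x\<bar> < e/2"
    using Stone_Weierstrass_real_polynomial_function[OF _ fK \<open>0 < e/2\<close>] by (metis compact_Icc)
  have "0 < min 1 (d/2)" using d(1) by simp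
  from uniform_closureD[OF \<phi> this]
  obtain \<psi> where \<psi>: "\<psi> \<in> A" "\<forall>\<omega>\<in>space M. \<bar>\<psi> \<omega> - \<phi> \<omega>\<bar> \<le> min 1 (d/2)" by blast
  have "\<bar>p (\<psi> \<omega>) - f (\<phi> \<omega>)\<bar> \<le> e" if \<omega>: "\<omega> \<in> space M" for \<omega>
  proof -
    have near: "\<bar>\<psi> \<omega> - \<phi> \<omega>\<bar> \<le> min 1 (d/2)" using \<psi>(2) \<omega> by blast
    have K: "\<phi> \<omega> \<in> ?K" "\<psi> \<omega> \<in> ?K" using near B[OF \<omega>] unfolding atLeastAtMost_iff by linarith+
    have "dist (\<psi> \<omega>) (\<phi> \<omega>) < d" using near d(1) by (simp add: dist_real_def)
    from d(2)[OF K this] have "\<bar>f (\<psi> \<omega>) - f (\<phi> \<omega>)\<bar> < e/2" by (simp add: dist_real_def)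
    with p(2)[OF K(2)] show ?thesis by linarith
  qed
  then show "\<exists>\<psi>\<in>A. \<forall>\<omega>\<in>space M. \<bar>\<psi> \<omega> - f (\<phi> \<omega>)\<bar> \<le> e"
    by (intro bexI[OF _ A_polynomial[OF p(1) \<psi>(1)]] ballI)
qed

lemma uniform_closure_scale: "\<phi> \<in> uniform_closure \<Longrightarrow> (\<lambda>\<omega>. c * \<phi> \<omega>) \<in> uniform_closure"
  by (erule uniform_closure_continuous) (intro continuous_intros)

lemma uniform_closure_min:
  assumes "\<phi> \<in> uniform_closure" "\<psi> \<in> uniform_closure"
  shows "(\<lambda>\<omega>. min (\<phi> \<omega>) (\<psi> \<omega>)) \<in> uniform_closure"
proof -
  have "(\<lambda>\<omega>. \<phi> \<omega> + (- 1) * \<psi> \<omega>) \<in> uniform_closure"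
    by (intro uniform_closure_add uniform_closure_scale assms)
  from uniform_closure_continuous[OF this, of "\<lambda>x. min x 0"]
  have "(\<lambda>\<omega>. min (\<phi> \<omega> + (- 1) * \<psi> \<omega>) 0) \<in> uniform_closure" by (simp add: continuous_on_min)
  from uniform_closure_add[OF this assms(2)]
  have "(\<lambda>\<omega>. min (\<phi> \<omega> + (- 1) * \<psi> \<omega>) 0 + \<psi> \<omega>) \<in> uniform_closure" .
  moreover have "(\<lambda>\<omega>. min (\<phi> \<omega> + (- 1) * \<psi> \<omega>) 0 + \<psi> \<omega>) = (\<lambda>\<omega>. min (\<phi> \<omega>) (\<psi> \<omega>))"
    by (auto simp: fun_eq_iff min_def)
  ultimately show ?thesis by simp
qed

lemma uniform_closure_limit:
  assumes "\<phi> \<in> uniform_closure"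
  shows "\<exists>\<psi>. \<forall>n. \<psi> n \<in> A \<and> (\<forall>\<omega>\<in>space M. \<bar>\<psi> n \<omega> - \<phi> \<omega>\<bar> \<le> 1 / Suc n)"
proof (rule choice, rule allI)
  fix n
  have "0 < 1 / real (Suc n)" by simp
  from uniform_closureD[OF assms this]
  show "\<exists>\<psi>. \<psi> \<in> A \<and> (\<forall>\<omega>\<in>space M. \<bar>\<psi> \<omega> - \<phi> \<omega>\<bar> \<le> 1 / Suc n)" by blast
qed

lemma uniform_closure_H:
  assumes "\<phi> \<in> uniform_closure"
  shows "\<phi> \<in> H"
proof -
  obtain \<psi> where "\<forall>n. \<psi> n \<in> A \<and> (\<forall>\<omega>\<in>space M. \<bar>\<psi> n \<omega> - \<phi> \<omega>\<bar> \<le> 1 / Suc n)"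
    using uniform_closure_limit[OF assms] by (rule exE)
  then have \<psi>: "\<And>n. \<psi> n \<in> A" "\<And>n \<omega>. \<omega> \<in> space M \<Longrightarrow> \<bar>\<psi> n \<omega> - \<phi> \<omega>\<bar> \<le> 1 / Suc n"
    by blast+
  obtain B where B: "\<And>\<omega>. \<omega> \<in> space M \<Longrightarrow> \<bar>\<phi> \<omega>\<bar> \<le> B" using uniform_closure_bounded[OF assms] by blast
  have lim: "(\<lambda>n. \<psi> n \<omega>) \<longlonglongrightarrow> \<phi> \<omega>" if "\<omega> \<in> space M" for \<omega>
    by (rule tendsto_if_dist_le_inverse) (rule \<psi>(2)[OF that])
  have \<phi>m: "\<phi> \<in> borel_measurable M"
    by (rule borel_measurable_LIMSEQ_real[where u=\<psi>]) (rule lim, assumption, rule H_measurable[OF A_H[OF \<psi>(1)]])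
  show "\<phi> \<in> H"
  proof (rule H_bounded_limit[OF A_H[OF \<psi>(1)] \<phi>m _ lim])
    fix n \<omega> assume \<omega>: "\<omega> \<in> space M"
    have "1 / real (Suc n) \<le> 1" by simp
    then show "\<bar>\<psi> n \<omega>\<bar> \<le> B + 1" using \<psi>(2)[OF \<omega>, of n] B[OF \<omega>] by linarith
  qed
qed

definition positivity_sets :: "'a set set" where
  "positivity_sets = {{\<omega>\<in>space M. 0 < \<phi> \<omega>} |\<phi>. \<phi> \<in> uniform_closure}"

lemma positivity_setsI: "\<phi> \<in> uniform_closure \<Longrightarrow> {\<omega>\<in>space M. 0 < \<phi> \<omega>} \<in> positivity_sets"
  unfolding positivity_sets_def by blast

lemma positivity_sets_subset: "positivity_sets \<subseteq> Pow (space M)"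
  unfolding positivity_sets_def by blast

lemma Int_stable_positivity_sets: "Int_stable positivity_sets"
proof (rule Int_stableI)
  fix a b assume "a \<in> positivity_sets" "b \<in> positivity_sets"
  then obtain \<phi> \<psi> where \<phi>: "\<phi> \<in> uniform_closure" "a = {\<omega>\<in>space M. 0 < \<phi> \<omega>}"
    and \<psi>: "\<psi> \<in> uniform_closure" "b = {\<omega>\<in>space M. 0 < \<psi> \<omega>}"
    unfolding positivity_sets_def by blast
  have "a \<inter> b = {\<omega>\<in>space M. 0 < min (\<phi> \<omega>) (\<psi> \<omega>)}" unfolding \<phi>(2) \<psi>(2) by auto
  then show "a \<inter> b \<in> positivity_sets"
    using positivity_setsI[OF uniform_closure_min[OF \<phi>(1) \<psi>(1)]] by simp
qed

lemma indicator_positivity_set: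
  assumes "\<phi> \<in> uniform_closure"
  shows "indicator {\<omega>\<in>space M. 0 < \<phi> \<omega>} \<in> H"
proof (rule H_bounded_limit[where B=1 and Y="\<lambda>n \<omega>. min 1 (max 0 (real n * \<phi> \<omega>))"])
  show "(\<lambda>\<omega>. min 1 (max 0 (real n * \<phi> \<omega>))) \<in> H" for n
    by (intro uniform_closure_H uniform_closure_continuous[OF assms, of "\<lambda>x. min 1 (max 0 (real n * x))"]
        continuous_intros)
  have [measurable]: "\<phi> \<in> borel_measurable M" by (intro H_measurable uniform_closure_H assms)
  show "indicator {\<omega>\<in>space M. 0 < \<phi> \<omega>} \<in> borel_measurable M" by measurable
  show "\<bar>min 1 (max 0 (real n * \<phi> \<omega>))\<bar> \<le> 1" for n \<omega> by simp
  show "(\<lambda>n. min 1 (max 0 (real n * \<phi> \<omega>))) \<longlonglongrightarrow> indicator {\<omega>\<in>space M. 0 < \<phi> \<omega>} \<omega>"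
    if \<omega>: "\<omega> \<in> space M" for \<omega>
  proof (cases "0 < \<phi> \<omega>")
    case True
    obtain n0 where n0: "1 / \<phi> \<omega> < real n0" using reals_Archimedean2 by blast
    have "min 1 (max 0 (real n * \<phi> \<omega>)) = 1" if "n \<ge> n0" for n
    proof -
      have "1 / \<phi> \<omega> \<le> real n" using n0 that by linarith
      then have "1 \<le> real n * \<phi> \<omega>" using True by (simp add: pos_divide_le_eq)
      then show ?thesis by simp
    qed
    then have "\<forall>\<^sub>F n in sequentially. min 1 (max 0 (real n * \<phi> \<omega>)) = 1"
      unfolding eventually_sequentially by blast
    then have "(\<lambda>n. min 1 (max 0 (real n * \<phi> \<omega>))) \<longlonglongrightarrow> 1" by (rule tendsto_eventually)
    then show ?thesis using True \<omega> by simp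
  next
    case False
    then have "min 1 (max 0 (real n * \<phi> \<omega>)) = 0" for n by (simp add: mult_nonneg_nonpos)
    then show ?thesis using False by simp
  qed
qed

lemma indicator_generated:
  assumes "E \<in> sigma_sets (space M) positivity_sets"
  shows "indicator E \<in> H \<and> E \<in> events"
  using Int_stable_positivity_sets positivity_sets_subset assms
proof (induction rule: sigma_sets_induct_disjoint)
  case (basic E)
  then obtain \<phi> where \<phi>: "\<phi> \<in> uniform_closure" "E = {\<omega>\<in>space M. 0 < \<phi> \<omega>}"
    unfolding positivity_sets_def by blast
  have [measurable]: "\<phi> \<in> borel_measurable M" by (intro H_measurable uniform_closure_H \<phi>(1))
  show ?case unfolding \<phi>(2) using indicator_positivity_set[OF \<phi>(1)] by simp
next
  case empty
  show ?case using H_const[of 0] by (simp add: indicator_def[abs_def])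
next
  case (compl E)
  from compl(2) have E: "indicator E \<in> H" "E \<in> events" by simp_all
  have H: "(\<lambda>\<omega>. 1 + (- 1) * indicator E \<omega>) \<in> H" by (intro H_add H_const H_scale E)
  have "indicator (space M - E) \<in> H"
  proof (rule H_limit[of "\<lambda>_ \<omega>. 1 + (- 1) * indicator E \<omega>"])
    have "sqdist M (\<lambda>\<omega>. 1 + (- 1) * indicator E \<omega>) (indicator (space M - E)) = (\<integral>\<^sup>+\<omega>. 0 \<partial>M)"
      unfolding sqdist_def by (intro nn_integral_cong) (simp add: indicator_def)
    then show "(\<lambda>n. sqdist M (\<lambda>\<omega>. 1 + (- 1) * indicator E \<omega>) (indicator (space M - E))) \<longlonglongrightarrow> 0" by simp
  qed (use H E in simp_all)
  then show ?case using E by simp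
next
  case (union E)
  have E: "indicator (E i) \<in> H" "E i \<in> events" for i using union(3)[of i] by simp_all
  have "indicator (\<Union>i. E i) \<in> H"
  proof (rule H_bounded_limit[where B=1 and Y="\<lambda>n \<omega>. \<Sum>i<n. indicator (E i) \<omega>"])
    show "(\<lambda>\<omega>. \<Sum>i<n. indicator (E i) \<omega>) \<in> H" for n by (intro H_sum E) simp
    show "indicator (\<Union>i. E i) \<in> borel_measurable M" using E(2) by simp
    have fin: "(\<Sum>i<n. indicator (E i) \<omega>) = (indicator (\<Union>i<n. E i) \<omega> :: real)" for n \<omega>
      by (rule indicator_UN_disjoint[symmetric]) (use union(1) in \<open>simp_all add: disjoint_family_on_def\<close>)
    show "\<bar>\<Sum>i<n. indicator (E i) \<omega>\<bar> \<le> (1::real)" for n \<omega> unfolding fin by (simp add: indicator_def)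
    show "(\<lambda>n. \<Sum>i<n. indicator (E i) \<omega>) \<longlonglongrightarrow> (indicator (\<Union>i. E i) \<omega> :: real)" for \<omega>
      unfolding fin by (rule LIMSEQ_indicator_UN)
  qed
  then show ?case using E(2) by blast
qed

text \<open>From indicators to simple functions to square-integrable functions. The sets \<open>{\<phi> > a}\<close> show that the
  positivity sets generate at least what \<open>A\<close> generates.\<close>

theorem dense:
  assumes N: "space N = space M" "sets N \<subseteq> sigma_sets (space M) {\<phi> -` B \<inter> space M |\<phi> B. \<phi> \<in> A \<and> B \<in> sets borel}"
    and X: "X \<in> borel_measurable N" and X2: "integrable M (\<lambda>\<omega>. (X \<omega>)\<^sup>2)"
  shows "X \<in> H"
proof -
  define G where "G = sigma (space M) positivity_sets"
  have space_G [simp]: "space G = space M" unfolding G_def by (simp add: space_measure_of_conv)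
  have sets_G: "sets G = sigma_sets (space M) positivity_sets"
    unfolding G_def by (rule sets_measure_of[OF positivity_sets_subset])
  have AG: "\<phi> \<in> borel_measurable G" if "\<phi> \<in> A" for \<phi>
  proof (rule borel_measurable_iff_greater[THEN iffD2], rule allI)
    fix a
    have "(\<lambda>\<omega>. \<phi> \<omega> + - a) \<in> uniform_closure" by (intro A_uniform_closure A_add that A_const)
    then have "{\<omega>\<in>space M. 0 < \<phi> \<omega> + - a} \<in> positivity_sets" by (rule positivity_setsI)
    moreover have "{\<omega>\<in>space M. 0 < \<phi> \<omega> + - a} = {\<omega>\<in>space G. a < \<phi> \<omega>}" by auto
    ultimately show "{\<omega>\<in>space G. a < \<phi> \<omega>} \<in> sets G" unfolding sets_G by (metis sigma_sets.Basic)
  qed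
  have "{\<phi> -` B \<inter> space M |\<phi> B. \<phi> \<in> A \<and> B \<in> sets borel} \<subseteq> sets G"
  proof safe
    fix \<phi> and B :: "real set" assume "\<phi> \<in> A" and B: "B \<in> sets borel"
    from measurable_sets[OF AG[OF \<open>\<phi> \<in> A\<close>] B] show "\<phi> -` B \<inter> space M \<in> sets G" by simp
  qed
  from sets.sigma_sets_subset[OF this] have NG: "sets N \<subseteq> sets G" using N(2) by (simp only: space_G)
  have E: "indicator E \<in> H" "E \<in> events" if "E \<in> sets N" for E
    using indicator_generated[OF subsetD[OF NG[unfolded sets_G] that]] by simp_all
  have XM: "X \<in> borel_measurable M"
  proof (rule measurableI)
    fix B :: "real set" assume "B \<in> sets borel"
    from E(2)[OF measurable_sets[OF X this]] show "X -` B \<inter> space M \<in> events" unfolding N(1) .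
  qed simp
  obtain s where s: "\<And>i. simple_function N (s i)"
    and lim: "\<And>\<omega>. \<omega> \<in> space N \<Longrightarrow> (\<lambda>i. s i \<omega>) \<longlonglongrightarrow> X \<omega>"
    and bnd: "\<And>i \<omega>. \<omega> \<in> space N \<Longrightarrow> dist (s i \<omega>) 0 \<le> 2 * dist (X \<omega>) 0"
    using borel_measurable_implies_sequence_metric[OF X, of 0] by blast
  have sH: "\<exists>Y\<in>H. \<forall>\<omega>\<in>space M. Y \<omega> = s i \<omega>" for i
  proof -
    define Y where "Y \<omega> = (\<Sum>y\<in>s i ` space N. y * indicator (s i -` {y} \<inter> space N) \<omega>)" for \<omega>
    have fin: "finite (s i ` space N)" by (rule simple_functionD(1)[OF s])
    have "s i -` {y} \<inter> space N \<in> sets N" for y by (rule simple_functionD(2)[OF s])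
    then have "Y \<in> H" unfolding Y_def[abs_def] by (intro H_sum fin H_scale E(1))
    moreover have "Y \<omega> = s i \<omega>" if "\<omega> \<in> space M" for \<omega>
    proof -
      have "Y \<omega> = (\<Sum>y\<in>s i ` space N. if y = s i \<omega> then s i \<omega> else 0)"
        unfolding Y_def using that N(1) by (intro sum.cong refl) (simp add: indicator_def)
      also have "\<dots> = s i \<omega>" using fin that N(1) by simp
      finally show ?thesis .
    qed
    ultimately show ?thesis by blast
  qed
  then have "\<forall>i. \<exists>Y. Y \<in> H \<and> (\<forall>\<omega>\<in>space M. Y \<omega> = s i \<omega>)" by blast
  from choice[OF this] obtain Y where Y: "\<And>i. Y i \<in> H" "\<And>i \<omega>. \<omega> \<in> space M \<Longrightarrow> Y i \<omega> = s i \<omega>" by blast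
  show ?thesis
  proof (rule H_dominated_limit[OF Y(1) XM, where w="\<lambda>\<omega>. 9 * (X \<omega>)\<^sup>2"])
    show "integrable M (\<lambda>\<omega>. 9 * (X \<omega>)\<^sup>2)" using X2 by simp
    fix \<omega> assume \<omega>: "\<omega> \<in> space M"
    show "(\<lambda>i. Y i \<omega>) \<longlonglongrightarrow> X \<omega>" unfolding Y(2)[OF \<omega>] using lim \<omega> N(1) by simp
    fix i
    have "\<bar>s i \<omega>\<bar> \<le> 2 * \<bar>X \<omega>\<bar>" using bnd[of \<omega> i] \<omega> N(1) by simp
    then have "\<bar>Y i \<omega> - X \<omega>\<bar> \<le> \<bar>3 * X \<omega>\<bar>" unfolding Y(2)[OF \<omega>] by linarith
    then have "(Y i \<omega> - X \<omega>)\<^sup>2 \<le> (3 * X \<omega>)\<^sup>2" by (simp only: abs_le_square_iff)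
    then show "(Y i \<omega> - X \<omega>)\<^sup>2 \<le> 9 * (X \<omega>)\<^sup>2" by (simp add: power_mult_distrib)
  qed
qed

end

section \<open>Predictable representation\<close>

text \<open>One step of the real part of the exponential martingale.\<close>

lemma exponential_recursion:
  fixes y x e k :: real
  shows "e * k * cos (y + x) = e * cos y + e * cos y * (k * cos x - 1) - e * sin y * (k * sin x - x) - e * sin y * x"
  by (simp add: cos_add algebra_simps)

context brownian_family begin

text \<open>The mean-square closure of the constants plus elementary integrals.\<close>

definition reachable :: "('a \<Rightarrow> real) set" where
  "reachable = {X \<in> borel_measurable M. \<forall>e>0. \<exists>c L. (\<forall>e\<in>set L. elementary e) \<and>
    sqdist M X (\<lambda>\<omega>. c + list_integral L \<omega>) \<le> ennreal e}"

lemma reachableD: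
  assumes "X \<in> reachable" "0 < e"
  shows "\<exists>c L. (\<forall>e\<in>set L. elementary e) \<and> sqdist M X (\<lambda>\<omega>. c + list_integral L \<omega>) \<le> ennreal e"
  using assms unfolding reachable_def by blast

lemma reachable_measurable: "X \<in> reachable \<Longrightarrow> X \<in> borel_measurable M"
  unfolding reachable_def by blast

lemma affine_list_measurable:
  "\<forall>e\<in>set L. elementary e \<Longrightarrow> (\<lambda>\<omega>. c + list_integral L \<omega>) \<in> borel_measurable M"
  by (intro borel_measurable_add borel_measurable_const list_integral_measurable(2))

lemma affine_list_reachable:
  assumes L: "\<forall>e\<in>set L. elementary e"
  shows "(\<lambda>\<omega>. c + list_integral L \<omega>) \<in> reachable"
  unfolding reachable_def
proof (intro CollectI conjI allI impI affine_list_measurable[OF L])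
  fix e :: real assume "0 < e"
  show "\<exists>c' L'. (\<forall>e\<in>set L'. elementary e) \<and>
      sqdist M (\<lambda>\<omega>. c + list_integral L \<omega>) (\<lambda>\<omega>. c' + list_integral L' \<omega>) \<le> ennreal e"
    by (intro exI[of _ c] exI[of _ L] conjI L) simp
qed

lemma reachable_close:
  assumes X: "X \<in> borel_measurable M"
    and close: "\<And>e::real. 0 < e \<Longrightarrow> \<exists>Y\<in>reachable. sqdist M X Y \<le> ennreal e"
  shows "X \<in> reachable"
  unfolding reachable_def
proof (intro CollectI conjI allI impI X)
  fix e :: real assume "0 < e"
  then have e: "0 < e/4" by simp
  obtain Y where Y: "Y \<in> reachable" "sqdist M X Y \<le> ennreal (e/4)" using close[OF e] by blast
  obtain c L where L: "\<forall>e\<in>set L. elementary e" "sqdist M Y (\<lambda>\<omega>. c + list_integral L \<omega>) \<le> ennreal (e/4)"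
    using reachableD[OF Y(1) e] by blast
  have "sqdist M X (\<lambda>\<omega>. c + list_integral L \<omega>) \<le> 2 * sqdist M X Y + 2 * sqdist M Y (\<lambda>\<omega>. c + list_integral L \<omega>)"
    by (intro sqdist_triangle X reachable_measurable[OF Y(1)] affine_list_measurable[OF L(1)])
  also have "\<dots> \<le> 2 * ennreal (e/4) + 2 * ennreal (e/4)"
    by (intro add_mono mult_left_mono Y(2) L(2)) simp_all
  also have "\<dots> = ennreal (4 * (e/4))" using e by (intro ennreal_twice_plus_twice) simp
  also have "4 * (e/4) = e" by simp
  finally show "\<exists>c L. (\<forall>e\<in>set L. elementary e) \<and> sqdist M X (\<lambda>\<omega>. c + list_integral L \<omega>) \<le> ennreal e"
    using L(1) by blast
qed

lemma reachable_add:
  assumes "X \<in> reachable" "Y \<in> reachable"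
  shows "(\<lambda>\<omega>. X \<omega> + Y \<omega>) \<in> reachable"
proof (rule reachable_close)
  note m = reachable_measurable[OF assms(1)] reachable_measurable[OF assms(2)]
  show "(\<lambda>\<omega>. X \<omega> + Y \<omega>) \<in> borel_measurable M" by (intro borel_measurable_add m)
  fix e :: real assume "0 < e"
  then have e: "0 < e/4" by simp
  obtain c L where L: "\<forall>e\<in>set L. elementary e" "sqdist M X (\<lambda>\<omega>. c + list_integral L \<omega>) \<le> ennreal (e/4)"
    using reachableD[OF assms(1) e] by blast
  obtain c' L' where L': "\<forall>e\<in>set L'. elementary e" "sqdist M Y (\<lambda>\<omega>. c' + list_integral L' \<omega>) \<le> ennreal (e/4)"
    using reachableD[OF assms(2) e] by blast
  have "sqdist M (\<lambda>\<omega>. X \<omega> + Y \<omega>) (\<lambda>\<omega>. (c + list_integral L \<omega>) + (c' + list_integral L' \<omega>))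
      \<le> 2 * sqdist M X (\<lambda>\<omega>. c + list_integral L \<omega>) + 2 * sqdist M Y (\<lambda>\<omega>. c' + list_integral L' \<omega>)"
    by (intro sqdist_add m affine_list_measurable L L')
  also have "\<dots> \<le> 2 * ennreal (e/4) + 2 * ennreal (e/4)"
    by (intro add_mono mult_left_mono L(2) L'(2)) simp_all
  also have "\<dots> = ennreal (4 * (e/4))" using e by (intro ennreal_twice_plus_twice) simp
  also have "4 * (e/4) = e" by simp
  also have "(\<lambda>\<omega>. (c + list_integral L \<omega>) + (c' + list_integral L' \<omega>)) = (\<lambda>\<omega>. (c + c') + list_integral (L @ L') \<omega>)"
    by (simp add: fun_eq_iff list_integral_append)
  finally have "sqdist M (\<lambda>\<omega>. X \<omega> + Y \<omega>) (\<lambda>\<omega>. (c + c') + list_integral (L @ L') \<omega>) \<le> ennreal e" .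
  moreover have "\<forall>e\<in>set (L @ L'). elementary e" using L(1) L'(1) by (simp add: ball_Un)
  ultimately show "\<exists>Z\<in>reachable. sqdist M (\<lambda>\<omega>. X \<omega> + Y \<omega>) Z \<le> ennreal e"
    by (intro bexI[OF _ affine_list_reachable])
qed

lemma reachable_scale:
  assumes "X \<in> reachable"
  shows "(\<lambda>\<omega>. k * X \<omega>) \<in> reachable"
proof (rule reachable_close)
  note m = reachable_measurable[OF assms]
  show "(\<lambda>\<omega>. k * X \<omega>) \<in> borel_measurable M" by (intro borel_measurable_times m borel_measurable_const)
  fix e :: real assume "0 < e"
  then have e: "0 < e / (k\<^sup>2 + 1)" by (intro divide_pos_pos) (simp_all add: add_nonneg_pos)
  obtain c L where L: "\<forall>e\<in>set L. elementary e" "sqdist M X (\<lambda>\<omega>. c + list_integral L \<omega>) \<le> ennreal (e / (k\<^sup>2 + 1))"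
    using reachableD[OF assms e] by blast
  have "sqdist M (\<lambda>\<omega>. k * X \<omega>) (\<lambda>\<omega>. k * (c + list_integral L \<omega>)) = ennreal (k\<^sup>2) * sqdist M X (\<lambda>\<omega>. c + list_integral L \<omega>)"
    by (intro sqdist_cmult m affine_list_measurable L(1))
  also have "\<dots> \<le> ennreal (k\<^sup>2) * ennreal (e / (k\<^sup>2 + 1))" by (intro mult_left_mono L(2)) simp
  also have "\<dots> = ennreal (k\<^sup>2 * (e / (k\<^sup>2 + 1)))" using e by (intro ennreal_mult[symmetric]) simp_all
  also have "\<dots> \<le> ennreal e"
  proof (rule ennreal_leI)
    have "k\<^sup>2 * (e / (k\<^sup>2 + 1)) \<le> (k\<^sup>2 + 1) * (e / (k\<^sup>2 + 1))" using e by (intro mult_right_mono) simp_all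
    also have "\<dots> = e"
    proof -
      have "k\<^sup>2 + 1 \<noteq> 0" using zero_le_power2[of k] by linarith
      then show ?thesis by simp
    qed
    finally show "k\<^sup>2 * (e / (k\<^sup>2 + 1)) \<le> e" .
  qed
  also have "(\<lambda>\<omega>. k * (c + list_integral L \<omega>)) = (\<lambda>\<omega>. k * c + list_integral (map (elem_scale k) L) \<omega>)"
    by (simp add: fun_eq_iff list_integral_scale distrib_left)
  finally have "sqdist M (\<lambda>\<omega>. k * X \<omega>) (\<lambda>\<omega>. k * c + list_integral (map (elem_scale k) L) \<omega>) \<le> ennreal e" .
  moreover have "\<forall>e\<in>set (map (elem_scale k) L). elementary e" using L(1) by (simp add: elementary_scale)
  ultimately show "\<exists>Z\<in>reachable. sqdist M (\<lambda>\<omega>. k * X \<omega>) Z \<le> ennreal e"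
    by (intro bexI[OF _ affine_list_reachable])
qed

lemma reachable_subspace: "L2_closed_subspace M reachable"
proof unfold_locales
  show "(\<lambda>_. c) \<in> reachable" for c using affine_list_reachable[of "[]" c] by simp
  fix Z X assume Z: "\<And>n. Z n \<in> reachable" and X: "X \<in> borel_measurable M"
    and lim: "(\<lambda>n::nat. sqdist M (Z n) X) \<longlonglongrightarrow> 0"
  show "X \<in> reachable"
  proof (rule reachable_close[OF X])
    fix e :: real assume "0 < e"
    from ennreal_tendsto_0D[OF lim this] obtain n where "sqdist M (Z n) X \<le> ennreal e"
      unfolding eventually_sequentially by blast
    then have "sqdist M X (Z n) \<le> ennreal e" by (simp add: sqdist_commute)
    then show "\<exists>Y\<in>reachable. sqdist M X Y \<le> ennreal e" using Z by blast
  qed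
qed (fact reachable_measurable reachable_add reachable_scale)+

lemma reachable_cong_AE:
  assumes "X \<in> reachable" "Y \<in> borel_measurable M" "AE \<omega> in M. X \<omega> = Y \<omega>"
  shows "Y \<in> reachable"
proof (rule reachable_close[OF assms(2)])
  fix e :: real
  have "sqdist M Y X = sqdist M X X"
    by (rule sqdist_cong_AE) (use assms(3) in \<open>auto elim!: eventually_mono\<close>)
  then show "\<exists>Z\<in>reachable. sqdist M Y Z \<le> ennreal e" using assms(1) by (intro bexI[of _ X]) simp_all
qed

subsection \<open>Sums of conditionally centred terms\<close>

lemma increment_adapted:
  assumes "0 \<le> s" "s \<le> t"
  shows "increment s t \<in> measurable (F t) (PiM UNIV (\<lambda>_. borel))"
proof (rule measurable_PiM_single')
  show "(\<lambda>\<omega>. increment s t \<omega> a) \<in> borel_measurable (F t)" for a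
    unfolding increment_def using assms by (intro borel_measurable_diff W_adapted) simp_all
qed simp

text \<open>The summands are orthogonal: each factor \<open>g\<close> is centred and independent of everything that precedes
  it.\<close>

lemma centred_sum_square:
  fixes g :: "('i \<Rightarrow> real) \<Rightarrow> real"
  assumes h: "0 < h" "0 \<le> s" "s + real n * h \<le> T"
    and D: "\<And>j. j < n \<Longrightarrow> D j \<in> borel_measurable (F (s + real j * h))"
    and DB: "\<And>j \<omega>. j < n \<Longrightarrow> \<omega> \<in> space M \<Longrightarrow> \<bar>D j \<omega>\<bar> \<le> B"
    and g [measurable]: "g \<in> borel_measurable (PiM UNIV (\<lambda>_. borel))"
    and gE: "\<And>j. j < n \<Longrightarrow> integrable M (\<lambda>\<omega>. (g (increment (s + real j * h) (s + real (Suc j) * h) \<omega>))\<^sup>2) \<and>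
      expectation (\<lambda>\<omega>. g (increment (s + real j * h) (s + real (Suc j) * h) \<omega>)) = 0 \<and>
      expectation (\<lambda>\<omega>. (g (increment (s + real j * h) (s + real (Suc j) * h) \<omega>))\<^sup>2) \<le> V"
  defines "S \<equiv> \<lambda>k \<omega>. \<Sum>j<k. D j \<omega> * g (increment (s + real j * h) (s + real (Suc j) * h) \<omega>)"
  shows "S n \<in> borel_measurable (F (s + real n * h)) \<and> integrable M (\<lambda>\<omega>. (S n \<omega>)\<^sup>2) \<and>
    expectation (\<lambda>\<omega>. (S n \<omega>)\<^sup>2) \<le> real n * (B\<^sup>2 * V)"
proof -
  have "S k \<in> borel_measurable (F (s + real k * h)) \<and> integrable M (\<lambda>\<omega>. (S k \<omega>)\<^sup>2) \<and>
      expectation (\<lambda>\<omega>. (S k \<omega>)\<^sup>2) \<le> real k * (B\<^sup>2 * V)" if "k \<le> n" for k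
    using that
  proof (induction k)
    case 0
    show ?case by (simp add: S_def)
  next
    case (Suc k)
    then have k: "k < n" by simp
    define r r' where "r = s + real k * h" and "r' = s + real (Suc k) * h"
    have "real (Suc k) * h \<le> real n * h" using k h by (intro mult_right_mono) simp_all
    then have rT: "0 \<le> r" "r < r'" "r' \<le> T"
    proof -
      have "0 \<le> real k * h" "real (Suc k) * h = real k * h + h" using h by (simp_all add: distrib_right)
      then show "0 \<le> r" "r < r'" "r' \<le> T"
        unfolding r_def r'_def using h \<open>real (Suc k) * h \<le> real n * h\<close> by linarith+
    qed
    from Suc have SF: "S k \<in> borel_measurable (F r)" and S2: "integrable M (\<lambda>\<omega>. (S k \<omega>)\<^sup>2)"
      and SE: "expectation (\<lambda>\<omega>. (S k \<omega>)\<^sup>2) \<le> real k * (B\<^sup>2 * V)"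
      by (simp_all add: r_def)
    have DF: "D k \<in> borel_measurable (F r)" unfolding r_def by (rule D[OF k])
    have DM: "D k \<in> borel_measurable M" by (rule measurable_F_M[OF DF]) (use rT in linarith)+
    have SM: "S k \<in> borel_measurable M" by (rule measurable_F_M[OF SF]) (use rT in linarith)+
    have Dbd: "bounded_rv (D k)" unfolding bounded_rv_def using DB[OF k] by blast
    define G where "G \<omega> = g (increment r r' \<omega>)" for \<omega>
    have G2: "integrable M (\<lambda>\<omega>. (G \<omega>)\<^sup>2)" and GE: "expectation G = 0" and GV: "expectation (\<lambda>\<omega>. (G \<omega>)\<^sup>2) \<le> V"
      using gE[OF k] unfolding G_def[abs_def] r_def r'_def by simp_all
    have GF: "G \<in> borel_measurable (F r')"
      unfolding G_def[abs_def] by (rule measurable_compose[OF increment_adapted g]) (use rT in linarith)+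
    have GM: "G \<in> borel_measurable M" by (rule measurable_F_M[OF GF]) (use rT in linarith)+
    have G1: "integrable M G" by (rule square_integrable_imp_integrable[OF GM G2])
    have step: "S (Suc k) = (\<lambda>\<omega>. S k \<omega> + D k \<omega> * G \<omega>)"
      by (simp add: S_def fun_eq_iff G_def r_def r'_def)
    have meas: "S (Suc k) \<in> borel_measurable (F r')"
      unfolding step
      by (intro borel_measurable_add borel_measurable_times GF measurable_F_mono[OF SF] measurable_F_mono[OF DF])
        (use rT in linarith)+
    have DG2: "integrable M (\<lambda>\<omega>. (D k \<omega> * G \<omega>)\<^sup>2)"
      by (rule bounded_rv_square_integrable_mult[OF DM GM Dbd G2])
    have S2': "integrable M (\<lambda>\<omega>. (S (Suc k) \<omega>)\<^sup>2)"
      unfolding step by (intro square_integrable_add SM S2 DG2 borel_measurable_times DM GM)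
    have SDF: "(\<lambda>\<omega>. S k \<omega> * D k \<omega>) \<in> borel_measurable (F r)" by (intro borel_measurable_times SF DF)
    have SD1: "integrable M (\<lambda>\<omega>. S k \<omega> * D k \<omega>)"
      by (intro square_integrable_prod SM DM S2 bounded_rv_square_integrable Dbd)
    have cross: "integrable M (\<lambda>\<omega>. (S k \<omega> * D k \<omega>) * G \<omega>)" "expectation (\<lambda>\<omega>. (S k \<omega> * D k \<omega>) * G \<omega>) = 0"
      using expectation_past_increment[OF rT SDF SD1 g G1[unfolded G_def[abs_def]]] GE unfolding G_def[abs_def] by simp_all
    have DG_le: "expectation (\<lambda>\<omega>. (D k \<omega> * G \<omega>)\<^sup>2) \<le> B\<^sup>2 * V"
    proof -
      have "expectation (\<lambda>\<omega>. (D k \<omega> * G \<omega>)\<^sup>2) \<le> expectation (\<lambda>\<omega>. B\<^sup>2 * (G \<omega>)\<^sup>2)"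
      proof (rule integral_mono[OF DG2])
        show "integrable M (\<lambda>\<omega>. B\<^sup>2 * (G \<omega>)\<^sup>2)" using G2 by simp
        fix \<omega> assume "\<omega> \<in> space M"
        from DB[OF k this] have "(D k \<omega>)\<^sup>2 \<le> B\<^sup>2" by (metis abs_ge_zero power2_abs power_mono)
        then show "(D k \<omega> * G \<omega>)\<^sup>2 \<le> B\<^sup>2 * (G \<omega>)\<^sup>2"
          unfolding power_mult_distrib by (rule mult_right_mono) simp
      qed
      also have "\<dots> \<le> B\<^sup>2 * V" using GV by (simp add: mult_left_mono)
      finally show ?thesis .
    qed
    have "expectation (\<lambda>\<omega>. (S (Suc k) \<omega>)\<^sup>2) =
        expectation (\<lambda>\<omega>. ((S k \<omega>)\<^sup>2 + 2 * ((S k \<omega> * D k \<omega>) * G \<omega>)) + (D k \<omega> * G \<omega>)\<^sup>2)"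
      unfolding step by (intro Bochner_Integration.integral_cong refl) (simp add: power2_sum algebra_simps)
    also have "\<dots> = expectation (\<lambda>\<omega>. (S k \<omega>)\<^sup>2) + 2 * expectation (\<lambda>\<omega>. (S k \<omega> * D k \<omega>) * G \<omega>) + expectation (\<lambda>\<omega>. (D k \<omega> * G \<omega>)\<^sup>2)"
      using S2 cross(1) DG2 by simp
    also have "\<dots> \<le> real k * (B\<^sup>2 * V) + B\<^sup>2 * V" using SE DG_le cross(2) by simp
    also have "\<dots> = real (Suc k) * (B\<^sup>2 * V)" by (simp add: distrib_right)
    finally show ?case using meas S2' unfolding r'_def by blast
  qed
  then show ?thesis by simp
qed

subsection \<open>Cosines of increments are reachable\<close>

lemma dot_increment_add:
  "dot lam (increment r u \<omega>) = dot lam (increment r v \<omega>) + dot lam (increment v u \<omega>)"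
  unfolding dot_def increment_def by (simp add: sum.distrib[symmetric] algebra_simps)

lemma dot_increment_adapted:
  assumes "0 \<le> s" "s \<le> t"
  shows "(\<lambda>\<omega>. dot lam (increment s t \<omega>)) \<in> borel_measurable (F t)"
  by (rule measurable_compose[OF increment_adapted[OF assms] dot_measurable])

lemma list_integral_concat: "list_integral (concat Ls) \<omega> = (\<Sum>L\<leftarrow>Ls. list_integral L \<omega>)"
  by (induction Ls) (simp_all add: list_integral_append)

text \<open>With \<open>\<kappa> = sqlen lam\<close>, the process \<open>exp (\<kappa> (r - s) / 2) cos (\<theta> + dot lam (increment s r))\<close> is a
  martingale in \<open>r\<close>. On a grid of \<open>N\<close> cells its value at \<open>t\<close> is \<open>cos \<theta>\<close>, plus the elementary integral of
  minus the corresponding sine process times \<open>lam\<close>, plus two sums of remainders whose second moments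
  are \<open>O(1/N)\<close>.\<close>

lemma cos_increment_reachable:
  assumes st: "0 \<le> s" "s < t" "t \<le> T" and \<theta>: "\<theta> \<in> borel_measurable (F s)"
    and cos\<theta>: "(\<lambda>\<omega>. cos (\<theta> \<omega>)) \<in> reachable"
  shows "(\<lambda>\<omega>. cos (\<theta> \<omega> + dot lam (increment s t \<omega>))) \<in> reachable"
proof (rule rem_moments[of lam])
  fix C assume C: "0 \<le> C"
    and rem: "\<And>s t g. 0 \<le> s \<Longrightarrow> s < t \<Longrightarrow> t \<le> T \<Longrightarrow> g = cos_rem lam (t - s) \<or> g = sin_rem lam (t - s) \<Longrightarrow>
      integrable M (\<lambda>\<omega>. (g (increment s t \<omega>))\<^sup>2) \<and> expectation (\<lambda>\<omega>. g (increment s t \<omega>)) = 0 \<and>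
      expectation (\<lambda>\<omega>. (g (increment s t \<omega>))\<^sup>2) \<le> C * (t - s)\<^sup>2"
  define \<kappa> where "\<kappa> = sqlen lam"
  have \<kappa>: "0 \<le> \<kappa>" unfolding \<kappa>_def by (rule sqlen_nonneg)
  define B where "B = exp (\<kappa> * T / 2)"
  define X where "X \<omega> = exp (\<kappa> * (t - s) / 2) * cos (\<theta> \<omega> + dot lam (increment s t \<omega>))" for \<omega>
  obtain as :: "'i list" where as: "set as = UNIV" "distinct as"
    using finite_distinct_list[OF finite_class.finite_UNIV] by blast
  have "X \<in> reachable"
  proof (rule reachable_close)
    have "(\<lambda>\<omega>. \<theta> \<omega> + dot lam (increment s t \<omega>)) \<in> borel_measurable (F t)"
      by (intro borel_measurable_add measurable_F_mono[OF \<theta>] dot_increment_adapted) (use st in linarith)+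
    then have [measurable]: "(\<lambda>\<omega>. \<theta> \<omega> + dot lam (increment s t \<omega>)) \<in> borel_measurable M"
      by (rule measurable_F_M) (use st in linarith)+
    show "X \<in> borel_measurable M" unfolding X_def[abs_def] by measurable
    fix e :: real assume "0 < e"
    define Q where "Q = B\<^sup>2 * C * (t - s)\<^sup>2"
    \<comment> \<open>each of the two remainder sums has second moment at most \<open>Q / N\<close>\<close>
    obtain N0 :: nat where N0: "4 * Q / e < real N0" using reals_Archimedean2 by blast
    define N where "N = Suc N0"
    have N: "0 < real N" "4 * Q / e < real N" using N0 by (simp_all add: N_def)
    define h where "h = (t - s) / real N"
    have h: "0 < h" "real N * h = t - s" using st N by (simp_all add: h_def)
    define r where "r j = s + real j * h" for j
    have r0: "r 0 = s" and rN: "r N = t" using h by (simp_all add: r_def)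
    have rs: "s \<le> r j" for j unfolding r_def using h by simp
    have rSuc: "r (Suc j) = r j + h" for j unfolding r_def by (simp add: distrib_right)
    have rt: "r j \<le> t" if "j \<le> N" for j
    proof -
      have "real j * h \<le> real N * h" using that h by (intro mult_right_mono) simp_all
      then show ?thesis unfolding r_def using h by linarith
    qed
    define Y where "Y j \<omega> = \<theta> \<omega> + dot lam (increment s (r j) \<omega>)" for j \<omega>
    have YF: "Y j \<in> borel_measurable (F (r j))" for j
      unfolding Y_def[abs_def]
      by (intro borel_measurable_add measurable_F_mono[OF \<theta>] dot_increment_adapted st(1) rs)
    define E where "E j = exp (\<kappa> * (real j * h) / 2)" for j
    have EB: "\<bar>E j\<bar> \<le> B" if "j \<le> N" for j
    proof -
      have "real j * h \<le> T" using rt[OF that] st unfolding r_def by linarith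
      then have "\<kappa> * (real j * h) / 2 \<le> \<kappa> * T / 2" using \<kappa> by (simp add: mult_left_mono)
      then show ?thesis unfolding E_def B_def by simp
    qed
    define c where "c j \<omega> = E j * cos (Y j \<omega>)" for j \<omega>
    define sn where "sn j \<omega> = E j * sin (Y j \<omega>)" for j \<omega>
    have cF: "c j \<in> borel_measurable (F (r j))" and snF: "sn j \<in> borel_measurable (F (r j))" for j
      using YF[of j] unfolding c_def[abs_def] sn_def[abs_def] by measurable
    have cB: "\<bar>c j \<omega>\<bar> \<le> B" and snB: "\<bar>sn j \<omega>\<bar> \<le> B" if "j \<le> N" for j \<omega>
    proof -
      have "\<bar>E j\<bar> * \<bar>cos (Y j \<omega>)\<bar> \<le> B * 1" "\<bar>E j\<bar> * \<bar>sin (Y j \<omega>)\<bar> \<le> B * 1"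
        by (intro mult_mono EB[OF that] abs_cos_le_one abs_sin_le_one; simp add: B_def)+
      then show "\<bar>c j \<omega>\<bar> \<le> B" "\<bar>sn j \<omega>\<bar> \<le> B" unfolding c_def sn_def by (simp_all add: abs_mult)
    qed
    define inc where "inc j \<omega> = increment (r j) (r (Suc j)) \<omega>" for j \<omega>
    have rec: "c (Suc j) \<omega> = c j \<omega> + (c j \<omega> * cos_rem lam h (inc j \<omega>) - sn j \<omega> * sin_rem lam h (inc j \<omega>)
        - sn j \<omega> * dot lam (inc j \<omega>))" for j \<omega>
    proof -
      have "Y (Suc j) \<omega> = Y j \<omega> + dot lam (inc j \<omega>)"
        unfolding Y_def inc_def using dot_increment_add[of lam s "r (Suc j)" \<omega> "r j"] by simp
      moreover have "E (Suc j) = E j * exp (\<kappa> * h / 2)"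
        unfolding E_def exp_add[symmetric] by (simp add: algebra_simps add_divide_distrib)
      ultimately show ?thesis
        unfolding c_def sn_def cos_rem_def sin_rem_def \<kappa>_def[symmetric]
        using exponential_recursion[of "E j" "exp (\<kappa> * h / 2)" "Y j \<omega>" "dot lam (inc j \<omega>)"] by simp
    qed
    define SP where "SP \<omega> = (\<Sum>j<N. c j \<omega> * cos_rem lam h (inc j \<omega>))" for \<omega>
    define SQ where "SQ \<omega> = (\<Sum>j<N. sn j \<omega> * sin_rem lam h (inc j \<omega>))" for \<omega>
    have tele: "c n \<omega> = c 0 \<omega> + ((\<Sum>j<n. c j \<omega> * cos_rem lam h (inc j \<omega>))
        - (\<Sum>j<n. sn j \<omega> * sin_rem lam h (inc j \<omega>)) - (\<Sum>j<n. sn j \<omega> * dot lam (inc j \<omega>)))" for n \<omega>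
      by (induction n) (simp_all add: rec)
    define L where "L = concat (map (\<lambda>j. map (\<lambda>a. (a, r j, r (Suc j), \<lambda>\<omega>. - lam a * sn j \<omega>)) as) [0..<N])"
    have LI: "list_integral L \<omega> = - (\<Sum>j<N. sn j \<omega> * dot lam (inc j \<omega>))" for \<omega>
    proof -
      have "list_integral (map (\<lambda>a. (a, r j, r (Suc j), \<lambda>\<omega>. - lam a * sn j \<omega>)) as) \<omega> = - (sn j \<omega> * dot lam (inc j \<omega>))" for j
      proof -
        have "list_integral (map (\<lambda>a. (a, r j, r (Suc j), \<lambda>\<omega>. - lam a * sn j \<omega>)) as) \<omega> =
            (\<Sum>a\<in>UNIV. - lam a * sn j \<omega> * inc j \<omega> a)"
          using as by (simp add: list_integral_def elem_integral_def comp_def sum_list_distinct_conv_sum_set inc_def increment_def)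
        also have "\<dots> = - (sn j \<omega> * dot lam (inc j \<omega>))"
          by (simp add: dot_def sum_distrib_left sum_negf[symmetric] mult_ac)
        finally show ?thesis .
      qed
      then show ?thesis
        unfolding L_def list_integral_concat
        by (simp add: comp_def interv_sum_list_conv_sum_set_nat atLeast0LessThan sum_negf)
    qed
    have el: "\<forall>e\<in>set L. elementary e"
    proof
      fix e assume "e \<in> set L"
      then obtain j a where j: "j < N" and e: "e = (a, r j, r (Suc j), \<lambda>\<omega>. - lam a * sn j \<omega>)"
        unfolding L_def by auto
      have "bounded_rv (\<lambda>\<omega>. - lam a * sn j \<omega>)"
        by (rule bounded_rv_mult) (use snB[of j] j in \<open>unfold bounded_rv_def, blast, meson less_imp_le\<close>)
      moreover have "(\<lambda>\<omega>. - lam a * sn j \<omega>) \<in> borel_measurable (F (r j))"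
        by (intro borel_measurable_times borel_measurable_const snF)
      moreover have "0 \<le> r j" using rs[of j] st by linarith
      moreover have "r (Suc j) \<le> T" using rt[of "Suc j"] j st by linarith
      moreover have "r j < r (Suc j)" unfolding rSuc using h by simp
      ultimately show "elementary e" unfolding e elementary_def prod.case by blast
    qed
    have Z: "(\<lambda>\<omega>. cos (\<theta> \<omega>) + list_integral L \<omega>) \<in> reachable"
      using reachable_add[OF cos\<theta> affine_list_reachable[OF el, of 0]] by simp
    have c0: "c 0 \<omega> = cos (\<theta> \<omega>)" for \<omega>
      unfolding c_def E_def Y_def r0 by (simp add: dot_def increment_def)
    have cN: "X = c N"
      unfolding X_def[abs_def] c_def[abs_def] E_def Y_def rN h(2) ..
    have hT: "s + real N * h \<le> T" using h st by linarith
    have gE: "integrable M (\<lambda>\<omega>. (g (increment (s + real j * h) (s + real (Suc j) * h) \<omega>))\<^sup>2) \<and>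
      expectation (\<lambda>\<omega>. g (increment (s + real j * h) (s + real (Suc j) * h) \<omega>)) = 0 \<and>
      expectation (\<lambda>\<omega>. (g (increment (s + real j * h) (s + real (Suc j) * h) \<omega>))\<^sup>2) \<le> C * h\<^sup>2"
      if g: "g = cos_rem lam h \<or> g = sin_rem lam h" and j: "j < N" for g j
    proof -
      have "0 \<le> r j" using rs[of j] st by linarith
      moreover have "r j < r (Suc j)" unfolding rSuc using h by simp
      moreover have "r (Suc j) \<le> T" using rt[of "Suc j"] j st by linarith
      moreover have "r (Suc j) - r j = h" unfolding rSuc by simp
      ultimately show ?thesis using rem[of "r j" "r (Suc j)" g] g unfolding r_def by simp
    qed
    have bound: "N * (B\<^sup>2 * (C * h\<^sup>2)) \<le> e/4"
    proof -
      have "real N * (B\<^sup>2 * (C * h\<^sup>2)) = Q / real N"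
        using N(1) unfolding Q_def h_def by (simp add: power_divide power2_eq_square)
      also have "\<dots> \<le> e / 4"
      proof -
        have "4 * Q < real N * e" using N(2) \<open>0 < e\<close> by (simp add: pos_divide_less_eq)
        then show ?thesis using N(1) by (simp add: pos_divide_le_eq mult.commute)
      qed
      finally show ?thesis .
    qed
    have SPb: "SP \<in> borel_measurable (F (s + real N * h)) \<and> integrable M (\<lambda>\<omega>. (SP \<omega>)\<^sup>2) \<and>
        expectation (\<lambda>\<omega>. (SP \<omega>)\<^sup>2) \<le> real N * (B\<^sup>2 * (C * h\<^sup>2))"
      unfolding SP_def[abs_def] inc_def r_def
      by (rule centred_sum_square[OF h(1) st(1) hT cF[unfolded r_def] cB[OF less_imp_le] cos_rem_measurable gE[OF disjI1[OF refl]]])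
    have SQb: "SQ \<in> borel_measurable (F (s + real N * h)) \<and> integrable M (\<lambda>\<omega>. (SQ \<omega>)\<^sup>2) \<and>
        expectation (\<lambda>\<omega>. (SQ \<omega>)\<^sup>2) \<le> real N * (B\<^sup>2 * (C * h\<^sup>2))"
      unfolding SQ_def[abs_def] inc_def r_def
      by (rule centred_sum_square[OF h(1) st(1) hT snF[unfolded r_def] snB[OF less_imp_le] sin_rem_measurable gE[OF disjI2[OF refl]]])
    have small: "sqdist M G (\<lambda>_. 0) \<le> ennreal (e/4)"
      if "integrable M (\<lambda>\<omega>. (G \<omega>)\<^sup>2)" "expectation (\<lambda>\<omega>. (G \<omega>)\<^sup>2) \<le> real N * (B\<^sup>2 * (C * h\<^sup>2))" for G
    proof -
      have "sqdist M G (\<lambda>_. 0) = ennreal (expectation (\<lambda>\<omega>. (G \<omega>)\<^sup>2))"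
        using sqdist_eq_integral[of M G "\<lambda>_. 0"] that(1) by simp
      also have "\<dots> \<le> ennreal (e/4)" by (rule ennreal_leI) (use that(2) bound in linarith)
      finally show ?thesis .
    qed
    have m: "SP \<in> borel_measurable M" "SQ \<in> borel_measurable M"
      by (rule measurable_F_M[OF conjunct1[OF SPb]] measurable_F_M[OF conjunct1[OF SQb]]; use hT h st in linarith)+
    have "sqdist M X (\<lambda>\<omega>. cos (\<theta> \<omega>) + list_integral L \<omega>) = sqdist M SP SQ"
      unfolding cN sqdist_def
    proof (intro nn_integral_cong arg_cong[where f=ennreal] arg_cong[where f="\<lambda>x. x\<^sup>2"])
      fix \<omega>
      show "c N \<omega> - (cos (\<theta> \<omega>) + list_integral L \<omega>) = SP \<omega> - SQ \<omega>"
        using tele[of N \<omega>] unfolding LI c0 SP_def SQ_def by linarith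
    qed
    also have "\<dots> \<le> 2 * sqdist M SP (\<lambda>_. 0) + 2 * sqdist M (\<lambda>_. 0) SQ"
      by (intro sqdist_triangle m) simp
    also have "\<dots> \<le> 2 * ennreal (e/4) + 2 * ennreal (e/4)"
      by (intro add_mono mult_left_mono) (use small SPb SQb in \<open>simp_all add: sqdist_commute[of M "\<lambda>_. 0"]\<close>)
    also have "\<dots> = ennreal (4 * (e/4))" using \<open>0 < e\<close> by (intro ennreal_twice_plus_twice) simp
    also have "4 * (e/4) = e" by simp
    finally show "\<exists>Y\<in>reachable. sqdist M X Y \<le> ennreal e" by (rule bexI[OF _ Z])
  qed
  have cancel: "inverse (exp k) * (exp k * y) = y" for k y :: real
    by (simp only: mult.assoc[symmetric] left_inverse[OF exp_not_eq_zero] mult_1_left)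
  from reachable_scale[OF \<open>X \<in> reachable\<close>, of "inverse (exp (\<kappa> * (t - s) / 2))"]
  show ?thesis unfolding X_def cancel .
qed

subsection \<open>Trigonometric polynomials\<close>

text \<open>The additive constant \<open>\<alpha>\<close> makes sines special cases of cosines.\<close>

definition phase :: "real set \<Rightarrow> (real \<Rightarrow> 'i \<Rightarrow> real) \<Rightarrow> real \<Rightarrow> 'a \<Rightarrow> real" where
  "phase R lam \<alpha> \<omega> = \<alpha> + (\<Sum>r\<in>R. dot (lam r) (\<lambda>a. W a r \<omega>))"

lemma phase_adapted:
  assumes "\<And>r. r \<in> R \<Longrightarrow> 0 \<le> r \<and> r \<le> s"
  shows "phase R lam \<alpha> \<in> borel_measurable (F s)"
  unfolding phase_def[abs_def] dot_def
  by (intro borel_measurable_add borel_measurable_const borel_measurable_sum borel_measurable_times W_adapted)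
    (use assms in blast)+

lemma dot_add: "dot (\<lambda>a. f a + g a) v = dot f v + dot g v"
  and dot_diff: "dot (\<lambda>a. f a - g a) v = dot f v - dot g v"
  and dot_zero: "dot (\<lambda>a. 0) v = 0"
  unfolding dot_def by (simp_all add: distrib_right left_diff_distrib sum.distrib sum_subtractf)

lemma phase_extend:
  assumes "finite R'" "R \<subseteq> R'"
  shows "phase R lam \<alpha> = phase R' (\<lambda>r. if r \<in> R then lam r else (\<lambda>_. 0)) \<alpha>"
proof
  fix \<omega>
  have "(\<Sum>r\<in>R. dot (lam r) (\<lambda>a. W a r \<omega>)) = (\<Sum>r\<in>R'. dot (if r \<in> R then lam r else (\<lambda>_. 0)) (\<lambda>a. W a r \<omega>))"
    by (rule sum.mono_neutral_cong_left[OF assms]) (simp_all add: dot_zero)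
  then show "phase R lam \<alpha> \<omega> = phase R' (\<lambda>r. if r \<in> R then lam r else (\<lambda>_. 0)) \<alpha> \<omega>"
    unfolding phase_def by simp
qed

lemma W_zero: "AE \<omega> in M. W a 0 \<omega> = 0"
  using brownian[of a] by (simp add: standard_brownian_motion_def)

lemma dot_W_zero: "AE \<omega> in M. dot lam (\<lambda>a. W a 0 \<omega>) = 0"
proof -
  have "AE \<omega> in M. \<forall>a\<in>UNIV. W a 0 \<omega> = 0" by (rule AE_finite_allI) (simp_all add: W_zero)
  then show ?thesis by eventually_elim (simp add: dot_def)
qed

text \<open>Add the times in increasing order. The value at the latest time \<open>b\<close> is the value at the preceding
  time, which is absorbed in its coefficients, plus an increment from there to \<open>b\<close>.\<close>

lemma cos_phase_reachable:
  assumes "finite R" "R \<subseteq> {0..T}"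
  shows "(\<lambda>\<omega>. cos (phase R lam \<alpha> \<omega>)) \<in> reachable"
  using assms
proof (induction R arbitrary: lam \<alpha> rule: finite_linorder_max_induct)
  case empty
  interpret L2_closed_subspace M reachable by (rule reachable_subspace)
  show ?case unfolding phase_def by (simp add: H_const)
next
  case (insert b A)
  interpret L2_closed_subspace M reachable by (rule reachable_subspace)
  have b: "0 \<le> b" "b \<le> T" and AT: "A \<subseteq> {0..T}" and "b \<notin> A" using insert.prems insert.hyps by auto
  have split: "phase (insert b A) lam \<alpha> \<omega> = phase A lam \<alpha> \<omega> + dot (lam b) (\<lambda>a. W a b \<omega>)" for \<omega>
    unfolding phase_def using insert.hyps(1) \<open>b \<notin> A\<close> by simp
  have incr: "dot (lam b) (\<lambda>a. W a b \<omega>) = dot (lam b) (\<lambda>a. W a s \<omega>) + dot (lam b) (increment s b \<omega>)" for s \<omega>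
    unfolding dot_def increment_def by (simp add: sum.distrib[symmetric] algebra_simps)
  have meas: "(\<lambda>\<omega>. cos (phase (insert b A) lam \<alpha> \<omega>)) \<in> borel_measurable M"
  proof -
    have "phase (insert b A) lam \<alpha> \<in> borel_measurable (F T)"
      by (rule phase_adapted) (use insert.prems in auto)
    from measurable_F_M[OF this] T_pos have "phase (insert b A) lam \<alpha> \<in> borel_measurable M" by simp
    then show ?thesis by measurable
  qed
  show ?case
  proof (cases "A = {}")
    case True
    have *: "(\<lambda>\<omega>. cos (\<alpha> + dot (lam b) (increment 0 b \<omega>))) \<in> reachable"
    proof (cases "b = 0")
      case True
      then show ?thesis using H_const[of "cos \<alpha>"] by (simp add: increment_def dot_def)
    next
      case False
      then show ?thesis using b by (intro cos_increment_reachable H_const) simp_all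
    qed
    show ?thesis
    proof (rule reachable_cong_AE[OF * meas])
      show "AE \<omega> in M. cos (\<alpha> + dot (lam b) (increment 0 b \<omega>)) = cos (phase (insert b A) lam \<alpha> \<omega>)"
        using dot_W_zero[of "lam b"]
      proof eventually_elim
        case (elim \<omega>)
        have "phase (insert b A) lam \<alpha> \<omega> = \<alpha> + dot (lam b) (\<lambda>a. W a b \<omega>)"
          unfolding split using True by (simp add: phase_def)
        then show ?case unfolding incr[of _ 0] elim by simp
      qed
    qed
  next
    case False
    define s where "s = Max A"
    have sA: "s \<in> A" and As: "\<And>r. r \<in> A \<Longrightarrow> r \<le> s" unfolding s_def using insert.hyps(1) False by simp_all
    have s: "0 \<le> s" "s < b" using sA AT insert.hyps(2) by auto
    \<comment> \<open>moves the coefficients of time \<open>b\<close> to time \<open>s\<close>\<close>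
    define lam' where "lam' r = (\<lambda>a. lam r a + (if r = s then lam b a else 0))" for r
    have "phase A lam' \<alpha> \<omega> = phase A lam \<alpha> \<omega> + dot (lam b) (\<lambda>a. W a s \<omega>)" for \<omega>
    proof -
      have "(\<Sum>r\<in>A. dot (lam' r) (\<lambda>a. W a r \<omega>)) =
          (\<Sum>r\<in>A. dot (lam r) (\<lambda>a. W a r \<omega>) + (if r = s then dot (lam b) (\<lambda>a. W a s \<omega>) else 0))"
        unfolding lam'_def dot_add by (intro sum.cong refl) (simp add: dot_zero)
      also have "\<dots> = (\<Sum>r\<in>A. dot (lam r) (\<lambda>a. W a r \<omega>)) + dot (lam b) (\<lambda>a. W a s \<omega>)"
        using insert.hyps(1) sA by (simp add: sum.distrib)
      finally show ?thesis unfolding phase_def by simp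
    qed
    then have eq: "phase (insert b A) lam \<alpha> \<omega> = phase A lam' \<alpha> \<omega> + dot (lam b) (increment s b \<omega>)" for \<omega>
      unfolding split incr[of _ s] by simp
    have "phase A lam' \<alpha> \<in> borel_measurable (F s)"
      by (rule phase_adapted) (use AT As in auto)
    then show ?thesis
      unfolding eq using s b by (intro cos_increment_reachable insert.IH AT)
  qed
qed

text \<open>The linear span of the cosines. Products stay inside by the product-to-sum formula, after both
  phases are written over the union of their sets of times.\<close>

inductive_set trig :: "('a \<Rightarrow> real) set" where
  wave: "finite R \<Longrightarrow> R \<subseteq> {0..T} \<Longrightarrow> (\<lambda>\<omega>. c * cos (phase R lam \<alpha> \<omega>)) \<in> trig"
| sum: "f \<in> trig \<Longrightarrow> g \<in> trig \<Longrightarrow> (\<lambda>\<omega>. f \<omega> + g \<omega>) \<in> trig"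

lemma wave_mult:
  assumes R: "finite R" "R \<subseteq> {0..T}" and R': "finite R'" "R' \<subseteq> {0..T}"
  shows "(\<lambda>\<omega>. (c * cos (phase R lam \<alpha> \<omega>)) * (c' * cos (phase R' lam' \<alpha>' \<omega>))) \<in> trig"
proof -
  define S where "S = R \<union> R'"
  have S: "finite S" "S \<subseteq> {0..T}" using R R' unfolding S_def by auto
  define p where "p r = (if r \<in> R then lam r else (\<lambda>_. 0))" for r
  define q where "q r = (if r \<in> R' then lam' r else (\<lambda>_. 0))" for r
  have pq: "phase R lam \<alpha> = phase S p \<alpha>" "phase R' lam' \<alpha>' = phase S q \<alpha>'"
    unfolding p_def[abs_def] q_def[abs_def] by (rule phase_extend, simp add: S, simp add: S_def)+
  have sum: "phase S p \<alpha> \<omega> + phase S q \<alpha>' \<omega> = phase S (\<lambda>r a. p r a + q r a) (\<alpha> + \<alpha>') \<omega>"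
    and diff: "phase S p \<alpha> \<omega> - phase S q \<alpha>' \<omega> = phase S (\<lambda>r a. p r a - q r a) (\<alpha> - \<alpha>') \<omega>" for \<omega>
    unfolding phase_def dot_add dot_diff by (simp_all add: sum.distrib sum_subtractf)
  have eq: "(\<lambda>\<omega>. (c * cos (phase R lam \<alpha> \<omega>)) * (c' * cos (phase R' lam' \<alpha>' \<omega>))) =
    (\<lambda>\<omega>. (c * c' / 2) * cos (phase S (\<lambda>r a. p r a - q r a) (\<alpha> - \<alpha>') \<omega>) +
      (c * c' / 2) * cos (phase S (\<lambda>r a. p r a + q r a) (\<alpha> + \<alpha>') \<omega>))"
    unfolding pq sum[symmetric] diff[symmetric]
    by (simp add: fun_eq_iff cos_add cos_diff algebra_simps)
  show ?thesis unfolding eq by (intro trig.sum trig.wave S)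
qed

lemma trig_mult:
  assumes "f \<in> trig" "g \<in> trig"
  shows "(\<lambda>\<omega>. f \<omega> * g \<omega>) \<in> trig"
  using assms(1)
proof (induction rule: trig.induct)
  case (wave R c lam \<alpha>)
  show ?case
    using assms(2)
  proof (induction rule: trig.induct)
    case (wave R' c' lam' \<alpha>')
    show ?case by (rule wave_mult) fact+
  next
    case (sum f g)
    then show ?case unfolding distrib_left by (intro trig.sum)
  qed
next
  case (sum f f')
  then show ?case unfolding distrib_right by (intro trig.sum)
qed

lemma trig_algebra: "bounded_function_algebra M reachable trig"
proof -
  interpret L2_closed_subspace M reachable by (rule reachable_subspace)
  show ?thesis
  proof unfold_locales
    show "\<phi> \<in> reachable" if "\<phi> \<in> trig" for \<phi>
      using that by (induction rule: trig.induct) (intro H_scale H_add cos_phase_reachable; assumption)+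
    show "\<exists>B. \<forall>\<omega>\<in>space M. \<bar>\<phi> \<omega>\<bar> \<le> B" if "\<phi> \<in> trig" for \<phi>
      using that
    proof (induction rule: trig.induct)
      case (wave R c lam \<alpha>)
      have "\<bar>c * cos (phase R lam \<alpha> \<omega>)\<bar> \<le> \<bar>c\<bar>" for \<omega>
        using mult_left_mono[OF abs_cos_le_one[of "phase R lam \<alpha> \<omega>"], of "\<bar>c\<bar>"] by (simp add: abs_mult)
      then show ?case by blast
    next
      case (sum f g)
      then obtain B B' where "\<forall>\<omega>\<in>space M. \<bar>f \<omega>\<bar> \<le> B" "\<forall>\<omega>\<in>space M. \<bar>g \<omega>\<bar> \<le> B'" by blast
      then have "\<forall>\<omega>\<in>space M. \<bar>f \<omega> + g \<omega>\<bar> \<le> B + B'"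
        by (intro ballI order_trans[OF abs_triangle_ineq] add_mono) blast+
      then show ?case by blast
    qed
    show "(\<lambda>_. c) \<in> trig" for c
      using trig.wave[of "{}" c "\<lambda>_ _. 0" 0] by (simp add: phase_def)
    show "(\<lambda>\<omega>. \<phi> \<omega> + \<psi> \<omega>) \<in> trig" if "\<phi> \<in> trig" "\<psi> \<in> trig" for \<phi> \<psi>
      using that by (rule trig.sum)
    show "(\<lambda>\<omega>. \<phi> \<omega> * \<psi> \<omega>) \<in> trig" if "\<phi> \<in> trig" "\<psi> \<in> trig" for \<phi> \<psi>
      using that by (rule trig_mult)
  qed
qed

text \<open>The Brownian motions are limits of trigonometric polynomials: \<open>W = lim n sin (W/n)\<close>.\<close>

lemma sets_F_trig:
  "sets (F T) \<subseteq> sigma_sets (space M) {\<phi> -` B \<inter> space M |\<phi> B. \<phi> \<in> trig \<and> B \<in> sets borel}"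
proof -
  define G where "G = {\<phi> -` B \<inter> space M |\<phi> B. \<phi> \<in> trig \<and> B \<in> sets (borel :: real measure)}"
  have Gpow: "G \<subseteq> Pow (space M)" unfolding G_def by blast
  define N where "N = sigma (space M) G"
  have space_N: "space N = space M" unfolding N_def by (simp add: space_measure_of_conv)
  have sets_N: "sets N = sigma_sets (space M) G" unfolding N_def by (rule sets_measure_of[OF Gpow])
  have trigN: "\<phi> \<in> borel_measurable N" if "\<phi> \<in> trig" for \<phi>
  proof (rule measurableI)
    fix B assume "B \<in> sets (borel :: real measure)"
    then have "\<phi> -` B \<inter> space M \<in> G" unfolding G_def using that by blast
    then show "\<phi> -` B \<inter> space N \<in> sets N" unfolding space_N sets_N by (rule sigma_sets.Basic)
  qed simp
  have WN: "W a r \<in> borel_measurable N" if r: "r \<in> {0..T}" for a r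
  proof (rule borel_measurable_LIMSEQ_real)
    define lam where "lam n r b = (if b = a then 1 / real (Suc n) else 0)" for n and r :: real and b
    show "(\<lambda>\<omega>. real (Suc n) * cos (phase {r} (lam n) (- pi / 2) \<omega>)) \<in> borel_measurable N" for n
      by (rule trigN, rule trig.wave) (use r in simp_all)
    fix \<omega>
    have ph: "phase {r} (lam n) (- pi / 2) \<omega> = W a r \<omega> / real (Suc n) - pi / 2" for n
    proof -
      have "dot (lam n r) (\<lambda>b. W b r \<omega>) = (\<Sum>b\<in>UNIV. if b = a then W a r \<omega> / real (Suc n) else 0)"
        unfolding dot_def lam_def by (intro sum.cong refl) simp
      then show ?thesis unfolding phase_def by simp
    qed
    have "cos (phase {r} (lam n) (- pi / 2) \<omega>) = sin (W a r \<omega> / real (Suc n))" for n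
      unfolding ph by (simp add: cos_diff)
    moreover have "(\<lambda>n. real (Suc n) * sin (W a r \<omega> / real (Suc n))) \<longlonglongrightarrow> W a r \<omega>"
    proof (cases "W a r \<omega> = 0")
      case True
      then show ?thesis by simp
    next
      case False
      define x where "x = W a r \<omega>"
      have "((\<lambda>y. sin y / y) \<longlongrightarrow> 1) (at (0::real))"
        using DERIV_sin[of 0] unfolding has_field_derivative_iff by simp
      moreover have "filterlim (\<lambda>n. x / real (Suc n)) (at 0) sequentially"
        unfolding filterlim_at
      proof (intro conjI)
        have "(\<lambda>n. x * (1 / real (Suc n))) \<longlonglongrightarrow> x * 0"
          by (intro tendsto_intros LIMSEQ_Suc[OF lim_1_over_n])
        then show "(\<lambda>n. x / real (Suc n)) \<longlonglongrightarrow> 0" by simp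
        show "\<forall>\<^sub>F n in sequentially. x / real (Suc n) \<in> UNIV \<and> x / real (Suc n) \<noteq> 0"
          using False by (intro always_eventually) (simp add: x_def)
      qed
      ultimately have "(\<lambda>n. sin (x / real (Suc n)) / (x / real (Suc n))) \<longlonglongrightarrow> 1"
        by (rule filterlim_compose)
      then have "(\<lambda>n. x * (sin (x / real (Suc n)) / (x / real (Suc n)))) \<longlonglongrightarrow> x * 1"
        by (intro tendsto_intros)
      moreover have "x * (sin (x / real (Suc n)) / (x / real (Suc n))) = real (Suc n) * sin (x / real (Suc n))" for n
        using False unfolding x_def[symmetric] by (simp del: of_nat_Suc)
      ultimately show ?thesis unfolding x_def[symmetric] by simp
    qed
    ultimately show "(\<lambda>n. real (Suc n) * cos (phase {r} (lam n) (- pi / 2) \<omega>)) \<longlonglongrightarrow> W a r \<omega>"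
      by (simp only:)
  qed
  have "{W a s -` A \<inter> space M |a s A. 0 \<le> s \<and> s \<le> T \<and> A \<in> sets borel} \<subseteq> sets N"
  proof safe
    fix a s and A :: "real set" assume "0 \<le> s" "s \<le> T" and A: "A \<in> sets borel"
    then have "s \<in> {0..T}" by simp
    from measurable_sets[OF WN[OF this] A] show "W a s -` A \<inter> space M \<in> sets N" unfolding space_N .
  qed
  from sets.sigma_sets_subset[OF this] show ?thesis
    unfolding sets_F space_N sets_N G_def .
qed

lemma terminal_reachable:
  assumes "X \<in> borel_measurable (F T)" "integrable M (\<lambda>\<omega>. (X \<omega>)\<^sup>2)"
  shows "X \<in> reachable"
proof -
  interpret bounded_function_algebra M reachable trig by (rule trig_algebra)
  show ?thesis by (rule dense[OF space_F sets_F_trig assms])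
qed

subsection \<open>The representing integrand\<close>

lemma elem_process_progressive:
  assumes e: "elementary e"
  shows "progressively_measurable F T (elem_process e b)"
  unfolding progressively_measurable_def
proof
  fix t assume t: "t \<in> {0..T}"
  obtain a s u \<eta> where a: "e = (a, s, u, \<eta>)" by (cases e)
  have \<eta>: "\<eta> \<in> borel_measurable (F s)" using e by (simp add: elementary_def a)
  let ?N = "restrict_space borel {0..t} \<Otimes>\<^sub>M F t"
  show "(\<lambda>(r, \<omega>). elem_process e b r \<omega>) \<in> borel_measurable ?N"
  proof (cases "s \<le> t")
    case True
    have 1: "(\<lambda>z. \<eta> (snd z)) \<in> borel_measurable ?N"
      by (rule measurable_compose[OF measurable_snd measurable_F_mono[OF \<eta> True]])
    have "(\<lambda>r. indicator {s<..u} r :: real) \<in> borel_measurable (restrict_space borel {0..t})"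
      by (intro measurable_restrict_space1) simp
    from measurable_compose[OF measurable_fst this]
    have 2: "(\<lambda>z. indicator {s<..u} (fst z) :: real) \<in> borel_measurable ?N" .
    have "(\<lambda>z. if a = b then \<eta> (snd z) * indicator {s<..u} (fst z) else 0) \<in> borel_measurable ?N"
      by (cases "a = b") (simp_all add: borel_measurable_times[OF 1 2])
    moreover have "(\<lambda>(r, \<omega>). elem_process e b r \<omega>) = (\<lambda>z. if a = b then \<eta> (snd z) * indicator {s<..u} (fst z) else 0)"
      by (rule ext) (simp add: a elem_process_def split_beta)
    ultimately show ?thesis by simp
  next
    case False
    have "(\<lambda>_. 0 :: real) \<in> borel_measurable ?N" by simp
    then show ?thesis
    proof (rule measurable_cong[THEN iffD1, rotated])
      fix z assume "z \<in> space ?N"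
      then have "fst z \<le> t" by (auto simp: space_pair_measure space_restrict_space)
      then show "0 = (case z of (r, \<omega>) \<Rightarrow> elem_process e b r \<omega>)"
        using False by (simp add: a elem_process_def case_prod_beta')
    qed
  qed
qed

lemma list_process_progressive:
  assumes "\<forall>e\<in>set L. elementary e"
  shows "progressively_measurable F T (list_process L b)"
  using assms
proof (induction L)
  case Nil
  show ?case by (simp add: progressively_measurable_def)
next
  case (Cons e L)
  have 1: "progressively_measurable F T (elem_process e b)"
    using Cons.prems by (intro elem_process_progressive) simp
  have 2: "progressively_measurable F T (list_process L b)" using Cons by simp
  show ?case
    unfolding progressively_measurable_def list_process_Cons
  proof
    fix t assume t: "t \<in> {0..T}"
    from borel_measurable_add[OF 1[unfolded progressively_measurable_def, rule_format, OF t]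
        2[unfolded progressively_measurable_def, rule_format, OF t]]
    show "(\<lambda>(r, \<omega>). elem_process e b r \<omega> + list_process L b r \<omega>) \<in> borel_measurable (restrict_space borel {0..t} \<Otimes>\<^sub>M F t)"
      by (simp add: case_prod_beta')
  qed
qed

text \<open>Elementary integrals are centred, and the mean is the best constant.\<close>

lemma sqdist_centred_le:
  assumes X: "X \<in> borel_measurable M" "integrable M (\<lambda>\<omega>. (X \<omega>)\<^sup>2)" and L: "\<forall>e\<in>set L. elementary e"
  shows "sqdist M (list_integral L) (\<lambda>\<omega>. X \<omega> - expectation X) \<le> sqdist M X (\<lambda>\<omega>. c + list_integral L \<omega>)"
proof -
  define D where "D \<omega> = X \<omega> - (c + list_integral L \<omega>)" for \<omega>
  have Lm: "list_integral L \<in> borel_measurable M" by (rule list_integral_measurable(2)[OF L])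
  have L2: "integrable M (\<lambda>\<omega>. (list_integral L \<omega>)\<^sup>2)" "expectation (list_integral L) = 0"
    by (rule list_integral_square_integrable[OF L])+
  have L1: "integrable M (list_integral L)" by (rule square_integrable_imp_integrable[OF Lm L2(1)])
  have X1: "integrable M X" by (rule square_integrable_imp_integrable[OF X])
  have D1: "integrable M D" unfolding D_def[abs_def] using X1 L1 by simp
  have D2: "integrable M (\<lambda>\<omega>. (D \<omega>)\<^sup>2)"
    unfolding D_def
  proof (rule square_integrable_diff[OF X(1) affine_list_measurable[OF L] X(2)])
    show "integrable M (\<lambda>\<omega>. (c + list_integral L \<omega>)\<^sup>2)" by (intro square_integrable_add Lm L2) simp_all
  qed
  have ED: "expectation D = expectation X - c"
    unfolding D_def[abs_def] using X1 L1 L2(2) by (simp add: prob_space)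
  have DX: "list_integral L \<omega> - (X \<omega> - expectation X) = - (D \<omega> - expectation D)" for \<omega>
    unfolding ED by (simp add: D_def)
  have var: "expectation (\<lambda>\<omega>. (D \<omega> - expectation D)\<^sup>2) \<le> expectation (\<lambda>\<omega>. (D \<omega>)\<^sup>2)"
    using variance_eq[OF D1 D2] by simp
  have "integrable M (\<lambda>\<omega>. (D \<omega> - expectation D)\<^sup>2)"
    by (intro square_integrable_diff D2 borel_measurable_integrable[OF D1]) simp_all
  then have "sqdist M (list_integral L) (\<lambda>\<omega>. X \<omega> - expectation X) = ennreal (expectation (\<lambda>\<omega>. (D \<omega> - expectation D)\<^sup>2))"
    unfolding sqdist_def DX power2_minus by (intro nn_integral_eq_integral) simp_all
  also have "\<dots> \<le> ennreal (expectation (\<lambda>\<omega>. (D \<omega>)\<^sup>2))" by (rule ennreal_leI[OF var])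
  also have "\<dots> = sqdist M X (\<lambda>\<omega>. c + list_integral L \<omega>)"
    using D2 unfolding D_def by (rule sqdist_eq_integral[symmetric])
  finally show ?thesis .
qed

text \<open>The integrand is defined as a pointwise limit along a subsequence, coordinate by coordinate, so that
  progressive measurability is inherited from the elementary integrands.\<close>

theorem martingale_representation:
  assumes X: "X \<in> borel_measurable (F T)" and X2: "integrable M (\<lambda>\<omega>. (X \<omega>)\<^sup>2)"
  shows "\<exists>\<gamma>. (\<forall>a. L2_progressive (\<gamma> a)) \<and> (AE \<omega> in M. X \<omega> = expectation X + ito_sum \<gamma> \<omega>)"
proof -
  have XM: "X \<in> borel_measurable M" by (rule measurable_F_M[OF X]) (use T_pos in linarith)+
  have XcM: "(\<lambda>\<omega>. X \<omega> - expectation X) \<in> borel_measurable M" using XM by simp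
  have "\<forall>j. \<exists>p. (\<forall>e\<in>set (snd p). elementary e) \<and>
      sqdist M X (\<lambda>\<omega>. fst p + list_integral (snd p) \<omega>) \<le> ennreal (1 / real (Suc j))"
  proof
    fix j
    have "0 < 1 / real (Suc j)" by simp
    from reachableD[OF terminal_reachable[OF X X2] this]
    obtain c L where "\<forall>e\<in>set L. elementary e" "sqdist M X (\<lambda>\<omega>. c + list_integral L \<omega>) \<le> ennreal (1 / real (Suc j))"
      by blast
    then show "\<exists>p. (\<forall>e\<in>set (snd p). elementary e) \<and>
        sqdist M X (\<lambda>\<omega>. fst p + list_integral (snd p) \<omega>) \<le> ennreal (1 / real (Suc j))"
      by (intro exI[of _ "(c, L)"]) simp
  qed
  from choice[OF this] obtain p where p: "\<forall>j. (\<forall>e\<in>set (snd (p j)). elementary e) \<and>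
      sqdist M X (\<lambda>\<omega>. fst (p j) + list_integral (snd (p j)) \<omega>) \<le> ennreal (1 / real (Suc j))" by (rule exE)
  define L where "L j = snd (p j)" for j
  have el: "\<forall>e\<in>set (L j). elementary e" for j using p unfolding L_def by blast
  note LM = list_integral_measurable(2)[OF el]
  have lim: "(\<lambda>j. sqdist M (list_integral (L j)) (\<lambda>\<omega>. X \<omega> - expectation X)) \<longlonglongrightarrow> 0"
  proof (rule ennreal_tendsto_0_le)
    show "sqdist M (list_integral (L j)) (\<lambda>\<omega>. X \<omega> - expectation X) \<le> ennreal (1 / real (Suc j))" for j
      using order_trans[OF sqdist_centred_le[OF XM X2 el[of j], of "fst (p j)"]] p unfolding L_def by blast
    have "(\<lambda>j. ennreal (1 / real (Suc j))) \<longlonglongrightarrow> ennreal 0"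
      by (intro tendsto_ennrealI) (rule LIMSEQ_Suc[OF lim_1_over_n])
    then show "(\<lambda>j. ennreal (1 / real (Suc j))) \<longlonglongrightarrow> 0" by simp
  qed
  have "\<forall>b. \<exists>r. (\<lambda>n. sqdist time_space (\<lambda>z. list_process (L n) b (fst z) (snd z))
      (\<lambda>z. lim (\<lambda>k. list_process (L (r k)) b (fst z) (snd z)))) \<longlonglongrightarrow> 0"
  proof
    fix b
    have le: "sqdist time_space (\<lambda>z. list_process (L m) b (fst z) (snd z)) (\<lambda>z. list_process (L n) b (fst z) (snd z))
        \<le> sqdist M (list_integral (L m)) (list_integral (L n))" for m n
      unfolding list_isometry_sqdist[OF el el] by (rule member_le_sum) simp_all
    have "\<exists>N. \<forall>m\<ge>N. \<forall>n\<ge>N. sqdist time_space (\<lambda>z. list_process (L m) b (fst z) (snd z))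
        (\<lambda>z. list_process (L n) b (fst z) (snd z)) \<le> ennreal e" if e: "0 < e" for e :: real
    proof -
      obtain N where N: "\<forall>m\<ge>N. \<forall>n\<ge>N. sqdist M (list_integral (L m)) (list_integral (L n)) \<le> ennreal e"
        using sqdist_limit_Cauchy[OF LM XcM lim e] by (rule exE)
      show ?thesis
      proof (intro exI[of _ N] allI impI)
        fix m n assume "N \<le> m" "N \<le> n"
        then show "sqdist time_space (\<lambda>z. list_process (L m) b (fst z) (snd z))
            (\<lambda>z. list_process (L n) b (fst z) (snd z)) \<le> ennreal e"
          using N by (intro order_trans[OF le]) simp
      qed
    qed
    from sqdist_complete[of "\<lambda>n z. list_process (L n) b (fst z) (snd z)", OF list_process_measurable[OF el] this]
    show "\<exists>r. (\<lambda>n. sqdist time_space (\<lambda>z. list_process (L n) b (fst z) (snd z))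
      (\<lambda>z. lim (\<lambda>k. list_process (L (r k)) b (fst z) (snd z)))) \<longlonglongrightarrow> 0"
      by blast
  qed
  from choice[OF this] obtain r where r: "\<forall>b. (\<lambda>n. sqdist time_space (\<lambda>z. list_process (L n) b (fst z) (snd z))
      (\<lambda>z. lim (\<lambda>k. list_process (L (r b k)) b (fst z) (snd z)))) \<longlonglongrightarrow> 0" by (rule exE)
  define \<gamma> where "\<gamma> b t \<omega> = lim (\<lambda>k. list_process (L (r b k)) b t \<omega>)" for b t \<omega>
  have P: "(\<lambda>n. sqdist time_space (\<lambda>z. list_process (L n) b (fst z) (snd z)) (\<lambda>z. \<gamma> b (fst z) (snd z))) \<longlonglongrightarrow> 0" for b
    using r unfolding \<gamma>_def by (rule spec)
  have prog: "progressively_measurable F T (\<gamma> b)" for b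
    unfolding progressively_measurable_def \<gamma>_def case_prod_beta'
  proof
    fix t assume "t \<in> {0..T}"
    then show "(\<lambda>z. lim (\<lambda>k. list_process (L (r b k)) b (fst z) (snd z))) \<in> borel_measurable (restrict_space borel {0..t} \<Otimes>\<^sub>M F t)"
      using list_process_progressive[OF el] unfolding progressively_measurable_def case_prod_beta'
      by (intro borel_measurable_lim_metric) blast
  qed
  have \<gamma>m: "(\<lambda>z. \<gamma> b (fst z) (snd z)) \<in> borel_measurable time_space" for b
    by (rule progressive_time_space[OF prog])
  have \<gamma>: "L2_progressive (\<gamma> b)" for b
    unfolding L2_progressive_def
    using prog integral_square_tendsto(1)[OF list_process_measurable[OF el] \<gamma>m list_process_square_integrable[OF el] P]
    by (rule conjI)
  obtain L' where "approximates L' \<gamma>" using ito_sum_approx[of \<gamma>, OF \<gamma>] by blast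
  then have el': "\<And>j. \<forall>e\<in>set (L' j). elementary e"
    and P': "\<And>b. (\<lambda>j. sqdist time_space (\<lambda>z. list_process (L' j) b (fst z) (snd z)) (\<lambda>z. \<gamma> b (fst z) (snd z))) \<longlonglongrightarrow> 0"
    and I': "(\<lambda>j. sqdist M (list_integral (L' j)) (ito_sum \<gamma>)) \<longlonglongrightarrow> 0"
    unfolding approximates_def by blast+
  have IM: "ito_sum \<gamma> \<in> borel_measurable M" by (rule ito_sum_measurable[of \<gamma>, OF \<gamma>])
  have "(\<lambda>j. sqdist time_space (\<lambda>z. list_process (L j) b (fst z) (snd z)) (\<lambda>z. list_process (L' j) b (fst z) (snd z))) \<longlonglongrightarrow> 0" for b
  proof (rule ennreal_tendsto_0_le)
    show "sqdist time_space (\<lambda>z. list_process (L j) b (fst z) (snd z)) (\<lambda>z. list_process (L' j) b (fst z) (snd z)) \<le>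
      2 * sqdist time_space (\<lambda>z. list_process (L j) b (fst z) (snd z)) (\<lambda>z. \<gamma> b (fst z) (snd z)) +
      2 * sqdist time_space (\<lambda>z. list_process (L' j) b (fst z) (snd z)) (\<lambda>z. \<gamma> b (fst z) (snd z))" for j
    proof -
      have "sqdist time_space (\<lambda>z. list_process (L j) b (fst z) (snd z)) (\<lambda>z. list_process (L' j) b (fst z) (snd z)) \<le>
        2 * sqdist time_space (\<lambda>z. list_process (L j) b (fst z) (snd z)) (\<lambda>z. \<gamma> b (fst z) (snd z)) +
        2 * sqdist time_space (\<lambda>z. \<gamma> b (fst z) (snd z)) (\<lambda>z. list_process (L' j) b (fst z) (snd z))"
        by (rule sqdist_triangle[OF list_process_measurable[OF el] \<gamma>m list_process_measurable[OF el']])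
      also have "sqdist time_space (\<lambda>z. \<gamma> b (fst z) (snd z)) (\<lambda>z. list_process (L' j) b (fst z) (snd z)) =
        sqdist time_space (\<lambda>z. list_process (L' j) b (fst z) (snd z)) (\<lambda>z. \<gamma> b (fst z) (snd z))"
        by (rule sqdist_commute)
      finally show ?thesis .
    qed
    have "(\<lambda>j. 2 * sqdist time_space (\<lambda>z. list_process (L j) b (fst z) (snd z)) (\<lambda>z. \<gamma> b (fst z) (snd z)) +
      2 * sqdist time_space (\<lambda>z. list_process (L' j) b (fst z) (snd z)) (\<lambda>z. \<gamma> b (fst z) (snd z))) \<longlonglongrightarrow> 2 * 0 + 2 * 0"
      by (intro tendsto_intros ennreal_tendsto_cmult P P') simp_all
    then show "(\<lambda>j. 2 * sqdist time_space (\<lambda>z. list_process (L j) b (fst z) (snd z)) (\<lambda>z. \<gamma> b (fst z) (snd z)) +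
      2 * sqdist time_space (\<lambda>z. list_process (L' j) b (fst z) (snd z)) (\<lambda>z. \<gamma> b (fst z) (snd z))) \<longlonglongrightarrow> 0" by simp
  qed
  then have "(\<lambda>j. \<Sum>b\<in>UNIV. sqdist time_space (\<lambda>z. list_process (L j) b (fst z) (snd z)) (\<lambda>z. list_process (L' j) b (fst z) (snd z)))
      \<longlonglongrightarrow> (\<Sum>b\<in>(UNIV :: 'i set). 0)" by (intro tendsto_sum)
  then have LL': "(\<lambda>j. sqdist M (list_integral (L j)) (list_integral (L' j))) \<longlonglongrightarrow> 0"
    unfolding list_isometry_sqdist[OF el el'] by simp
  have "(\<lambda>j. sqdist M (list_integral (L j)) (ito_sum \<gamma>)) \<longlonglongrightarrow> 0"
  proof (rule ennreal_tendsto_0_le)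
    show "sqdist M (list_integral (L j)) (ito_sum \<gamma>) \<le>
      2 * sqdist M (list_integral (L j)) (list_integral (L' j)) + 2 * sqdist M (list_integral (L' j)) (ito_sum \<gamma>)" for j
      by (rule sqdist_triangle[OF LM list_integral_measurable(2)[OF el'] IM])
    have "(\<lambda>j. 2 * sqdist M (list_integral (L j)) (list_integral (L' j)) + 2 * sqdist M (list_integral (L' j)) (ito_sum \<gamma>)) \<longlonglongrightarrow> 2 * 0 + 2 * 0"
      by (intro tendsto_intros ennreal_tendsto_cmult LL' I') simp_all
    then show "(\<lambda>j. 2 * sqdist M (list_integral (L j)) (list_integral (L' j)) + 2 * sqdist M (list_integral (L' j)) (ito_sum \<gamma>)) \<longlonglongrightarrow> 0" by simp
  qed
  from sqdist_unique[OF LM XcM IM lim this]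
  have "AE \<omega> in M. X \<omega> = expectation X + ito_sum \<gamma> \<omega>" by eventually_elim simp
  with \<gamma> show ?thesis by blast
qed

end

section \<open>Measurability of the state\<close>

lemma integral_exp_Icc:
  fixes K t :: real
  assumes "0 < K" "0 \<le> t"
  shows "integrable lborel (\<lambda>s. exp (2 * K * s) * indicator {0..t} s)"
    and "(\<integral>s. exp (2 * K * s) * indicator {0..t} s \<partial>lborel) = (exp (2 * K * t) - 1) / (2 * K)"
proof -
  have D: "DERIV (\<lambda>s. exp (2 * K * s) / (2 * K)) s :> exp (2 * K * s)" for s
    using assms by (auto intro!: derivative_eq_intros)
  have C: "isCont (\<lambda>s. exp (2 * K * s)) s" for s by (intro continuous_intros)
  have "has_bochner_integral lborel (\<lambda>s. exp (2 * K * s) * indicator {0..t} s)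
      (exp (2 * K * t) / (2 * K) - exp (2 * K * 0) / (2 * K))"
    by (rule has_bochner_integral_FTC_Icc_real[OF assms(2) D C])
  then show "integrable lborel (\<lambda>s. exp (2 * K * s) * indicator {0..t} s)"
    "(\<integral>s. exp (2 * K * s) * indicator {0..t} s \<partial>lborel) = (exp (2 * K * t) - 1) / (2 * K)"
    by (auto simp: has_bochner_integral_iff diff_divide_distrib)
qed

text \<open>One Picard step halves errors measured in the norm weighted by \<open>exp (- 2Kt)\<close>.\<close>

lemma picard_step:
  fixes K t :: real
  assumes K: "0 < K" and t: "0 \<le> t" "t \<le> T"
    and d: "integrable (restrict_space lborel {0..T}) d"
    and bound: "\<And>s. s \<in> {0..T} \<Longrightarrow> \<bar>d s\<bar> \<le> K * (c * exp (2 * K * s))" and c: "0 \<le> c"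
  shows "\<bar>\<integral>s. indicator {..t} s * d s \<partial>restrict_space lborel {0..T}\<bar> \<le> c / 2 * exp (2 * K * t)"
proof -
  have ed: "(\<integral>s. indicator {..t} s * \<bar>d s\<bar> \<partial>restrict_space lborel {0..T}) =
      (\<integral>s. indicator {0..T} s *\<^sub>R (indicator {..t} s * \<bar>d s\<bar>) \<partial>lborel)"
    by (rule integral_restrict_space) simp
  have di: "integrable lborel (\<lambda>s. indicator {0..T} s *\<^sub>R (indicator {..t} s * \<bar>d s\<bar>))"
  proof -
    have "integrable (restrict_space lborel {0..T}) (\<lambda>s. indicator {..t} s * \<bar>d s\<bar>)"
    proof (rule Bochner_Integration.integrable_bound[OF d])
      have "(\<lambda>s. indicator {..t} s :: real) \<in> borel_measurable (restrict_space lborel {0..T})"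
        by (intro measurable_restrict_space1) simp
      then show "(\<lambda>s. indicator {..t} s * \<bar>d s\<bar>) \<in> borel_measurable (restrict_space lborel {0..T})"
        using d by (intro borel_measurable_times borel_measurable_abs) simp_all
    qed (simp add: indicator_def)
    then show ?thesis by (subst (asm) integrable_restrict_space) simp_all
  qed
  have "\<bar>\<integral>s. indicator {..t} s * d s \<partial>restrict_space lborel {0..T}\<bar>
      \<le> (\<integral>s. \<bar>indicator {..t} s * d s\<bar> \<partial>restrict_space lborel {0..T})"
    by (rule integral_abs_bound)
  also have "\<dots> = (\<integral>s. indicator {0..T} s *\<^sub>R (indicator {..t} s * \<bar>d s\<bar>) \<partial>lborel)"
    by (simp add: abs_mult ed)
  also have "\<dots> \<le> (\<integral>s. (K * c) * (exp (2 * K * s) * indicator {0..t} s) \<partial>lborel)"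
  proof (rule integral_mono[OF di])
    show "integrable lborel (\<lambda>s. (K * c) * (exp (2 * K * s) * indicator {0..t} s))"
      using integral_exp_Icc(1)[OF K t(1)] by simp
    show "indicator {0..T} s *\<^sub>R (indicator {..t} s * \<bar>d s\<bar>) \<le> (K * c) * (exp (2 * K * s) * indicator {0..t} s)" for s
      using bound[of s] t by (cases "s \<in> {0..t}") (auto simp: indicator_def mult.assoc)
  qed
  also have "\<dots> = (K * c) * ((exp (2 * K * t) - 1) / (2 * K))"
    using integral_exp_Icc(2)[OF K t(1)] by simp
  also have "\<dots> = c / 2 * (exp (2 * K * t) - 1)" using K by simp
  also have "\<dots> \<le> c / 2 * exp (2 * K * t)" using c by (intro mult_left_mono) simp_all
  finally show ?thesis .
qed

text \<open>The Picard iterates are jointly measurable by Fubini's theorem and converge to the solution at every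
  point. The set \<open>V\<close> restricts the coefficient to
  where it is measurable.\<close>

lemma integral_equation_measurable:
  fixes f :: "real \<Rightarrow> real \<Rightarrow> real" and u x :: "real \<Rightarrow> 'a \<Rightarrow> real"
  assumes T: "0 < T" and K: "0 < K"
    and fU: "(\<lambda>z. indicator V z * f (fst z) (snd z)) \<in> borel_measurable (borel :: (real \<times> real) measure)"
    and um: "(\<lambda>z. u (fst z) (snd z)) \<in> borel_measurable (restrict_space borel {0..T} \<Otimes>\<^sub>M N)"
    and uV: "\<And>t \<omega> y. t \<in> {0..T} \<Longrightarrow> \<omega> \<in> space N \<Longrightarrow> (y, u t \<omega>) \<in> V"
    and lip: "\<And>t \<omega> y y'. t \<in> {0..T} \<Longrightarrow> \<omega> \<in> space N \<Longrightarrow> \<bar>f y (u t \<omega>) - f y' (u t \<omega>)\<bar> \<le> K * \<bar>y - y'\<bar>"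
    and sol_int: "\<And>\<omega>. \<omega> \<in> space N \<Longrightarrow> integrable (restrict_space lborel {0..T}) (\<lambda>s. f (x s \<omega>) (u s \<omega>))"
    and sol: "\<And>\<omega> t. \<omega> \<in> space N \<Longrightarrow> t \<in> {0..T} \<Longrightarrow>
      x t \<omega> = x0 + (\<integral>s. indicator {..t} s * f (x s \<omega>) (u s \<omega>) \<partial>restrict_space lborel {0..T})"
  shows "(\<lambda>z. x (fst z) (snd z)) \<in> borel_measurable (restrict_space borel {0..T} \<Otimes>\<^sub>M N)"
proof -
  let ?L = "restrict_space lborel {0..T}"
  let ?R = "restrict_space borel {0..T} \<Otimes>\<^sub>M N"
  interpret L: finite_measure ?L
    using T by (intro finite_measureI) (simp add: emeasure_restrict_space space_restrict_space)
  have space_R: "space ?R = {0..T} \<times> space N" by (simp add: space_pair_measure space_restrict_space)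
  define X where "X = rec_nat (\<lambda>t \<omega>. x0) (\<lambda>_ Y t \<omega>. x0 + (\<integral>s. indicator {..t} s * f (Y s \<omega>) (u s \<omega>) \<partial>?L))"
  have X0: "X 0 t \<omega> = x0" for t \<omega> by (simp add: X_def)
  have XS: "X (Suc k) t \<omega> = x0 + (\<integral>s. indicator {..t} s * f (X k s \<omega>) (u s \<omega>) \<partial>?L)" for k t \<omega>
    by (simp add: X_def)
  have drift: "(\<lambda>z. f (Y (fst z) (snd z)) (u (fst z) (snd z))) \<in> borel_measurable ?R"
    if Y: "(\<lambda>z. Y (fst z) (snd z)) \<in> borel_measurable ?R" for Y
  proof -
    have "(\<lambda>z. (Y (fst z) (snd z), u (fst z) (snd z))) \<in> borel_measurable ?R"
      by (rule borel_measurable_Pair[OF Y um])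
    from measurable_compose[OF this fU]
    have "(\<lambda>z. indicator V (Y (fst z) (snd z), u (fst z) (snd z)) * f (Y (fst z) (snd z)) (u (fst z) (snd z))) \<in> borel_measurable ?R"
      by simp
    then show ?thesis
    proof (rule measurable_cong[THEN iffD1, rotated])
      fix z assume "z \<in> space ?R"
      then have "(Y (fst z) (snd z), u (fst z) (snd z)) \<in> V" unfolding space_R by (intro uV) auto
      then show "indicator V (Y (fst z) (snd z), u (fst z) (snd z)) * f (Y (fst z) (snd z)) (u (fst z) (snd z)) =
          f (Y (fst z) (snd z)) (u (fst z) (snd z))" by simp
    qed
  qed
  have LB: "(\<lambda>s. s) \<in> measurable ?L (restrict_space borel {0..T})"
    by (intro measurable_ident_sets sets_restrict_space_cong) simp
  have Xm: "(\<lambda>z. X k (fst z) (snd z)) \<in> borel_measurable ?R" for k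
  proof (induction k)
    case 0
    show ?case by (simp add: X0)
  next
    case (Suc k)
    have swap: "(\<lambda>p. (snd p, snd (fst p))) \<in> measurable (?R \<Otimes>\<^sub>M ?L) ?R"
    proof (rule measurable_Pair)
      show "snd \<in> measurable (?R \<Otimes>\<^sub>M ?L) (restrict_space borel {0..T})"
        using measurable_compose[OF measurable_snd[of ?R ?L] LB] by simp
      show "(\<lambda>p. snd (fst p)) \<in> measurable (?R \<Otimes>\<^sub>M ?L) N"
        by (rule measurable_compose[OF measurable_fst measurable_snd])
    qed
    have 1: "(\<lambda>p. f (X k (snd p) (snd (fst p))) (u (snd p) (snd (fst p)))) \<in> borel_measurable (?R \<Otimes>\<^sub>M ?L)"
      using measurable_compose[OF swap drift[OF Suc]] by simp
    have b: "(\<lambda>s. s) \<in> borel_measurable (restrict_space borel {0..T})" by (intro measurable_restrict_space1) simp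
    have bL: "(\<lambda>s. s) \<in> borel_measurable ?L" by (intro measurable_restrict_space1) simp
    have [measurable]: "(\<lambda>p. fst (fst p)) \<in> borel_measurable (?R \<Otimes>\<^sub>M ?L)"
      using measurable_compose[OF measurable_fst[of ?R ?L] measurable_compose[OF measurable_fst[of _ N] b]] by simp
    have [measurable]: "snd \<in> borel_measurable (?R \<Otimes>\<^sub>M ?L)"
      using measurable_compose[OF measurable_snd[of ?R ?L] bL] by simp
    have "(\<lambda>p. indicator {p. snd p \<le> fst (fst p)} p :: real) \<in> borel_measurable (?R \<Otimes>\<^sub>M ?L)"
      by measurable
    then have 2: "(\<lambda>p. indicator {..fst (fst p)} (snd p) :: real) \<in> borel_measurable (?R \<Otimes>\<^sub>M ?L)"
      by (simp add: indicator_def)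
    have "(\<lambda>(z, s). indicator {..fst z} s * f (X k s (snd z)) (u s (snd z))) \<in> borel_measurable (?R \<Otimes>\<^sub>M ?L)"
      using borel_measurable_times[OF 2 1] by (simp add: case_prod_beta')
    from L.borel_measurable_lebesgue_integral[OF this]
    have "(\<lambda>z. x0 + (\<integral>s. indicator {..fst z} s * f (X k s (snd z)) (u s (snd z)) \<partial>?L)) \<in> borel_measurable ?R"
      by (intro borel_measurable_add borel_measurable_const)
    then show ?case by (simp only: XS)
  qed
  have conv: "(\<lambda>k. X k t \<omega>) \<longlonglongrightarrow> x t \<omega>" if t: "t \<in> {0..T}" and \<omega>: "\<omega> \<in> space N" for t \<omega>
  proof -
    define c where "c = (\<integral>s. \<bar>f (x s \<omega>) (u s \<omega>)\<bar> \<partial>?L)"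
    have c: "0 \<le> c" unfolding c_def by simp
    note G = sol_int[OF \<omega>]
    have indm: "(\<lambda>s. indicator {..t} s :: real) \<in> borel_measurable ?L" for t
      by (intro measurable_restrict_space1) simp
    have Gt: "integrable ?L (\<lambda>s. indicator {..t} s * g s)" if "integrable ?L g" for t and g :: "real \<Rightarrow> real"
    proof (rule Bochner_Integration.integrable_bound[OF that])
      show "(\<lambda>s. indicator {..t} s * g s) \<in> borel_measurable ?L"
        by (intro borel_measurable_times indm borel_measurable_integrable that)
    qed (simp add: indicator_def)
    have est: "\<bar>X k t \<omega> - x t \<omega>\<bar> \<le> c / 2 ^ k * exp (2 * K * t)" if "t \<in> {0..T}" for k t
      using that
    proof (induction k arbitrary: t)
      case 0
      have "\<bar>X 0 t \<omega> - x t \<omega>\<bar> = \<bar>\<integral>s. indicator {..t} s * f (x s \<omega>) (u s \<omega>) \<partial>?L\<bar>"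
        unfolding X0 sol[OF \<omega> 0] by simp
      also have "\<dots> \<le> (\<integral>s. \<bar>indicator {..t} s * f (x s \<omega>) (u s \<omega>)\<bar> \<partial>?L)" by (rule integral_abs_bound)
      also have "\<dots> \<le> c"
        unfolding c_def by (intro integral_mono integrable_abs Gt G) (simp add: indicator_def)
      also have "\<dots> \<le> c * exp (2 * K * t)"
      proof -
        have "1 \<le> exp (2 * K * t)" using K 0 by simp
        from mult_left_mono[OF this c] show ?thesis by simp
      qed
      finally show ?case by simp
    next
      case (Suc k)
      define d where "d s = f (X k s \<omega>) (u s \<omega>) - f (x s \<omega>) (u s \<omega>)" for s
      have db: "\<bar>d s\<bar> \<le> K * (c / 2 ^ k * exp (2 * K * s))" if s: "s \<in> {0..T}" for s
        using order_trans[OF lip[OF s \<omega>] mult_left_mono[OF Suc.IH[OF s]]] K unfolding d_def by simp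
      have path: "(\<lambda>s. (s, \<omega>)) \<in> measurable ?L ?R"
        by (rule measurable_Pair[OF LB measurable_const[OF \<omega>]])
      have fm: "(\<lambda>s. f (X k s \<omega>) (u s \<omega>)) \<in> borel_measurable ?L"
        using measurable_compose[OF path drift[OF Xm[of k]]] by simp
      have dm: "d \<in> borel_measurable ?L"
        unfolding d_def[abs_def] by (intro borel_measurable_diff fm borel_measurable_integrable[OF G])
      have di: "integrable ?L d"
      proof (rule L.integrable_const_bound[OF _ dm, of "K * (c / 2 ^ k * exp (2 * K * T))"], rule AE_I2)
        fix s assume "s \<in> space ?L"
        then have s: "s \<in> {0..T}" by (simp add: space_restrict_space)
        have "K * (c / 2 ^ k * exp (2 * K * s)) \<le> K * (c / 2 ^ k * exp (2 * K * T))"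
          using K c s by (intro mult_left_mono) simp_all
        then show "norm (d s) \<le> K * (c / 2 ^ k * exp (2 * K * T))" using db[OF s] by simp
      qed
      have fi: "integrable ?L (\<lambda>s. f (X k s \<omega>) (u s \<omega>))"
        using Bochner_Integration.integrable_add[OF di G] by (simp add: d_def)
      have "X (Suc k) t \<omega> - x t \<omega> = (\<integral>s. indicator {..t} s * f (X k s \<omega>) (u s \<omega>) \<partial>?L)
          - (\<integral>s. indicator {..t} s * f (x s \<omega>) (u s \<omega>) \<partial>?L)"
        unfolding XS sol[OF \<omega> Suc.prems] by simp
      also have "\<dots> = (\<integral>s. indicator {..t} s * d s \<partial>?L)"
        unfolding d_def right_diff_distrib by (rule Bochner_Integration.integral_diff[OF Gt[OF fi] Gt[OF G], symmetric])
      finally have "\<bar>X (Suc k) t \<omega> - x t \<omega>\<bar> = \<bar>\<integral>s. indicator {..t} s * d s \<partial>?L\<bar>" by simp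
      also have "\<dots> \<le> (c / 2 ^ k) / 2 * exp (2 * K * t)"
        using Suc.prems c by (intro picard_step[OF K _ _ di db]) simp_all
      finally show ?case by (simp add: mult.commute)
    qed
    have "(\<lambda>k. c * exp (2 * K * t) * (1 / 2) ^ k) \<longlonglongrightarrow> c * exp (2 * K * t) * 0"
      by (intro tendsto_intros LIMSEQ_realpow_zero) simp_all
    then have "(\<lambda>k. c / 2 ^ k * exp (2 * K * t)) \<longlonglongrightarrow> 0" by (simp add: power_one_over field_simps)
    then have "(\<lambda>k. X k t \<omega> - x t \<omega>) \<longlonglongrightarrow> 0"
      by (rule Lim_null_comparison[rotated]) (use est[OF t] in simp)
    then show ?thesis by (simp add: LIM_zero_iff)
  qed
  show ?thesis
  proof (rule borel_measurable_LIMSEQ_real[where u="\<lambda>k z. X k (fst z) (snd z)"])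
    fix z assume "z \<in> space ?R"
    then show "(\<lambda>k. X k (fst z) (snd z)) \<longlonglongrightarrow> x (fst z) (snd z)" unfolding space_R by (intro conv) auto
  qed (rule Xm)
qed

section \<open>The risk-limiting condition\<close>

lemma (in prob_space) indep_sets_reindex:
  assumes inj: "inj_on h J" and G: "indep_sets G (h ` J)"
  shows "indep_sets (\<lambda>j. G (h j)) J"
proof (rule indep_setsI)
  show "G (h j) \<subseteq> events" if "j \<in> J" for j using G that unfolding indep_sets_def by blast
  fix A J' assume J': "J' \<noteq> {}" "J' \<subseteq> J" "finite J'" and A: "\<forall>j\<in>J'. A j \<in> G (h j)"
  have inj': "inj_on h J'" by (rule inj_on_subset[OF inj J'(2)])
  define A' where "A' i = A (the_inv_into J' h i)" for i
  have A': "A' (h j) = A j" if "j \<in> J'" for j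
    unfolding A'_def by (simp add: the_inv_into_f_f[OF inj' that])
  have "(\<Inter>j\<in>J'. A j) = (\<Inter>i\<in>h ` J'. A' i)" using A' by simp
  then have "prob (\<Inter>j\<in>J'. A j) = prob (\<Inter>i\<in>h ` J'. A' i)" by simp
  also have "\<dots> = (\<Prod>i\<in>h ` J'. prob (A' i))"
  proof (rule indep_setsD[OF G])
    show "h ` J' \<subseteq> h ` J" using J'(2) by blast
    show "\<forall>i\<in>h ` J'. A' i \<in> G i" using A A' by simp
  qed (use J' in simp_all)
  also have "\<dots> = (\<Prod>j\<in>J'. prob (A j))" by (simp add: prod.reindex[OF inj'] A')
  finally show "prob (\<Inter>j\<in>J'. A j) = (\<Prod>j\<in>J'. prob (A j))" .
qed

lemma independent_processes_reindex:
  assumes M: "prob_space M" and inj: "inj_on h J" and hJ: "h ` J \<subseteq> I"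
    and W: "independent_processes M T I W"
  shows "independent_processes M T J (\<lambda>j. W (h j))"
proof -
  interpret prob_space M by (rule M)
  have W': "indep_vars (\<lambda>_. PiM {0..T} (\<lambda>_. borel)) (\<lambda>i \<omega>. \<lambda>t\<in>{0..T}. W i t \<omega>) (h ` J)"
    by (rule indep_vars_subset[OF W[unfolded independent_processes_def] hJ])
  then show ?thesis
    unfolding independent_processes_def indep_vars_def
    using indep_sets_reindex[OF inj] by auto
qed

lemma sets_natural_filtration_pair:
  fixes X Y :: "real \<Rightarrow> 'a \<Rightarrow> real"
  shows "sets (natural_filtration M (\<lambda>t \<omega>. (X t \<omega>, Y t \<omega>)) t) =
    sigma_sets (space M) {(if b then Y else X) s -` A \<inter> space M |(b :: bool) s A. 0 \<le> s \<and> s \<le> t \<and> A \<in> sets borel}"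
    (is "?N = sigma_sets _ ?G")
proof -
  let ?P = "{(\<lambda>\<omega>. (X s \<omega>, Y s \<omega>)) -` A \<inter> space M |s A. 0 \<le> s \<and> s \<le> t \<and> A \<in> sets borel}"
  have P: "?P \<subseteq> Pow (space M)" by blast
  have N: "?N = sigma_sets (space M) ?P" unfolding natural_filtration_def by (rule sets_measure_of[OF P])
  have G: "?G \<subseteq> Pow (space M)" by blast
  define \<G> where "\<G> = sigma (space M) ?G"
  have space_G: "space \<G> = space M" unfolding \<G>_def by (simp add: space_measure_of_conv)
  have sets_G: "sets \<G> = sigma_sets (space M) ?G" unfolding \<G>_def by (rule sets_measure_of[OF G])
  have comp: "(if b then Y else X) s \<in> borel_measurable \<G>" if s: "0 \<le> s" "s \<le> t" for b s
  proof (rule measurableI)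
    fix A assume "A \<in> sets (borel :: real measure)"
    then have "(if b then Y else X) s -` A \<inter> space M \<in> ?G" using s by blast
    then show "(if b then Y else X) s -` A \<inter> space \<G> \<in> sets \<G>"
      unfolding space_G sets_G by (rule sigma_sets.Basic)
  qed simp
  have "?P \<subseteq> sets \<G>"
  proof safe
    fix s and A :: "(real \<times> real) set" assume s: "0 \<le> s" "s \<le> t" and A: "A \<in> sets borel"
    have "(\<lambda>\<omega>. (X s \<omega>, Y s \<omega>)) \<in> borel_measurable \<G>"
      using comp[OF s, of False] comp[OF s, of True] by (intro borel_measurable_Pair) simp_all
    from measurable_sets[OF this A] show "(\<lambda>\<omega>. (X s \<omega>, Y s \<omega>)) -` A \<inter> space M \<in> sets \<G>" unfolding space_G .
  qed
  from sets.sigma_sets_subset[OF this] have "?N \<subseteq> sigma_sets (space M) ?G" unfolding N space_G sets_G .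
  moreover have "sigma_sets (space M) ?G \<subseteq> ?N"
    unfolding N
  proof (rule sigma_sets_mono, safe)
    fix b s and A :: "real set" assume s: "0 \<le> s" "s \<le> t" and A: "A \<in> sets borel"
    define A' where "A' = (if b then UNIV \<times> A else A \<times> UNIV)"
    have "A' \<in> sets borel" unfolding A'_def using A by (auto intro!: borel_Times)
    moreover have "(if b then Y else X) s -` A \<inter> space M = (\<lambda>\<omega>. (X s \<omega>, Y s \<omega>)) -` A' \<inter> space M"
      unfolding A'_def by auto
    ultimately show "(if b then Y else X) s -` A \<inter> space M \<in> sigma_sets (space M) ?P"
      using s by (intro sigma_sets.Basic CollectI exI[of _ s] exI[of _ A']) simp
  qed
  ultimately show ?thesis by (rule equalityI)
qed

text \<open>Coordinates of a two-dimensional process, indexed so that \<open>False\<close> belongs to the common noise and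
  \<open>True\<close> to the agent's own.\<close>

definition component :: "(real \<Rightarrow> 'a \<Rightarrow> real \<times> real) \<Rightarrow> bool \<Rightarrow> real \<Rightarrow> 'a \<Rightarrow> real" where
  "component \<gamma> b = (\<lambda>t \<omega>. if b then snd (\<gamma> t \<omega>) else fst (\<gamma> t \<omega>))"

lemma norm_pair_square: "(norm p)\<^sup>2 = (fst p)\<^sup>2 + (snd p)\<^sup>2" for p :: "real \<times> real"
  by (cases p) (simp add: norm_prod_def)

lemma progressive_pair_iff:
  "progressively_measurable F T (\<gamma> :: real \<Rightarrow> 'a \<Rightarrow> real \<times> real) \<longleftrightarrow> (\<forall>b. progressively_measurable F T (component \<gamma> b))"
proof
  assume \<gamma>: "progressively_measurable F T \<gamma>"
  show "\<forall>b. progressively_measurable F T (component \<gamma> b)"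
    unfolding progressively_measurable_def
  proof (intro allI ballI)
    fix b t assume "t \<in> {0..T}"
    then have m: "(\<lambda>z. \<gamma> (fst z) (snd z)) \<in> borel_measurable (restrict_space borel {0..t} \<Otimes>\<^sub>M F t)"
      using \<gamma> unfolding progressively_measurable_def case_prod_beta' by blast
    have 1: "(fst :: real \<times> real \<Rightarrow> real) \<in> borel_measurable borel" "(snd :: real \<times> real \<Rightarrow> real) \<in> borel_measurable borel"
      by (intro borel_measurable_continuous_onI continuous_intros)+
    show "(\<lambda>(s, \<omega>). component \<gamma> b s \<omega>) \<in> borel_measurable (restrict_space borel {0..t} \<Otimes>\<^sub>M F t)"
      unfolding component_def case_prod_beta'
      using measurable_compose[OF m 1(1)] measurable_compose[OF m 1(2)] by (cases b) simp_all
  qed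
next
  assume \<gamma>: "\<forall>b. progressively_measurable F T (component \<gamma> b)"
  show "progressively_measurable F T \<gamma>"
    unfolding progressively_measurable_def
  proof
    fix t assume t: "t \<in> {0..T}"
    have c: "(\<lambda>z. component \<gamma> b (fst z) (snd z)) \<in> borel_measurable (restrict_space borel {0..t} \<Otimes>\<^sub>M F t)" for b
      using \<gamma> t unfolding progressively_measurable_def case_prod_beta' by blast
    show "(\<lambda>(s, \<omega>). \<gamma> s \<omega>) \<in> borel_measurable (restrict_space borel {0..t} \<Otimes>\<^sub>M F t)"
      using borel_measurable_Pair[OF c[of False] c[of True]] by (simp add: component_def case_prod_beta')
  qed
qed

context brownian_family begin

lemma iterated_nn_integral:
  assumes "f \<in> borel_measurable time_space"
  shows "(\<integral>\<^sup>+\<omega>. (\<integral>\<^sup>+t\<in>{0..T}. f (t, \<omega>) \<partial>lborel) \<partial>M) = (\<integral>\<^sup>+z. f z \<partial>time_space)"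
proof -
  interpret PS: pair_sigma_finite "restrict_space lborel {0..T}" M by (rule pair_sigma_finite_time_space)
  have "(\<integral>\<^sup>+\<omega>. (\<integral>\<^sup>+t\<in>{0..T}. f (t, \<omega>) \<partial>lborel) \<partial>M) = (\<integral>\<^sup>+\<omega>. (\<integral>\<^sup>+t. f (t, \<omega>) \<partial>restrict_space lborel {0..T}) \<partial>M)"
    by (intro nn_integral_cong nn_integral_restrict_space[symmetric]) simp
  also have "\<dots> = (\<integral>\<^sup>+z. f z \<partial>time_space)"
    using assms unfolding time_space_def by (rule PS.nn_integral_snd)
  finally show ?thesis .
qed

lemma iterated_integral:
  fixes f :: "real \<times> 'a \<Rightarrow> real"
  assumes "integrable time_space f"
  shows "expectation (\<lambda>\<omega>. LBINT t:{0..T}. f (t, \<omega>)) = (\<integral>z. f z \<partial>time_space)"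
proof -
  interpret PS: pair_sigma_finite "restrict_space lborel {0..T}" M by (rule pair_sigma_finite_time_space)
  have "expectation (\<lambda>\<omega>. LBINT t:{0..T}. f (t, \<omega>)) = expectation (\<lambda>\<omega>. \<integral>t. f (t, \<omega>) \<partial>restrict_space lborel {0..T})"
    unfolding set_lebesgue_integral_def
    by (intro Bochner_Integration.integral_cong refl integral_restrict_space[symmetric]) simp
  also have "\<dots> = (\<integral>z. f z \<partial>time_space)"
    using PS.integral_snd[of "\<lambda>t \<omega>. f (t, \<omega>)"] assms unfolding time_space_def by simp
  finally show ?thesis .
qed

end

lemma square_integrable_processes_iff:
  assumes "brownian_family M T F (W :: bool \<Rightarrow> real \<Rightarrow> 'a \<Rightarrow> real)"
  shows "\<gamma> \<in> square_integrable_processes M F T \<longleftrightarrow> (\<forall>b. brownian_family.L2_progressive M T F (component \<gamma> b))"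
proof -
  interpret brownian_family M T F W by (rule assms)
  show ?thesis
  proof (cases "\<forall>b. progressively_measurable F T (component \<gamma> b)")
    case False
    then show ?thesis
      unfolding square_integrable_processes_def L2_progressive_def mem_Collect_eq progressive_pair_iff by blast
  next
    case True
    have cm: "(\<lambda>z. component \<gamma> b (fst z) (snd z)) \<in> borel_measurable time_space" for b
      using True by (intro progressive_time_space) blast
    have pt: "ennreal ((norm (\<gamma> t \<omega>))\<^sup>2) =
        ennreal ((component \<gamma> False t \<omega>)\<^sup>2) + ennreal ((component \<gamma> True t \<omega>)\<^sup>2)" for t \<omega>
      unfolding norm_pair_square component_def by (simp add: ennreal_plus)
    have nm: "(\<lambda>z. ennreal ((norm (\<gamma> (fst z) (snd z)))\<^sup>2)) \<in> borel_measurable time_space"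
      unfolding pt using cm by measurable
    have "(\<integral>\<^sup>+\<omega>. (\<integral>\<^sup>+t\<in>{0..T}. ennreal ((norm (\<gamma> t \<omega>))\<^sup>2) \<partial>lborel) \<partial>M) =
        (\<integral>\<^sup>+z. ennreal ((component \<gamma> False (fst z) (snd z))\<^sup>2) \<partial>time_space) +
        (\<integral>\<^sup>+z. ennreal ((component \<gamma> True (fst z) (snd z))\<^sup>2) \<partial>time_space)"
      using iterated_nn_integral[OF nm] cm unfolding pt by (simp add: nn_integral_add)
    moreover have "(\<integral>\<^sup>+z. ennreal ((component \<gamma> b (fst z) (snd z))\<^sup>2) \<partial>time_space) < \<infinity> \<longleftrightarrow>
        integrable time_space (\<lambda>z. (component \<gamma> b (fst z) (snd z))\<^sup>2)" for b
      using cm[of b] unfolding integrable_iff_bounded by simp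
    ultimately show ?thesis
      using True unfolding square_integrable_processes_def L2_progressive_def mem_Collect_eq progressive_pair_iff
      by (simp add: all_bool_eq) (metis (full_types))
  qed
qed

lemma expectation_norm_square:
  assumes BF: "brownian_family M T F (W :: bool \<Rightarrow> real \<Rightarrow> 'a \<Rightarrow> real)"
    and \<gamma>: "\<And>b. brownian_family.L2_progressive M T F (component \<gamma> b)"
  shows "prob_space.expectation M (\<lambda>\<omega>. LBINT t:{0..T}. (norm (\<gamma> t \<omega>))\<^sup>2) =
    prob_space.expectation M (\<lambda>\<omega>. (brownian_family.ito_sum M T F W (component \<gamma>) \<omega>)\<^sup>2)"
proof -
  interpret brownian_family M T F W by (rule BF)
  have i: "integrable time_space (\<lambda>z. (component \<gamma> b (fst z) (snd z))\<^sup>2)" for b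
    using \<gamma>[of b] unfolding L2_progressive_def by (rule conjunct2)
  have pt: "(norm (\<gamma> t \<omega>))\<^sup>2 = (component \<gamma> False t \<omega>)\<^sup>2 + (component \<gamma> True t \<omega>)\<^sup>2" for t \<omega>
    unfolding norm_pair_square component_def by simp
  have "expectation (\<lambda>\<omega>. LBINT t:{0..T}. (norm (\<gamma> t \<omega>))\<^sup>2) =
      (\<integral>z. (component \<gamma> False (fst z) (snd z))\<^sup>2 + (component \<gamma> True (fst z) (snd z))\<^sup>2 \<partial>time_space)"
    using iterated_integral[OF Bochner_Integration.integrable_add[OF i[of False] i[of True]]] unfolding pt by simp
  also have "\<dots> = (\<Sum>b\<in>UNIV. \<integral>z. (component \<gamma> b (fst z) (snd z))\<^sup>2 \<partial>time_space)"
    using i by (simp add: UNIV_bool)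
  also have "\<dots> = expectation (\<lambda>\<omega>. (ito_sum (component \<gamma>) \<omega>)\<^sup>2)"
    by (rule ito_sum_isometry(2)[of "component \<gamma>", OF \<gamma>, symmetric])
  finally show ?thesis .
qed

lemma ito_sum_eq_imp_AE_eq:
  assumes BF: "brownian_family M T F (W :: bool \<Rightarrow> real \<Rightarrow> 'a \<Rightarrow> real)"
    and \<gamma>: "\<And>b. brownian_family.L2_progressive M T F (component \<gamma> b)"
    and \<gamma>': "\<And>b. brownian_family.L2_progressive M T F (component \<gamma>' b)"
    and eq: "AE \<omega> in M. brownian_family.ito_sum M T F W (component \<gamma>) \<omega> = brownian_family.ito_sum M T F W (component \<gamma>') \<omega>"
  shows "AE (t, \<omega>) in restrict_space lborel {0..T} \<Otimes>\<^sub>M M. \<gamma> t \<omega> = \<gamma>' t \<omega>"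
proof -
  interpret brownian_family M T F W by (rule BF)
  let ?d = "\<lambda>b z. component \<gamma> b (fst z) (snd z) - component \<gamma>' b (fst z) (snd z)"
  have m: "(\<lambda>z. component \<gamma> b (fst z) (snd z)) \<in> borel_measurable time_space"
    "(\<lambda>z. component \<gamma>' b (fst z) (snd z)) \<in> borel_measurable time_space" for b
    using \<gamma>[of b] \<gamma>'[of b] unfolding L2_progressive_def by (blast intro: progressive_time_space)+
  have i: "integrable time_space (\<lambda>z. (?d b z)\<^sup>2)" for b
    using \<gamma>[of b] \<gamma>'[of b] m[of b] unfolding L2_progressive_def by (intro square_integrable_diff) blast+
  have "(\<Sum>b\<in>UNIV. \<integral>z. (?d b z)\<^sup>2 \<partial>time_space) = expectation (\<lambda>\<omega>. (ito_sum (component \<gamma>) \<omega> - ito_sum (component \<gamma>') \<omega>)\<^sup>2)"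
    by (rule ito_sum_diff_isometry[of "component \<gamma>" "component \<gamma>'", OF \<gamma> \<gamma>', symmetric])
  also have "\<dots> = expectation (\<lambda>_. 0)"
    by (rule integral_cong_AE)
      (use eq ito_sum_measurable[of "component \<gamma>", OF \<gamma>] ito_sum_measurable[of "component \<gamma>'", OF \<gamma>'] in \<open>auto elim!: eventually_mono\<close>)
  finally have "(\<Sum>b\<in>UNIV. \<integral>z. (?d b z)\<^sup>2 \<partial>time_space) = 0" by simp
  then have zero: "(\<integral>z. (?d b z)\<^sup>2 \<partial>time_space) = 0" for b
    by (subst (asm) sum_nonneg_eq_0_iff) simp_all
  have "AE z in time_space. (?d b z)\<^sup>2 = 0" for b
    using integral_nonneg_eq_0_iff_AE[OF i[of b]] zero[of b] by simp
  then have "AE z in time_space. (?d False z)\<^sup>2 = 0 \<and> (?d True z)\<^sup>2 = 0" by (intro AE_conjI)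
  then have "AE z in time_space. \<gamma> (fst z) (snd z) = \<gamma>' (fst z) (snd z)"
    by eventually_elim (simp add: component_def prod_eq_iff)
  then show ?thesis unfolding time_space_def case_prod_beta' .
qed

lemma ito_integral2_eq_ito_sum:
  assumes BF: "brownian_family M T F (W :: bool \<Rightarrow> real \<Rightarrow> 'a \<Rightarrow> real)"
  shows "ito_integral2 M F T (W False) (W True) \<gamma> = brownian_family.ito_sum M T F W (component \<gamma>)"
proof -
  interpret brownian_family M T F W by (rule BF)
  show ?thesis
    unfolding ito_integral2_def[abs_def] ito_sum_def[abs_def] by (simp add: UNIV_bool component_def add.commute)
qed

text \<open>The reward functional of the state, as a function of the scenario, depends only on what generates the
  control.\<close>

lemma reward_measurable:
  fixes u x :: "real \<Rightarrow> 'a \<Rightarrow> real" and f r :: "real \<Rightarrow> real \<Rightarrow> real"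
  assumes T: "0 < T" and N: "space N = space M" and ne: "space M \<noteq> {}"
    and U: "compact U"
    and f: "continuous_on (UNIV \<times> U) (\<lambda>(y, v). f y v)"
    and df: "\<forall>y. \<forall>v\<in>U. (\<lambda>z. f z v) differentiable at y \<and> \<bar>deriv (\<lambda>z. f z v) y\<bar> \<le> K"
    and \<mu>: "\<mu> \<in> borel_measurable (restrict_space borel {0..T})"
    and l: "l \<in> borel_measurable (restrict_space borel {0..T})"
    and r: "(\<lambda>(y, v). r y v) \<in> borel_measurable borel"
    and um: "(\<lambda>(s, \<omega>). u s \<omega>) \<in> borel_measurable (restrict_space borel {0..T} \<Otimes>\<^sub>M N)"
    and uU: "\<forall>t\<in>{0..T}. \<forall>\<omega>\<in>space M. u t \<omega> \<in> U"
    and x: "state_solution M T f x0 u x"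
  shows "(\<lambda>\<omega>. LBINT t:{0..T}. agent_reward \<mu> l r t (x t \<omega>) (u t \<omega>)) \<in> borel_measurable N"
proof -
  let ?R = "restrict_space borel {0..T} \<Otimes>\<^sub>M N"
  let ?L = "restrict_space lborel {0..T}"
  interpret L: finite_measure ?L
    using T by (intro finite_measureI) (simp add: emeasure_restrict_space space_restrict_space)
  \<comment> \<open>a strictly positive Lipschitz constant\<close>
  define K' where "K' = \<bar>K\<bar> + 1"
  have um': "(\<lambda>z. u (fst z) (snd z)) \<in> borel_measurable ?R" using um by (simp add: case_prod_beta')
  have lip: "\<bar>f y v - f y' v\<bar> \<le> K' * \<bar>y - y'\<bar>" if v: "v \<in> U" for y y' v
  proof -
    have "norm (f y v - f y' v) \<le> K' * norm (y - y')"
    proof (rule field_differentiable_bound[OF convex_UNIV, where f'="\<lambda>z. deriv (\<lambda>z. f z v) z"])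
      fix z :: real
      have "(\<lambda>z. f z v) differentiable at z" using df v by blast
      then show "((\<lambda>z. f z v) has_field_derivative deriv (\<lambda>z. f z v) z) (at z within UNIV)"
        using DERIV_deriv_iff_real_differentiable by simp
      have "\<bar>deriv (\<lambda>z. f z v) z\<bar> \<le> K" using df v by blast
      then show "norm (deriv (\<lambda>z. f z v) z) \<le> K'" unfolding K'_def by simp
    qed simp_all
    then show ?thesis by simp
  qed
  have "closed (UNIV \<times> U :: (real \<times> real) set)" by (intro closed_Times closed_UNIV compact_imp_closed[OF U])
  then have V: "(UNIV \<times> U :: (real \<times> real) set) \<in> sets borel" by (rule borel_closed)
  have fU: "(\<lambda>z. indicator (UNIV \<times> U) z * f (fst z) (snd z)) \<in> borel_measurable borel"
    using borel_measurable_continuous_on_indicator[OF V f] by (simp add: case_prod_beta')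
  have Lint: "(LBINT s:{0..t}. g s) = (\<integral>s. indicator {..t} s * g s \<partial>?L)" if "t \<in> {0..T}" for t and g :: "real \<Rightarrow> real"
  proof -
    have "(\<integral>s. indicator {..t} s * g s \<partial>?L) = (\<integral>s. indicator {0..T} s *\<^sub>R (indicator {..t} s * g s) \<partial>lborel)"
      by (rule integral_restrict_space) simp
    also have "\<dots> = (LBINT s:{0..t}. g s)"
      unfolding set_lebesgue_integral_def using that
      by (intro Bochner_Integration.integral_cong refl) (auto simp: indicator_def)
    finally show ?thesis by simp
  qed
  have xm: "(\<lambda>z. x (fst z) (snd z)) \<in> borel_measurable ?R"
  proof (rule integral_equation_measurable[where f=f and u=u and x=x and V="UNIV \<times> U" and K=K', OF T _ fU um'])
    show "0 < K'" unfolding K'_def by simp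
    show "(y, u t \<omega>) \<in> UNIV \<times> U" if "t \<in> {0..T}" "\<omega> \<in> space N" for t \<omega> y
      using uU that N by simp
    show "\<bar>f y (u t \<omega>) - f y' (u t \<omega>)\<bar> \<le> K' * \<bar>y - y'\<bar>" if "t \<in> {0..T}" "\<omega> \<in> space N" for t \<omega> y y'
      by (rule lip) (use uU that N in simp)
    show "integrable ?L (\<lambda>s. f (x s \<omega>) (u s \<omega>))" if "\<omega> \<in> space N" for \<omega>
      using x that N unfolding state_solution_def set_integrable_def
      by (subst integrable_restrict_space) simp_all
    show "x t \<omega> = x0 + (\<integral>s. indicator {..t} s * f (x s \<omega>) (u s \<omega>) \<partial>?L)" if "\<omega> \<in> space N" "t \<in> {0..T}" for \<omega> t
      using x that N unfolding state_solution_def Lint[OF that(2), symmetric] by blast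
  qed
  have LB: "(\<lambda>s. s) \<in> measurable ?L (restrict_space borel {0..T})"
    by (intro measurable_ident_sets sets_restrict_space_cong) simp
  have swap: "(\<lambda>p. (snd p, fst p)) \<in> measurable (N \<Otimes>\<^sub>M ?L) ?R"
    using measurable_compose[OF measurable_snd[of N ?L] LB] by (intro measurable_Pair) simp_all
  have t: "(\<lambda>z. \<mu> (fst z)) \<in> borel_measurable ?R" "(\<lambda>z. l (fst z)) \<in> borel_measurable ?R"
    by (rule measurable_compose[OF measurable_fst \<mu>], rule measurable_compose[OF measurable_fst l])
  have rm: "(\<lambda>z. r (x (fst z) (snd z)) (u (fst z) (snd z))) \<in> borel_measurable ?R"
    using measurable_compose[OF borel_measurable_Pair[OF xm um'] r] by simp
  have "(\<lambda>z. agent_reward \<mu> l r (fst z) (x (fst z) (snd z)) (u (fst z) (snd z))) \<in> borel_measurable ?R"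
    unfolding agent_reward_def
    by (intro borel_measurable_add borel_measurable_times borel_measurable_uminus t um' rm)
  from measurable_compose[OF swap this]
  have "(\<lambda>(\<omega>, t). agent_reward \<mu> l r t (x t \<omega>) (u t \<omega>)) \<in> borel_measurable (N \<Otimes>\<^sub>M ?L)" by (simp add: case_prod_beta')
  from L.borel_measurable_lebesgue_integral[OF this]
  have "(\<lambda>\<omega>. \<integral>t. agent_reward \<mu> l r t (x t \<omega>) (u t \<omega>) \<partial>?L) \<in> borel_measurable N" .
  moreover have "(\<integral>t. agent_reward \<mu> l r t (x t \<omega>) (u t \<omega>) \<partial>?L) = (LBINT t:{0..T}. agent_reward \<mu> l r t (x t \<omega>) (u t \<omega>))" for \<omega>
    unfolding set_lebesgue_integral_def by (rule integral_restrict_space) simp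
  ultimately show ?thesis by simp
qed

lemma (in brownian_family) deterministic_L2_progressive:
  assumes g: "g \<in> borel_measurable (restrict_space borel {0..T})" and B: "\<And>t. t \<in> {0..T} \<Longrightarrow> \<bar>g t\<bar> \<le> B"
  shows "L2_progressive (\<lambda>t _. g t)"
  unfolding L2_progressive_def
proof
  show prog: "progressively_measurable F T (\<lambda>t _. g t)"
    unfolding progressively_measurable_def
  proof
    fix t assume "t \<in> {0..T}"
    then have "g \<in> borel_measurable (restrict_space borel {0..t})"
      by (intro measurable_restrict_mono[OF g]) simp
    from measurable_compose[OF measurable_fst this]
    show "(\<lambda>(s, \<omega>). g s) \<in> borel_measurable (restrict_space borel {0..t} \<Otimes>\<^sub>M F t)" by (simp add: case_prod_beta')
  qed
  interpret P: finite_measure time_space by (rule finite_measure_time_space)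
  show "integrable time_space (\<lambda>z. (g (fst z))\<^sup>2)"
  proof (rule P.integrable_const_bound[of _ "B\<^sup>2"])
    show "AE z in time_space. norm ((g (fst z))\<^sup>2) \<le> B\<^sup>2"
    proof (rule AE_I2)
      fix z assume "z \<in> space time_space"
      then have "fst z \<in> {0..T}" unfolding space_time_space by auto
      from B[OF this] have "(g (fst z))\<^sup>2 \<le> B\<^sup>2" by (metis abs_ge_zero power2_abs power_mono)
      then show "norm ((g (fst z))\<^sup>2) \<le> B\<^sup>2" by simp
    qed
    show "(\<lambda>z. (g (fst z))\<^sup>2) \<in> borel_measurable time_space"
      by (intro borel_measurable_power progressive_time_space[OF prog])
  qed
qed

text \<open>The equivalence for an arbitrary payoff that is almost surely a functional of the two
  driving Brownian motions.\<close>

lemma variance_at_most_iff_represented: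
  fixes S :: real
  assumes BF: "brownian_family M T F (W :: bool \<Rightarrow> real \<Rightarrow> 'a \<Rightarrow> real)"
    and J: "J \<in> borel_measurable M" and J': "J' \<in> borel_measurable (F T)" "AE \<omega> in M. J \<omega> = J' \<omega>"
  defines "represents \<equiv> \<lambda>\<gamma>. (AE \<omega> in M. J \<omega> = prob_space.expectation M J + ito_integral2 M F T (W False) (W True) \<gamma> \<omega>)
      \<and> prob_space.expectation M (\<lambda>\<omega>. LBINT t:{0..T}. (norm (\<gamma> t \<omega>))\<^sup>2) \<le> S"
  shows "variance_at_most M J S \<longleftrightarrow>
    (\<exists>\<gamma> \<in> square_integrable_processes M F T. represents \<gamma> \<and>
       (\<forall>\<gamma>' \<in> square_integrable_processes M F T. represents \<gamma>' \<longrightarrow>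
          (AE (t, \<omega>) in restrict_space lborel {0..T} \<Otimes>\<^sub>M M. \<gamma>' t \<omega> = \<gamma> t \<omega>)))"
proof -
  interpret brownian_family M T F W by (rule BF)
  note I2 = ito_integral2_eq_ito_sum[OF BF]
  note SI = square_integrable_processes_iff[OF BF]
  have var: "expectation (\<lambda>\<omega>. (ito_sum (component \<gamma>) \<omega>)\<^sup>2) = variance J \<and> integrable M (\<lambda>\<omega>. (J \<omega>)\<^sup>2)"
    if \<gamma>: "\<And>b. L2_progressive (component \<gamma> b)" and eq: "AE \<omega> in M. J \<omega> = expectation J + ito_sum (component \<gamma>) \<omega>" for \<gamma>
  proof
    have Im: "ito_sum (component \<gamma>) \<in> borel_measurable M" by (rule ito_sum_measurable[of "component \<gamma>", OF \<gamma>])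
    have Is: "integrable M (\<lambda>\<omega>. (ito_sum (component \<gamma>) \<omega>)\<^sup>2)" by (rule ito_sum_isometry(1)[of "component \<gamma>", OF \<gamma>])
    show "expectation (\<lambda>\<omega>. (ito_sum (component \<gamma>) \<omega>)\<^sup>2) = variance J"
    proof (rule integral_cong_AE)
      show "AE \<omega> in M. (ito_sum (component \<gamma>) \<omega>)\<^sup>2 = (J \<omega> - expectation J)\<^sup>2" using eq by eventually_elim simp
    qed (use Im J in simp_all)
    have "integrable M (\<lambda>\<omega>. (expectation J + ito_sum (component \<gamma>) \<omega>)\<^sup>2)"
      by (intro square_integrable_add Im Is) simp_all
    then show "integrable M (\<lambda>\<omega>. (J \<omega>)\<^sup>2)"
    proof (rule integrable_cong_AE_imp)
      show "AE \<omega> in M. (expectation J + ito_sum (component \<gamma>) \<omega>)\<^sup>2 = (J \<omega>)\<^sup>2" using eq by eventually_elim simp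
    qed (use J in simp)
  qed
  show ?thesis
  proof
    assume V: "variance_at_most M J S"
    then have J2: "integrable M (\<lambda>\<omega>. (J \<omega>)\<^sup>2)" and VS: "variance J \<le> S" unfolding variance_at_most_def by blast+
    have J'M: "J' \<in> borel_measurable M" by (rule measurable_F_M[OF J'(1)]) (use T_pos in linarith)+
    have "integrable M (\<lambda>\<omega>. (J' \<omega>)\<^sup>2)"
      using J2
    proof (rule integrable_cong_AE_imp)
      show "AE \<omega> in M. (J \<omega>)\<^sup>2 = (J' \<omega>)\<^sup>2" using J'(2) by eventually_elim simp
    qed (use J'M in simp)
    from martingale_representation[OF J'(1) this] obtain g where g: "\<And>b. L2_progressive (g b)"
      and rep: "AE \<omega> in M. J' \<omega> = expectation J' + ito_sum g \<omega>" by blast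
    define \<gamma> where "\<gamma> t \<omega> = (g False t \<omega>, g True t \<omega>)" for t \<omega>
    have c: "component \<gamma> = g"
    proof
      fix b show "component \<gamma> b = g b" by (cases b) (simp_all add: component_def \<gamma>_def)
    qed
    have \<gamma>: "\<And>b. L2_progressive (component \<gamma> b)" unfolding c by (rule g)
    have EJ: "expectation J' = expectation J"
      by (rule integral_cong_AE) (use J J'M J'(2) in \<open>auto elim!: eventually_mono\<close>)
    have eq: "AE \<omega> in M. J \<omega> = expectation J + ito_sum (component \<gamma>) \<omega>"
      using rep J'(2) unfolding c EJ by eventually_elim simp
    have "represents \<gamma>"
      unfolding represents_def I2 expectation_norm_square[OF BF \<gamma>] using eq var[OF \<gamma> eq] VS by simp
    moreover have "\<gamma> \<in> square_integrable_processes M F T" unfolding SI using \<gamma> by blast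
    moreover have "AE (t, \<omega>) in restrict_space lborel {0..T} \<Otimes>\<^sub>M M. \<gamma>' t \<omega> = \<gamma> t \<omega>"
      if \<gamma>': "\<gamma>' \<in> square_integrable_processes M F T" "represents \<gamma>'" for \<gamma>'
    proof (rule ito_sum_eq_imp_AE_eq[OF BF _ \<gamma>])
      show "L2_progressive (component \<gamma>' b)" for b using \<gamma>'(1) unfolding SI by blast
      have "AE \<omega> in M. J \<omega> = expectation J + ito_sum (component \<gamma>') \<omega>"
        using \<gamma>'(2) unfolding represents_def I2 by blast
      with eq show "AE \<omega> in M. ito_sum (component \<gamma>') \<omega> = ito_sum (component \<gamma>) \<omega>" by eventually_elim simp
    qed
    ultimately show "\<exists>\<gamma> \<in> square_integrable_processes M F T. represents \<gamma> \<and>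
       (\<forall>\<gamma>' \<in> square_integrable_processes M F T. represents \<gamma>' \<longrightarrow>
          (AE (t, \<omega>) in restrict_space lborel {0..T} \<Otimes>\<^sub>M M. \<gamma>' t \<omega> = \<gamma> t \<omega>))" by blast
  next
    assume "\<exists>\<gamma> \<in> square_integrable_processes M F T. represents \<gamma> \<and>
       (\<forall>\<gamma>' \<in> square_integrable_processes M F T. represents \<gamma>' \<longrightarrow>
          (AE (t, \<omega>) in restrict_space lborel {0..T} \<Otimes>\<^sub>M M. \<gamma>' t \<omega> = \<gamma> t \<omega>))"
    then obtain \<gamma> where G: "\<gamma> \<in> square_integrable_processes M F T" and rep: "represents \<gamma>" by blast
    have \<gamma>: "L2_progressive (component \<gamma> b)" for b using G unfolding SI by blast
    have eq: "AE \<omega> in M. J \<omega> = expectation J + ito_sum (component \<gamma>) \<omega>"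
      and le: "expectation (\<lambda>\<omega>. (ito_sum (component \<gamma>) \<omega>)\<^sup>2) \<le> S"
      using rep unfolding represents_def I2 expectation_norm_square[OF BF \<gamma>] by blast+
    show "variance_at_most M J S"
      unfolding variance_at_most_def using var[OF \<gamma> eq] le by simp
  qed
qed

theorem theorem1:
  fixes M :: "'a measure" and T :: real and n i :: nat
    and W :: "nat \<Rightarrow> real \<Rightarrow> 'a \<Rightarrow> real" and F :: "real \<Rightarrow> 'a measure"
    and U :: "real set" and f r :: "real \<Rightarrow> real \<Rightarrow> real" and \<mu> \<sigma> l \<sigma>A :: "real \<Rightarrow> real"
    and rA :: "real \<Rightarrow> real \<Rightarrow> real \<Rightarrow> real"
    and x0 K B0 B1 S :: real
    and u x :: "real \<Rightarrow> 'a \<Rightarrow> real" and C J :: "'a \<Rightarrow> real"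
  assumes "prob_space M" and "T > 0" and "n \<ge> 1" and "i \<in> {1..n}"
    and "\<forall>j\<in>{0..n}. standard_brownian_motion M T (W j)"
    and "independent_processes M T {0..n} W"
    and "F = natural_filtration M (\<lambda>t \<omega>. (W 0 t \<omega>, W i t \<omega>))"
    and "compact U"
    and "continuous_on (UNIV \<times> U) (\<lambda>(y, v). f y v)"
    and "\<forall>y. \<forall>v\<in>U. (\<lambda>z. f z v) differentiable at y \<and> \<bar>deriv (\<lambda>z. f z v) y\<bar> \<le> K"
    and "\<forall>y. \<forall>v\<in>U. \<bar>f y v\<bar> \<le> K * (1 + \<bar>y\<bar> + \<bar>v\<bar>)"
    and "\<mu> \<in> borel_measurable (restrict_space borel {0..T})" and "bounded (\<mu> ` {0..T})"
    and "\<sigma> \<in> borel_measurable (restrict_space borel {0..T})" and "bounded (\<sigma> ` {0..T})"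
    and "l \<in> borel_measurable (restrict_space borel {0..T})"
    and "(\<lambda>(y, v). r y v) \<in> borel_measurable borel"
    and "rA = agent_reward \<mu> l r" and "\<sigma>A = agent_volatility \<mu> \<sigma>"
    and "\<forall>t\<in>{0..T}. \<forall>y. \<forall>v\<in>U. \<bar>rA t y v\<bar> \<le> B0 + B1 * \<bar>y\<bar>"
    and "u \<in> controls M F T U" and "C \<in> compensations F T"
    and "state_solution M T f x0 u x"
    and "J = agent_payoff M F T (W i) rA \<sigma>A x C u"
  defines "represents \<equiv> \<lambda>\<gamma>.
      (AE \<omega> in M. C \<omega> = prob_space.expectation M J - (LBINT t:{0..T}. rA t (x t \<omega>) (u t \<omega>))
         - ito_integral M F T (W i) (\<lambda>t _. \<sigma>A t) \<omega> + ito_integral2 M F T (W 0) (W i) \<gamma> \<omega>)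
      \<and> prob_space.expectation M (\<lambda>\<omega>. LBINT t:{0..T}. (norm (\<gamma> t \<omega>))\<^sup>2) \<le> S"
  shows "variance_at_most M J S \<longleftrightarrow>
    (\<exists>\<gamma> \<in> square_integrable_processes M F T. represents \<gamma> \<and>
       (\<forall>\<gamma>' \<in> square_integrable_processes M F T. represents \<gamma>' \<longrightarrow>
          (AE (t, \<omega>) in restrict_space lborel {0..T} \<Otimes>\<^sub>M M. \<gamma>' t \<omega> = \<gamma> t \<omega>)))"
proof -
  interpret prob_space M by (rule assms(1))
  define V where "V b = W (if b then i else 0)" for b
  have V: "V False = W 0" "V True = W i" by (simp_all add: V_def)
  have i: "i \<noteq> 0" "i \<le> n" using assms(4) by simp_all
  have BF: "brownian_family M T F V"
  proof unfold_locales
    show "0 < T" by (rule assms(2))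
    show "standard_brownian_motion M T (V b)" for b
      using assms(5) i unfolding V_def by simp
    show "independent_processes M T UNIV V"
      unfolding V_def[abs_def]
    proof (rule independent_processes_reindex[OF assms(1) _ _ assms(6)])
      show "inj_on (\<lambda>b. if b then i else 0) UNIV" using i by (auto simp: inj_on_def)
      show "range (\<lambda>b. if b then i else 0) \<subseteq> {0..n}" using i by auto
    qed
    show "space (F t) = space M" for t
      unfolding assms(7) natural_filtration_def by (simp add: space_measure_of_conv)
    show "sets (F t) = sigma_sets (space M) {V a s -` A \<inter> space M |a s A. 0 \<le> s \<and> s \<le> t \<and> A \<in> sets borel}" for t
    proof -
      have "(if b then W i else W 0) = V b" for b by (simp add: V_def)
      then show ?thesis unfolding assms(7) sets_natural_filtration_pair by (simp only:)
    qed
  qed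
  interpret brownian_family M T F V by (rule BF)
  obtain Bm where "\<forall>y\<in>\<mu> ` {0..T}. norm y \<le> Bm" using assms(13) unfolding bounded_iff by blast
  then have Bm: "\<bar>\<mu> t\<bar> \<le> Bm" if "t \<in> {0..T}" for t using that by simp
  obtain Bs where "\<forall>y\<in>\<sigma> ` {0..T}. norm y \<le> Bs" using assms(15) unfolding bounded_iff by blast
  then have Bs: "\<bar>\<sigma> t\<bar> \<le> Bs" if "t \<in> {0..T}" for t using that by simp
  have vol: "L2_progressive (\<lambda>t _. \<sigma>A t)"
  proof (rule deterministic_L2_progressive[where B="Bm * Bs"])
    show "\<sigma>A \<in> borel_measurable (restrict_space borel {0..T})"
      unfolding assms(19) agent_volatility_def[abs_def]
      by (intro borel_measurable_times borel_measurable_uminus assms(12,14))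
    show "\<bar>\<sigma>A t\<bar> \<le> Bm * Bs" if "t \<in> {0..T}" for t
      unfolding assms(19) agent_volatility_def abs_mult abs_minus_cancel
      by (intro mult_mono Bm Bs that abs_ge_zero order_trans[OF abs_ge_zero Bm[OF that]])
  qed
  have Cm: "C \<in> borel_measurable (F T)" using assms(22) unfolding compensations_def .
  have um: "(\<lambda>(s, \<omega>). u s \<omega>) \<in> borel_measurable (restrict_space borel {0..T} \<Otimes>\<^sub>M F T)"
    and uU: "\<forall>t\<in>{0..T}. \<forall>\<omega>\<in>space M. u t \<omega> \<in> U"
    using assms(21) assms(2) unfolding controls_def progressively_measurable_def by auto
  define R where "R \<omega> = (LBINT t:{0..T}. rA t (x t \<omega>) (u t \<omega>))" for \<omega>
  have RF: "R \<in> borel_measurable (F T)"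
    unfolding R_def[abs_def] assms(18)
    by (rule reward_measurable[OF assms(2) space_F not_empty assms(8,9,10,12,16,17) um uU assms(23)])
  define Z where "Z = ito_integral M F T (W i) (\<lambda>t _. \<sigma>A t)"
  have ZM: "Z \<in> borel_measurable M"
    using ito_integral_approx[OF vol, where a=True] unfolding Z_def V by blast
  obtain Z' where Z': "Z' \<in> borel_measurable (F T)" "AE \<omega> in M. Z \<omega> = Z' \<omega>"
    using ito_integral_terminal_measurable[OF vol, where a=True] unfolding Z_def V by blast
  have Jeq: "J \<omega> = R \<omega> + Z \<omega> + C \<omega>" for \<omega>
    unfolding assms(24) agent_payoff_def R_def Z_def ..
  have T: "0 \<le> T" using assms(2) by simp
  have JM: "J \<in> borel_measurable M"
    unfolding Jeq[abs_def]
    by (intro borel_measurable_add ZM measurable_F_M[OF RF T order_refl] measurable_F_M[OF Cm T order_refl])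
  have J'F: "(\<lambda>\<omega>. R \<omega> + Z' \<omega> + C \<omega>) \<in> borel_measurable (F T)"
    by (intro borel_measurable_add RF Cm Z'(1))
  have JJ': "AE \<omega> in M. J \<omega> = R \<omega> + Z' \<omega> + C \<omega>"
    using Z'(2) by eventually_elim (simp add: Jeq)
  \<comment> \<open>solving for \<open>C\<close> turns the representation of \<open>C\<close> into one of \<open>J\<close>\<close>
  have C_iff: "C \<omega> = e - (LBINT t:{0..T}. rA t (x t \<omega>) (u t \<omega>)) - ito_integral M F T (W i) (\<lambda>t _. \<sigma>A t) \<omega> + y
      \<longleftrightarrow> J \<omega> = e + y" for \<omega> e y
    unfolding Jeq R_def Z_def by linarith
  show ?thesis
    unfolding represents_def C_iff
    using variance_at_most_iff_represented[OF BF JM J'F JJ', of S] unfolding V .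
qed

end
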